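(* Let $k,n\ge 0$ be integers with $k\le n-4$. The $\oplus$-diagrams in $\mathcal D_{n,k,4}$ index the $(k,n)$-BCFW cells: the map $D\mapsto S_D$ is a bijection from $\mathcal D_{n,k,4}$ onto the set $\mathcal C_{n,k,4}$ of $(k,n)$-BCFW cells of $\mathrm{Gr}_{k,n}^{\ge 0}$.
   Context: $\mathrm{Gr}_{k,n}$ is the real Grassmannian of $k$-dimensional subspaces of $\mathbb R^n$ (row spans of $k\times n$ matrices); $\mathrm{Gr}_{k,n}^{\ge 0}$ is the set of $V$ representable by a matrix all of whose $k\times k$ minors are nonnegative. $[n]=\{1,\dots,n\}$. **Decorated permutations and positroid cells.** A decorated permutation of $[n]$ is a permutation of $[n]$ with each fixed point colored black or white. For $V\in\mathrm{Gr}_{k,n}^{\ge 0}$ represented by a matrix with columns $v_1,\dots,v_n$, put $v_{j+n}=v_j$; the decorated permutation $\pi_V$ sends $i$ to the residue in $[n]$ mod $n$ of the smallest $j\ge i$ with $v_i\in\mathrm{span}(v_{i+1},\dots,v_j)$ (so $j=i$ iff $v_i=0$); a fixed point $i$ is black if $j=i$ and white if $j=i+n$. The positroid cell of a decorated permutation $\pi$ is $S_\pi=\{V:\pi_V=\pi\}$. **$\oplus$-diagrams.** A $\oplus$-diagram $D$ of type $(k,n)$ is a filling with symbols $0,+$ of a Young diagram (English notation) inside a $k\times(n-k)$ rectangle. Its decorated permutation $\pi_D$: label the $n$ unit steps of the southeast border of the Young diagram (a lattice path from the northeast to the southwest corner of the rectangle) by $1,\dots,n$, and label each edge of the northwest border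 by the label of the opposite edge (same row or column) of the southeast border. A pipe starts at each southeast border edge and travels northwest: in a box with $0$ it goes straight; in a box with $+$, a pipe entering through the right edge leaves through the top edge and a pipe entering through the bottom edge leaves through the left edge. If the pipe starting at $i$ ends at $j$, then $\pi_D(i)=j$; a fixed point is black if $i$ labels horizontal edges, white if $i$ labels vertical edges. Put $S_D=S_{\pi_D}$. **Lattice paths and $\mathcal D_{n,k,4}$.** $\mathcal L_{n,k,4}$ is the set of pairs $(W_U,W_L)$ of lattice paths in a $k\times(n-k-4)$ rectangle, each going from the northeast to the southwest corner by unit steps west ($H$) and south ($V$), with $W_L$ weakly below $W_U$ (overlaps allowed). Let $Y_U,Y_L$ be the Young diagrams in the rectangle with southeast borders $W_U,W_L$. Define $D=\Omega_{\mathcal L\mathcal D}(W_U,W_L)$, a $\oplus$-diagram of type $(k,n)$, by: (1) the Young diagram of $D$ is $Y_L$ with four extra columns of height $k$ added at the left; place $+$ in the leftmost and rightmost box of each row, other boxes empty. (2) Read the columns of $Y_U$ from left to right; for each column of height $i$, place $0$'s in the top $i$ boxes of the rightmost column of $D$ whose top $i$ boxes all exist and are currently empty. (3) In each row place $+$ in the two rightmost empty boxes. (4) Fill all remaining boxes with $0$. Then $\mathcal D_{n,k,4}$ is the image of $\Omega_{\mathcal L\mathcal D}$ on $\mathcal L_{n,k,4}$. **Plabic graphs.** A plabic graph is a planar graph in a disk with boundary vertices $1,\dots,n$ in clockwise order, each incident to a single edge, and internal vertices colored black or white. Its permutation $\pi_G$: from boundary vertex $i$ follow edges, turning maximally right at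 black and maximally left at white internal vertices, ending at boundary vertex $\pi_G(i)$. *Blowing up at $i$*: let boundary vertex $i$ be adjacent to an internal vertex $v$ of degree $3$, whose edges in clockwise order are (the edge to $i$), $e$, $f$. Replace $v$ by a 4-cycle $a,b,c,d$ (clockwise) with $a,c$ black and $b,d$ white; attach $e$ to $a$ and $f$ to $b$; join $c$ to boundary vertex $i$ and $d$ to a new boundary vertex $i+1$ placed next clockwise after $i$; the old labels $i+1,\dots,n$ increase by $1$. **BCFW cells.** For $2\le k\le n-2$ define sets $\tilde{\mathcal G}_{n,k,4}$ of plabic graphs: $\tilde{\mathcal G}_{4,2,4}$ consists of the single graph formed by a 4-cycle whose vertices in clockwise order are white, black, white, black and are joined respectively to boundary vertices $1,2,3,4$. For $n\ge 5$, $\tilde{\mathcal G}_{n,k,4}$ is the set of all graphs obtained by blowing up a graph in $\tilde{\mathcal G}_{n-1,k,4}$ at some $i\ne 1,n-1$ adjacent to a black vertex, or a graph in $\tilde{\mathcal G}_{n-1,k-1,4}$ at some $i\neq 1,n-1$ adjacent to a white vertex. Let $c_n$ be the $n$-cycle $n\mapsto n-1\mapsto\cdots\mapsto 1\mapsto n$ (products of permutations are composed right to left). For $0\le k\le n-4$, $\Pi_{n,k,4}=\{c_n^2\pi_G: G\in\tilde{\mathcal G}_{n,k+2,4}\}$, with all fixed points colored black, and $\mathcal C_{n,k,4}=\{S_\pi:\pi\in\Pi_{n,k,4}\}$; its members are the $(k,n)$-BCFW cells. *)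

theory Defs
  imports
    "Jordan_Normal_Form.Determinant"
    "Jordan_Normal_Form.VS_Connect"
    "Jordan_Normal_Form.DL_Submatrix"
begin

datatype colour = Black | White

(* A decorated permutation of {1..n}: the permutation is extended by the identity
   outside {1..n}, and the second component is defined exactly on the fixed points
   in {1..n}, so that equality of pairs is equality of decorated permutations. *)
type_synonym decorated_perm = "(nat \<Rightarrow> nat) \<times> (nat \<Rightarrow> colour option)"


section \<open>The nonnegative Grassmannian and positroid cells\<close>

definition grassmannian :: "nat \<Rightarrow> nat \<Rightarrow> real vec set set" where
  "grassmannian k n =
     {V. VectorSpace.subspace class_ring V (module_vec TYPE(real) n) \<and>
         vectorspace.dim class_ring ((module_vec TYPE(real) n)\<lparr>carrier := V\<rparr>) = k}"

definition represents :: "nat \<Rightarrow> nat \<Rightarrow> real mat \<Rightarrow> real vec set \<Rightarrow> bool" where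
  "represents k n A V \<longleftrightarrow> A \<in> carrier_mat k n \<and> vec_space.row_space n A = V"

definition tnn_grassmannian :: "nat \<Rightarrow> nat \<Rightarrow> real vec set set" where
  "tnn_grassmannian k n =
     {V \<in> grassmannian k n. \<exists>A. represents k n A V \<and>
        (\<forall>J \<subseteq> {0..<n}. card J = k \<longrightarrow> det (submatrix A UNIV J) \<ge> 0)}"

(* The representative in {1..n} modulo n, for j at least 1. *)
definition residue :: "nat \<Rightarrow> nat \<Rightarrow> nat" where
  "residue n j = (j - 1) mod n + 1"

(* Columns are numbered cyclically from 1, whereas matrix indices start at 0. *)
definition cyc_col :: "nat \<Rightarrow> real mat \<Rightarrow> nat \<Rightarrow> real vec" where
  "cyc_col n A j = col A (residue n j - 1)"

(* For i in {1..n} such a j exists and is at most i + n. *)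
definition first_return :: "nat \<Rightarrow> nat \<Rightarrow> real mat \<Rightarrow> nat \<Rightarrow> nat" where
  "first_return k n A i =
     (LEAST j. i \<le> j \<and> cyc_col n A i \<in>
        LinearCombinations.module.span class_ring (module_vec TYPE(real) k) (cyc_col n A ` {i<..j}))"

definition mat_decorated_perm :: "nat \<Rightarrow> nat \<Rightarrow> real mat \<Rightarrow> decorated_perm" where
  "mat_decorated_perm k n A =
     (\<lambda>i. if i \<in> {1..n} then residue n (first_return k n A i) else i,
      \<lambda>i. if i \<in> {1..n} then
             (if first_return k n A i = i then Some Black
              else if first_return k n A i = i + n then Some White
              else None)
           else None)"

(* The choice of the representing matrix is immaterial: two representing matrices differ by
   invertible row operations, which preserve all linear relations between columns. *)
definition space_decorated_perm :: "nat \<Rightarrow> nat \<Rightarrow> real vec set \<Rightarrow> decorated_perm" where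
  "space_decorated_perm k n V = mat_decorated_perm k n (SOME A. represents k n A V)"

definition positroid_cell :: "nat \<Rightarrow> nat \<Rightarrow> decorated_perm \<Rightarrow> real vec set set" where
  "positroid_cell k n \<pi> = {V \<in> tnn_grassmannian k n. space_decorated_perm k n V = \<pi>}"


section \<open>Diagrams and their decorated permutations\<close>

datatype symbol = Zero | Plus

(* A diagram of type (k,n) is a partial map whose domain is its Young diagram, a set of boxes
   (r,c) with row r < k counted from the top and column c < n - k counted from the left. *)
type_synonym diagram = "nat \<times> nat \<Rightarrow> symbol option"

definition row_length :: "(nat \<times> nat) set \<Rightarrow> nat \<Rightarrow> nat" where
  "row_length Y r = card {c. (r, c) \<in> Y}"

definition col_height :: "(nat \<times> nat) set \<Rightarrow> nat \<Rightarrow> nat" where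
  "col_height Y c = card {r. (r, c) \<in> Y}"

(* VEdge r c is the vertical edge in row r and HEdge r c the horizontal edge in column c such that
   box (r,c) has left edge VEdge r c, right edge VEdge r (c+1), top edge HEdge r c and
   bottom edge HEdge (r+1) c. *)
datatype edge = VEdge nat nat | HEdge nat nat

function pipe_end :: "diagram \<Rightarrow> edge \<Rightarrow> edge" where
  "pipe_end D (VEdge r 0) = VEdge r 0"
| "pipe_end D (VEdge r (Suc c)) =
     (if D (r, c) = Some Plus then pipe_end D (HEdge r c) else pipe_end D (VEdge r c))"
| "pipe_end D (HEdge 0 c) = HEdge 0 c"
| "pipe_end D (HEdge (Suc r) c) =
     (if D (r, c) = Some Plus then pipe_end D (VEdge r c) else pipe_end D (HEdge r c))"
  by pat_completeness auto
termination
  by (relation "measure (\<lambda>(D, e). case e of VEdge r c \<Rightarrow> r + c | HEdge r c \<Rightarrow> r + c)") auto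

(* Opposite edges on the southeast and northwest border share a line. *)
datatype line = Row nat | Column nat

fun line_of :: "edge \<Rightarrow> line" where
  "line_of (VEdge r c) = Row r"
| "line_of (HEdge r c) = Column c"

definition lines :: "nat \<Rightarrow> nat \<Rightarrow> line set" where
  "lines k n = Row ` {0..<k} \<union> Column ` {0..<n - k}"

fun southeast_edge :: "(nat \<times> nat) set \<Rightarrow> line \<Rightarrow> edge" where
  "southeast_edge Y (Row r) = VEdge r (row_length Y r)"
| "southeast_edge Y (Column c) = HEdge (col_height Y c) c"

(* The position of the edge on the border path from the northeast corner: the vertical edge of
   row r is preceded by r south steps and n - k - row_length west steps, the horizontal edge of
   column c by col_height south steps and n - k - 1 - c west steps. *)
fun label :: "nat \<Rightarrow> nat \<Rightarrow> (nat \<times> nat) set \<Rightarrow> line \<Rightarrow> nat" where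
  "label k n Y (Row r) = r + (n - k - row_length Y r) + 1"
| "label k n Y (Column c) = col_height Y c + (n - k - 1 - c) + 1"

definition line_labelled :: "nat \<Rightarrow> nat \<Rightarrow> (nat \<times> nat) set \<Rightarrow> nat \<Rightarrow> line" where
  "line_labelled k n Y i = (THE l. l \<in> lines k n \<and> label k n Y l = i)"

definition diagram_perm :: "nat \<Rightarrow> nat \<Rightarrow> diagram \<Rightarrow> nat \<Rightarrow> nat" where
  "diagram_perm k n D i =
     (if i \<in> {1..n}
      then label k n (dom D)
             (line_of (pipe_end D (southeast_edge (dom D) (line_labelled k n (dom D) i))))
      else i)"

definition diagram_decorated_perm :: "nat \<Rightarrow> nat \<Rightarrow> diagram \<Rightarrow> decorated_perm" where
  "diagram_decorated_perm k n D =
     (diagram_perm k n D,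
      \<lambda>i. if i \<in> {1..n} \<and> diagram_perm k n D i = i
           then Some (case line_labelled k n (dom D) i of Column c \<Rightarrow> Black | Row r \<Rightarrow> White)
           else None)"

definition diagram_cell :: "nat \<Rightarrow> nat \<Rightarrow> diagram \<Rightarrow> real vec set set" where
  "diagram_cell k n D = positroid_cell k n (diagram_decorated_perm k n D)"


section \<open>Pairs of lattice paths\<close>

(* Paths start at the northeast corner. *)
datatype step = West | South

definition lattice_paths :: "nat \<Rightarrow> nat \<Rightarrow> step list set" where
  "lattice_paths h w = {p. count_list p South = h \<and> count_list p West = w}"

(* After equally many steps both paths are on a common antidiagonal, where being lower means
   having made more south steps. *)
definition weakly_below :: "step list \<Rightarrow> step list \<Rightarrow> bool" where
  "weakly_below q p \<longleftrightarrow> (\<forall>t. count_list (take t p) South \<le> count_list (take t q) South)"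

definition path_pairs :: "nat \<Rightarrow> nat \<Rightarrow> (step list \<times> step list) set" where
  "path_pairs n k =
     {(p, q). p \<in> lattice_paths k (n - k - 4) \<and> q \<in> lattice_paths k (n - k - 4) \<and> weakly_below q p}"

(* The boxes to the left of the r-th south step (counted from 0) are as many as the west steps
   that come after it. *)
definition young_of_path :: "step list \<Rightarrow> (nat \<times> nat) set" where
  "young_of_path p =
     {(r, c). \<exists>p1 p2. p = p1 @ South # p2 \<and> count_list p1 South = r \<and> c < count_list p2 West}"

definition add_four_columns :: "nat \<Rightarrow> (nat \<times> nat) set \<Rightarrow> (nat \<times> nat) set" where
  "add_four_columns k Y = {0..<k} \<times> {0..<4} \<union> (\<lambda>(r, c). (r, c + 4)) ` Y"

(* The four filling steps act on partial fillings F of a fixed shape Y; a box of Y is empty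
   if F is undefined there. *)
definition fill_ends :: "(nat \<times> nat) set \<Rightarrow> diagram" where
  "fill_ends Y = (\<lambda>(r, c). if (r, c) \<in> Y \<and> (c = 0 \<or> (r, Suc c) \<notin> Y) then Some Plus else None)"

(* For i = 0 nothing is placed, whatever column is chosen. *)
definition place_zeros :: "(nat \<times> nat) set \<Rightarrow> nat \<Rightarrow> diagram \<Rightarrow> diagram" where
  "place_zeros Y i F =
     (let c0 = (GREATEST c. \<forall>r<i. (r, c) \<in> Y \<and> F (r, c) = None)
      in (\<lambda>(r, c). if r < i \<and> c = c0 then Some Zero else F (r, c)))"

definition place_pluses :: "(nat \<times> nat) set \<Rightarrow> diagram \<Rightarrow> diagram" where
  "place_pluses Y F =
     (\<lambda>(r, c). if (r, c) \<in> Y \<and> F (r, c) = None \<and>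
                   card {c'. c < c' \<and> (r, c') \<in> Y \<and> F (r, c') = None} < 2
                then Some Plus else F (r, c))"

definition fill_rest :: "(nat \<times> nat) set \<Rightarrow> diagram \<Rightarrow> diagram" where
  "fill_rest Y F = (\<lambda>b. if b \<in> Y \<and> F b = None then Some Zero else F b)"

definition Omega_LD :: "nat \<Rightarrow> nat \<Rightarrow> step list \<times> step list \<Rightarrow> diagram" where
  "Omega_LD n k = (\<lambda>(p, q).
     let Y = add_four_columns k (young_of_path q);
         hs = map (col_height (young_of_path p)) [0..<n - k - 4]
     in fill_rest Y (place_pluses Y (fold (place_zeros Y) hs (fill_ends Y))))"

definition D_diagrams :: "nat \<Rightarrow> nat \<Rightarrow> diagram set" where
  "D_diagrams n k = Omega_LD n k ` path_pairs n k"


section \<open>Plabic graphs and BCFW cells\<close>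

datatype vertex = Boundary nat | Internal nat

(* A plabic graph is given by its rotation system. Each edge consists of two half-edges exchanged
   by opp; vert is the vertex a half-edge is attached to; cw is the next half-edge clockwise around
   the same vertex; col is the colour of internal vertices. Boundary vertex i is Boundary i. Only
   the values on half-edges of the graph and on its vertices are relevant. The graphs used here are
   a square drawn in the disk and local modifications of it that stay in the disk, so planarity
   need not be imposed separately. *)
record plabic =
  halves :: "nat set"
  opp :: "nat \<Rightarrow> nat"
  cw :: "nat \<Rightarrow> nat"
  vert :: "nat \<Rightarrow> vertex"
  col :: "nat \<Rightarrow> colour"

hide_const (open) col

(* Arriving at a vertex through half-edge h, the rightmost continuation is the half-edge
   preceding h in clockwise order, and the leftmost one is the half-edge following h. *)
definition turn :: "plabic \<Rightarrow> nat \<Rightarrow> nat \<Rightarrow> nat" where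
  "turn G v h = (case plabic.col G v of
                   Black \<Rightarrow> the_inv_into (halves G) (cw G) h
                 | White \<Rightarrow> cw G h)"

(* trip G h j: leaving a vertex along the half-edge h, one ends at boundary vertex j. *)
inductive trip :: "plabic \<Rightarrow> nat \<Rightarrow> nat \<Rightarrow> bool" for G where
  "vert G (opp G h) = Boundary j \<Longrightarrow> trip G h j"
| "vert G (opp G h) = Internal v \<Longrightarrow> trip G (turn G v (opp G h)) j \<Longrightarrow> trip G h j"

definition trip_perm :: "nat \<Rightarrow> plabic \<Rightarrow> nat \<Rightarrow> nat" where
  "trip_perm n G i =
     (if i \<in> {1..n} then THE j. \<exists>h\<in>halves G. vert G h = Boundary i \<and> trip G h j else i)"

(* In the next two definitions ab is the half-edge at the internal vertex a of the edge from a to b,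
   and so on. The internal vertices of the square are a, b, c, d in clockwise order; the half-edge
   xa at a leads to the half-edge za at the boundary. The names of half-edges and internal vertices
   are arbitrary, so the predicates hold for all graphs isomorphic to the ones described. *)
inductive square_graph :: "plabic \<Rightarrow> bool" where
  "\<lbrakk>distinct [ab, ba, bc, cb, cd, dc, da, ad, xa, xb, xc, xd, za, zb, zc, zd];
    halves G = {ab, ba, bc, cb, cd, dc, da, ad, xa, xb, xc, xd, za, zb, zc, zd};
    map (opp G) [ab, ba, bc, cb, cd, dc, da, ad] = [ba, ab, cb, bc, dc, cd, ad, da];
    map (opp G) [xa, xb, xc, xd, za, zb, zc, zd] = [za, zb, zc, zd, xa, xb, xc, xd];
    map (cw G) [xa, ab, ad] = [ab, ad, xa];
    map (cw G) [xb, bc, ba] = [bc, ba, xb];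
    map (cw G) [xc, cd, cb] = [cd, cb, xc];
    map (cw G) [xd, da, dc] = [da, dc, xd];
    map (cw G) [za, zb, zc, zd] = [za, zb, zc, zd];
    distinct [a, b, c, d];
    map (vert G) [xa, ab, ad] = replicate 3 (Internal a);
    map (vert G) [xb, bc, ba] = replicate 3 (Internal b);
    map (vert G) [xc, cd, cb] = replicate 3 (Internal c);
    map (vert G) [xd, da, dc] = replicate 3 (Internal d);
    map (vert G) [za, zb, zc, zd] = [Boundary 1, Boundary 2, Boundary 3, Boundary 4];
    map (plabic.col G) [a, b, c, d] = [White, Black, White, Black]\<rbrakk>
   \<Longrightarrow> square_graph G"

(* Making room for a new boundary vertex i + 1. *)
fun shift_boundary :: "nat \<Rightarrow> vertex \<Rightarrow> vertex" where
  "shift_boundary i (Boundary j) = Boundary (if j \<le> i then j else j + 1)"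
| "shift_boundary i (Internal v) = Internal v"

(* blow_up i s G G': boundary vertex i of G is adjacent to a trivalent internal vertex v of
   colour s, and G' is the result of blowing up G at i. The half-edges x, e, f at v (x leading to
   boundary vertex i) are kept and reattached to c, a, b; the new edge from d to boundary vertex
   i + 1 has half-edges y (at d) and z. *)
inductive blow_up :: "nat \<Rightarrow> colour \<Rightarrow> plabic \<Rightarrow> plabic \<Rightarrow> bool" for i s G where
  "\<lbrakk>h \<in> halves G; vert G h = Boundary i;
    opp G h = x; vert G x = Internal v; plabic.col G v = s;
    {u \<in> halves G. vert G u = Internal v} = {x, e, f}; distinct [x, e, f];
    cw G x = e; cw G e = f; cw G f = x;
    distinct [ab, ba, bc, cb, cd, dc, da, ad, y, z];
    {ab, ba, bc, cb, cd, dc, da, ad, y, z} \<inter> halves G = {};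
    distinct [a, b, c, d];
    Internal ` {a, b, c, d} \<inter> vert G ` halves G = {};
    G' = \<lparr>halves = halves G \<union> {ab, ba, bc, cb, cd, dc, da, ad, y, z},
          opp = (opp G)(ab := ba, ba := ab, bc := cb, cb := bc, cd := dc, dc := cd,
                        da := ad, ad := da, y := z, z := y),
          cw = (cw G)(e := ab, ab := ad, ad := e,
                      f := bc, bc := ba, ba := f,
                      x := cd, cd := cb, cb := x,
                      y := da, da := dc, dc := y,
                      z := z),
          vert = (shift_boundary i \<circ> vert G)
                   (e := Internal a, ab := Internal a, ad := Internal a,
                    f := Internal b, bc := Internal b, ba := Internal b,
                    x := Internal c, cd := Internal c, cb := Internal c,
                    y := Internal d, da := Internal d, dc := Internal d,
                    z := Boundary (i + 1)),
          col = (plabic.col G)(a := Black, b := White, c := Black, d := White)\<rparr>\<rbrakk>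
   \<Longrightarrow> blow_up i s G G'"

(* bcfw_graph n k G: G is one of the graphs with n boundary vertices and parameter k. *)
inductive bcfw_graph :: "nat \<Rightarrow> nat \<Rightarrow> plabic \<Rightarrow> bool" where
  square: "square_graph G \<Longrightarrow> bcfw_graph 4 2 G"
| black: "\<lbrakk>bcfw_graph n k G; i \<in> {1..n} - {1, n}; blow_up i Black G G'\<rbrakk>
            \<Longrightarrow> bcfw_graph (n + 1) k G'"
| white: "\<lbrakk>bcfw_graph n k G; i \<in> {1..n} - {1, n}; blow_up i White G G'\<rbrakk>
            \<Longrightarrow> bcfw_graph (n + 1) (k + 1) G'"

definition cyc :: "nat \<Rightarrow> nat \<Rightarrow> nat" where
  "cyc n i = (if i = 1 then n else if i \<in> {2..n} then i - 1 else i)"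

definition black_decorated :: "nat \<Rightarrow> (nat \<Rightarrow> nat) \<Rightarrow> decorated_perm" where
  "black_decorated n \<pi> = (\<pi>, \<lambda>i. if i \<in> {1..n} \<and> \<pi> i = i then Some Black else None)"

definition bcfw_perms :: "nat \<Rightarrow> nat \<Rightarrow> decorated_perm set" where
  "bcfw_perms n k =
     {black_decorated n (cyc n \<circ> cyc n \<circ> trip_perm n G) |G. bcfw_graph n (k + 2) G}"

definition bcfw_cells :: "nat \<Rightarrow> nat \<Rightarrow> real vec set set set" where
  "bcfw_cells n k = positroid_cell k n ` bcfw_perms n k"

end

(* All graphs obtained by blowing up are encoded by the colours c of the vertices adjacent to the
   boundary together with the trip permutation f: both transform explicitly under a blow-up, because the
   trips leaving the new square to a boundary vertex pass through a run of neighbours of one colour. Blow-ups at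
   different places commute, so one may always blow up at the last black vertex before n or at a
   white vertex after it. Read from left to right, these canonical choices are exactly the steps of a
   pair of lattice paths: the colours give the lower path, the places of the blow-ups the upper one.

   On the other side, extending both paths by a west step inserts a column of zeros into the diagram,
   and extending them by a south step adds a bottom row whose pluses multiply the pipe permutation by
   a 5-cycle; this changes the pipe permutation in the same way as the
   blow-up changes the trip permutation multiplied by the square of the long cycle. So diagrams and
   BCFW cells have the same decorated permutations, and the path pair can be recovered
   from the permutation.

   For injectivity on the level of cells it remains to see that positroid cells are nonempty. A
   permutation all of whose points are fixed is realized by unit columns. Otherwise there are i < j
   with only fixed points strictly in between whose values are in increasing order; exchanging them
   decreases the sum of l * f l, and the exchange is undone on matrices by adding a multiple of
   column i to column j with the sign for which all minors stay nonnegative. *)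
theory Submission
  imports
    Defs
    "HOL-Library.Function_Algebras"
    "Jordan_Normal_Form.DL_Rank"
begin

section \<open>Colour words and permutations under blowing up\<close>

text \<open>Colours and trip permutation are not enough to verify the rule for a blow-up, since it
  also reroutes trips that pass the blown-up vertex on their way. The graph invariant therefore
  records in addition where each trip enters the run of colours next to its end. The offsets stem
  from the fixed letters White, Black at both ends of the colour word: letter number
  \<open>t\<close> of the lower path sits at boundary vertex \<open>t + 2\<close>, and the square of
  the long cycle lowers values by 2. A black canonical blow-up inserts a value two above its place,
  hence a fixed point after rotation. A white one inserts the place \<open>s + 3\<close> with a
  value that rotates to \<open>s\<close>. Moving this place to \<open>s\<close> costs a 4-cycle,
  which the transposition, acting on the places \<open>s + 3\<close> and \<open>n + 1\<close>,
  extends to a 5-cycle. Its points are the labels of the new row and of the four columns where that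
  row has a plus. The paths are recovered because the value at \<open>n\<close> shows the last black
  place before \<open>n\<close>, and because \<open>f x = x + 1\<close> never occurs, which tells
  the two kinds of last step apart.\<close>

definition sh :: "nat \<Rightarrow> nat \<Rightarrow> nat" where
  "sh v x = (if x < v then x else x + 1)"

definition unsh :: "nat \<Rightarrow> nat \<Rightarrow> nat" where
  "unsh v x = (if x < v then x else x - 1)"

text \<open>The one-line notation of \<open>f\<close> with a new letter \<open>v\<close> written at
  place \<open>p\<close>, the old letters from \<open>v\<close> on being raised to make
  room.\<close>

definition ins :: "nat \<Rightarrow> nat \<Rightarrow> (nat \<Rightarrow> nat) \<Rightarrow> nat \<Rightarrow> nat" where
  "ins p v f x = (if x = p then v else sh v (f (unsh p x)))"

lemma sh_inject [simp]: "sh v x = sh v y \<longleftrightarrow> x = y"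
  by (auto simp: sh_def)

lemma sh_neq [simp]: "sh v x \<noteq> v" "v \<noteq> sh v x"
  by (auto simp: sh_def)

lemma unsh_sh [simp]: "unsh v (sh v x) = x"
  by (auto simp: sh_def unsh_def)

lemma sh_unsh: "x \<noteq> v \<Longrightarrow> sh v (unsh v x) = x"
  by (auto simp: sh_def unsh_def)

lemma ins_self [simp]: "ins p v f p = v"
  by (simp add: ins_def)

lemma ins_sh [simp]: "ins p v f (sh p x) = sh v (f x)"
  by (simp add: ins_def)

lemma ins_inject [simp]: "ins p v f = ins p v g \<longleftrightarrow> f = g"
  by (metis ext ins_sh sh_inject)

text \<open>Lets transpositions be pulled out of insertions, so that the commutation of blow-ups
  becomes an identity between products of transpositions.\<close>

lemma ins_transpose:
  "ins p v (transpose a b \<circ> f) = transpose (sh v a) (sh v b) \<circ> ins p v f"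
  by (rule ext) (simp add: ins_def transpose_def)

text \<open>The lower insertion pushes the other new point up by one in both coordinates. Every
  argument is one of the two new places or comes from an old one.\<close>

lemma ins_ins:
  assumes "p \<le> q" "v \<le> u"
  shows "ins p v (ins q u f) = ins (q + 1) (u + 1) (ins p v f)"
proof
  fix x
  consider "x = p" | "x = q + 1" | y where "x = sh p (sh q y)"
    using assms by (metis Suc_eq_plus1 sh_unsh leD sh_def)
  then show "ins p v (ins q u f) x = ins (q + 1) (u + 1) (ins p v f) x"
  proof cases
    case 1
    with assms have "x = sh (q+1) p" by (auto simp: sh_def)
    then have "ins (q + 1) (u + 1) (ins p v f) x = sh (u + 1) v" by simp
    with 1 assms show ?thesis by (simp add: sh_def)
  next
    case 2
    with assms have "x = sh p q" by (auto simp: sh_def)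
    then have "ins p v (ins q u f) x = sh v u" by simp
    with 2 assms show ?thesis by (simp add: sh_def)
  next
    case 3
    then have "ins p v (ins q u f) x = sh v (sh u (f y))" by simp
    moreover have "x = sh (q+1) (sh p y)" using 3 assms by (auto simp: sh_def)
    then have "ins (q + 1) (u + 1) (ins p v f) x = sh (u+1) (sh v (f y))" by simp
    ultimately show ?thesis using assms by (auto simp: sh_def)
  qed
qed

lemma bij_ins: "bij f \<Longrightarrow> bij (ins p v f)"
proof (intro bijI injI)
  assume b: "bij f"
  fix x y assume e: "ins p v f x = ins p v f y"
  show "x = y"
    using e b by (cases "x = p"; cases "y = p") 
      (auto simp: ins_def bij_def inj_eq, metis sh_unsh)
next
  assume b: "bij f"
  have "\<exists>x. ins p v f x = y" for y
  proof (cases "y = v")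
    case False
    obtain z where "f z = unsh v y" using b by (metis bij_pointE)
    then have "ins p v f (sh p z) = y" using False by (simp add: sh_unsh)
    then show ?thesis by blast
  qed (metis ins_self)
  then show "surj (ins p v f)" by (metis surjI surj_def)
qed

lemma ins_permutes:
  assumes "f permutes {1..n}" "1 \<le> p" "p \<le> n + 1" "1 \<le> v" "v \<le> n + 1"
  shows "ins p v f permutes {1..n+1}"
proof -
  have "ins p v f x = x" if "x \<notin> {1..n+1}" for x
  proof -
    have "unsh p x \<notin> {1..n}" using that assms by (auto simp: unsh_def)
    then have "f (unsh p x) = unsh p x" using assms(1) by (simp add: permutes_not_in)
    then show ?thesis using that assms by (auto simp: ins_def sh_def unsh_def)
  qed
  moreover have "bij (ins p v f)" using assms(1) by (simp add: bij_ins permutes_bij)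
  ultimately show ?thesis by (simp add: permutes_def bij_iff)
qed

section \<open>Runs of equal colours next to a place\<close>

definition next_white :: "(nat \<Rightarrow> colour) \<Rightarrow> nat \<Rightarrow> nat" where
  "next_white c i = (LEAST w. i < w \<and> c w = White)"

definition prev_black :: "(nat \<Rightarrow> colour) \<Rightarrow> nat \<Rightarrow> nat" where
  "prev_black c i = (GREATEST b. b < i \<and> c b = Black)"

lemma next_whiteI:
  assumes "i < w" "c w = White" "\<And>x. i < x \<Longrightarrow> x < w \<Longrightarrow> c x = Black"
  shows "next_white c i = w"
  unfolding next_white_def using assms by (intro Least_equality) (auto, metis colour.distinct(1) not_le)

lemma prev_blackI:
  assumes "b < i" "c b = Black" "\<And>x. b < x \<Longrightarrow> x < i \<Longrightarrow> c x = White"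
  shows "prev_black c i = b"
  unfolding prev_black_def using assms by (intro Greatest_equality) (auto, metis colour.distinct(1) not_le)

lemma next_white_props:
  assumes "i < w" "c w = White"
  shows "i < next_white c i" "c (next_white c i) = White" "next_white c i \<le> w"
    "i < x \<Longrightarrow> x < next_white c i \<Longrightarrow> c x = Black"
  using LeastI[of "\<lambda>w. i < w \<and> c w = White" w] assms
    Least_le[of "\<lambda>w. i < w \<and> c w = White" w] not_less_Least[of x "\<lambda>w. i < w \<and> c w = White"]
  by (auto simp: next_white_def) (metis colour.exhaust)

lemma prev_black_props:
  assumes "b < i" "c b = Black"
  shows "prev_black c i < i" "c (prev_black c i) = Black" "b \<le> prev_black c i"
    "prev_black c i < x \<Longrightarrow> x < i \<Longrightarrow> c x = White"
proof -
  have bd: "\<And>y. y < i \<and> c y = Black \<Longrightarrow> y \<le> i" by auto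
  show "prev_black c i < i" "c (prev_black c i) = Black"
    using GreatestI_nat[of "\<lambda>b. b < i \<and> c b = Black" b i] assms bd by (auto simp: prev_black_def)
  show "b \<le> prev_black c i"
    using Greatest_le_nat[of "\<lambda>b. b < i \<and> c b = Black" b i] assms bd by (auto simp: prev_black_def)
  show "prev_black c i < x \<Longrightarrow> x < i \<Longrightarrow> c x = White"
    using Greatest_le_nat[of "\<lambda>b. b < i \<and> c b = Black" x i] bd 
    by (auto simp: prev_black_def) (metis colour.exhaust not_le)
qed

text \<open>Whatever the colour at \<open>i\<close> was, the square presents its black vertex
  \<open>c\<close> to \<open>i\<close> and its white vertex \<open>d\<close> to
  \<open>i + 1\<close>.\<close>

definition blow_col :: "nat \<Rightarrow> (nat \<Rightarrow> colour) \<Rightarrow> nat \<Rightarrow> colour" where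
  "blow_col i c x = (if x < i then c x else if x = i then Black
                     else if x = i + 1 then White else c (x - 1))"

(* The trip permutation after blowing up at i: a new source and a new value are inserted, namely
   i going to i + 1 for a black and i + 1 going to i for a white vertex, and then two values are
   exchanged. The trips ending there pass through the run of equal colours next to i, which is why
   the second value belongs to the first vertex beyond that run. *)
definition blow_perm :: "nat \<Rightarrow> (nat \<Rightarrow> colour) \<Rightarrow> (nat \<Rightarrow> nat) \<Rightarrow> nat \<Rightarrow> nat" where
  "blow_perm i c f =
     (if c i = Black then transpose (i + 1) (next_white c i + 1) \<circ> ins i (i + 1) f
      else transpose i (prev_black c i) \<circ> ins (i + 1) i f)"

text \<open>Two letters at either end survive every blow-up at an inner place. They provide a white
  letter to the right of each inner black one and a black letter to the left of each inner white
  one, so that \<open>next_white\<close> and \<open>prev_black\<close> are never arbitrary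
  there.\<close>

definition word :: "nat \<Rightarrow> (nat \<Rightarrow> colour) \<Rightarrow> bool" where
  "word n c \<longleftrightarrow> 4 \<le> n \<and> c 1 = White \<and> c 2 = Black \<and> c (n - 1) = White \<and> c n = Black"

lemma word_blow: "word n c \<Longrightarrow> 1 < i \<Longrightarrow> i < n \<Longrightarrow> word (n + 1) (blow_col i c)"
  by (auto simp: word_def blow_col_def)

lemma blow_col_commute:
  "i < j \<Longrightarrow> blow_col i (blow_col j c) = blow_col (j + 1) (blow_col i c)"
  by (rule ext) (auto simp: blow_col_def)

lemma word_next_white:
  assumes "word n c" "c i = Black" "1 < i" "i < n"
  shows "i < next_white c i" "c (next_white c i) = White" "next_white c i < n"
    "i < x \<Longrightarrow> x < next_white c i \<Longrightarrow> c x = Black"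
proof -
  have a: "i < n - 1" "c (n-1) = White" using assms 
    by (auto simp: word_def) (metis One_nat_def Suc_pred colour.distinct(1) less_antisym less_imp_Suc_add zero_less_Suc)
  note b = next_white_props[where c = c, OF a]
  show "i < next_white c i" "c (next_white c i) = White" "next_white c i < n"
    "i < x \<Longrightarrow> x < next_white c i \<Longrightarrow> c x = Black" using a b by auto
qed

lemma word_prev_black:
  assumes "word n c" "c i = White" "1 < i" "i < n"
  shows "prev_black c i < i" "c (prev_black c i) = Black" "1 < prev_black c i"
    "prev_black c i < x \<Longrightarrow> x < i \<Longrightarrow> c x = White"
proof -
  have a: "2 < i" "c 2 = Black" using assms 
    by (auto simp: word_def) (metis One_nat_def Suc_1 Suc_lessI colour.distinct(1))
  note b = prev_black_props[where c = c, OF a]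
  show "prev_black c i < i" "c (prev_black c i) = Black" "1 < prev_black c i"
    "prev_black c i < x \<Longrightarrow> x < i \<Longrightarrow> c x = White" using a b by auto
qed

text \<open>The blow-up puts a black letter at \<open>j\<close> and a white one at
  \<open>j + 1\<close>. A black run from \<open>i\<close> that ended at \<open>j\<close> or later
  therefore ends at \<open>j + 1\<close> now; one that ended earlier is not affected.\<close>

lemma next_white_blow_after:
  assumes w: "word n c" and "1 < i" "i < j" "j < n" "c i = Black"
  shows "next_white (blow_col j c) i = (if next_white c i < j then next_white c i else j + 1)"
proof -
  have "i < n" using assms by simp
  note a = word_next_white[OF w \<open>c i = Black\<close> \<open>1 < i\<close> \<open>i < n\<close>]
  have e: "blow_col j c x = c x" if "x < j" for x using that by (simp add: blow_col_def)
  have e': "blow_col j c j = Black" "blow_col j c (j + 1) = White" by (simp_all add: blow_col_def)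
  show ?thesis
  proof (cases "next_white c i < j")
    case True
    then have "next_white (blow_col j c) i = next_white c i"
      by (intro next_whiteI) (use a e in auto)
    with True show ?thesis by simp
  next
    case False
    have "blow_col j c x = Black" if "i < x" "x < j + 1" for x
      using that False a(4) e e' by (cases "x = j") auto
    then have "next_white (blow_col j c) i = j + 1"
      by (intro next_whiteI) (use \<open>i < j\<close> e' in auto)
    with False show ?thesis by simp
  qed
qed

lemma next_white_blow_before:
  assumes w: "word n c" and "1 < i" "i < j" "j < n" "c j = Black"
  shows "next_white (blow_col i c) (j + 1) = next_white c j + 1"
proof -
  have "1 < j" using assms by simp
  note a = word_next_white[OF w \<open>c j = Black\<close> \<open>1 < j\<close> \<open>j < n\<close>]
  have e: "blow_col i c (x + 1) = c x" if "j < x" for x using that assms by (simp add: blow_col_def)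
  have "blow_col i c x = Black" if "j + 1 < x" "x < next_white c j + 1" for x
    using that a(4)[of "x - 1"] e[of "x - 1"] by simp
  then show ?thesis by (intro next_whiteI) (use a e in auto)
qed

lemma prev_black_blow_after:
  assumes w: "word n c" and "1 < i" "i < j" "j < n" "c i = White"
  shows "prev_black (blow_col j c) i = prev_black c i"
proof -
  have "i < n" using assms by simp
  note a = word_prev_black[OF w \<open>c i = White\<close> \<open>1 < i\<close> \<open>i < n\<close>]
  have e: "blow_col j c x = c x" if "x < i" for x using that assms by (simp add: blow_col_def)
  show ?thesis by (rule prev_blackI) (use a e in auto)
qed

text \<open>The new black letter at \<open>i\<close> cuts a white run that extended down to
  \<open>i\<close> or further; otherwise the end of the run is only shifted by one.\<close>

lemma prev_black_blow_before:
  assumes w: "word n c" and "1 < i" "i < j" "j < n" "c j = White"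
  shows "prev_black (blow_col i c) (j + 1) = (if prev_black c j \<le> i then i else prev_black c j + 1)"
proof -
  have "1 < j" using assms by simp
  note a = word_prev_black[OF w \<open>c j = White\<close> \<open>1 < j\<close> \<open>j < n\<close>]
  have e: "blow_col i c (x + 1) = c x" if "i < x" for x using that by (simp add: blow_col_def)
  have e': "blow_col i c i = Black" "blow_col i c (i + 1) = White" by (simp_all add: blow_col_def)
  have W: "blow_col i c x = White" if "i + 1 < x" "prev_black c j + 1 < x" "x < j + 1" for x
    using that a(4)[of "x - 1"] e[of "x - 1"] by simp
  show ?thesis
  proof (cases "prev_black c j \<le> i")
    case True
    have "blow_col i c x = White" if "i < x" "x < j + 1" for x
      using that True W e' by (cases "x = i + 1") auto
    then have "prev_black (blow_col i c) (j + 1) = i"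
      by (intro prev_blackI) (use \<open>i < j\<close> e' in auto)
    with True show ?thesis by simp
  next
    case False
    then have "prev_black (blow_col i c) (j + 1) = prev_black c j + 1"
      by (intro prev_blackI) (use a e W in auto)
    with False show ?thesis by simp
  qed
qed

section \<open>Commutation of blow-ups at different places\<close>

lemma transpose_commute_disjoint:
  "a \<notin> {c, d} \<Longrightarrow> b \<notin> {c, d} \<Longrightarrow> transpose a b \<circ> transpose c d = transpose c d \<circ> transpose a b"
  by (auto simp: transpose_def fun_eq_iff)

text \<open>Each blow-up is a transposition after an insertion. The insertions commute by
  \<open>ins_ins\<close>, so only the transpositions remain to be compared.\<close>

lemma transpose_ins_commute:
  assumes "p \<le> q" "v \<le> u"
    and "transpose a b \<circ> transpose (sh v x) (sh v y) = transpose x' y' \<circ> transpose (sh (u + 1) a') (sh (u + 1) b')"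
  shows "transpose a b \<circ> ins p v (transpose x y \<circ> ins q u f)
       = transpose x' y' \<circ> ins (q + 1) (u + 1) (transpose a' b' \<circ> ins p v f)"
  unfolding ins_transpose ins_ins[OF assms(1,2)] o_assoc assms(3) ..

lemma transpose_share:
  assumes "z \<noteq> x" "z \<noteq> y" "x \<noteq> y"
  shows "transpose x y \<circ> transpose y z = transpose y z \<circ> transpose x z"
  using assms by (auto simp: transpose_def fun_eq_iff)

lemma blow_perm_black:
  "c i = Black \<Longrightarrow> next_white c i = w \<Longrightarrow> blow_perm i c f = transpose (i + 1) (w + 1) \<circ> ins i (i + 1) f"
  by (simp add: blow_perm_def)

lemma blow_perm_white:
  "c i = White \<Longrightarrow> prev_black c i = b \<Longrightarrow> blow_perm i c f = transpose i b \<circ> ins (i + 1) i f"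
  by (simp add: blow_perm_def)

text \<open>The two transpositions are disjoint unless \<open>i\<close> and \<open>j\<close> have
  the same colour and lie in the same run. In that case they share a point, and both products are
  the same 3-cycle.\<close>

lemma blow_perm_commute:
  assumes w: "word n c" and i: "1 < i" "i < j" "j < n"
  shows "blow_perm i (blow_col j c) (blow_perm j c f)
       = blow_perm (j + 1) (blow_col i c) (blow_perm i c f)"
proof -
  have ci: "blow_col j c i = c i" "blow_col i c (j + 1) = c j"
    using i by (auto simp: blow_col_def)
  have i2: "1 < j" "i < n" using i by auto
  show ?thesis
  proof (cases "c i"; cases "c j")
    assume c: "c i = Black" "c j = Black"
    note a = word_next_white[OF w c(1) i(1) i2(2)] and b = word_next_white[OF w c(2) i2(1) i(3)]
    note n1 = next_white_blow_after[OF w i c(1)] and n2 = next_white_blow_before[OF w i c(2)]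
    note B = blow_perm_black[where c = "blow_col j c" and i = i, unfolded ci, OF c(1) n1]
      blow_perm_black[where c = "blow_col i c" and i = "j + 1", unfolded ci, OF c(2) n2]
      blow_perm_black[where c = c, OF c(1) refl] blow_perm_black[where c = c, OF c(2) refl]
    have *: "next_white c i \<noteq> j" using a(2) c i by auto
    have T: "transpose (i + 1) ((if next_white c i < j then next_white c i else j + 1) + 1)
        \<circ> transpose (sh (i + 1) (j + 1)) (sh (i + 1) (next_white c j + 1))
      = transpose (j + 1 + 1) (next_white c j + 1 + 1)
        \<circ> transpose (sh (j + 1 + 1) (i + 1)) (sh (j + 1 + 1) (next_white c i + 1))"
    proof (cases "next_white c i < j")
      case True
      have e: "sh (i + 1) (j + 1) = j + 1 + 1" "sh (i + 1) (next_white c j + 1) = next_white c j + 1 + 1"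
        "sh (j + 1 + 1) (i + 1) = i + 1" "sh (j + 1 + 1) (next_white c i + 1) = next_white c i + 1"
        using True b(1) i by (auto simp: sh_def)
      show ?thesis unfolding e if_P[OF True] using True a(1) b(1) i
        by (intro transpose_commute_disjoint) auto
    next
      case False
      \<comment> \<open>Now \<open>i\<close> and \<open>j\<close> belong to one black run, which
        ends at a single white letter.\<close>
      have "next_white c i = next_white c j"
        using False * a(1,2) b(4)[of "next_white c i"] b(1,2) a(4)[of "next_white c j"] i
        by (cases "next_white c i" "next_white c j" rule: linorder_cases) auto
      then have e: "sh (i + 1) (j + 1) = j + 1 + 1" "sh (i + 1) (next_white c j + 1) = next_white c j + 1 + 1"
        "sh (j + 1 + 1) (i + 1) = i + 1" "sh (j + 1 + 1) (next_white c i + 1) = next_white c j + 1 + 1"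
        using b(1) i by (auto simp: sh_def)
      show ?thesis unfolding e if_not_P[OF False] using b(1) i
        by (intro transpose_share) auto
    qed
    show ?thesis unfolding B using i by (intro transpose_ins_commute T) auto
  next
    assume c: "c i = Black" "c j = White"
    note a = word_next_white[OF w c(1) i(1) i2(2)] and b = word_prev_black[OF w c(2) i2(1) i(3)]
    note n1 = next_white_blow_after[OF w i c(1)] and n2 = prev_black_blow_before[OF w i c(2)]
    note B = blow_perm_black[where c = "blow_col j c" and i = i, unfolded ci, OF c(1) n1]
      blow_perm_white[where c = "blow_col i c" and i = "j + 1", unfolded ci, OF c(2) n2]
      blow_perm_black[where c = c, OF c(1) refl] blow_perm_white[where c = c, OF c(2) refl]
    \<comment> \<open>The run of \<open>i\<close> may end at \<open>j\<close> and that of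
      \<open>j\<close> at \<open>i\<close>; but the ends of the two runs have different colours, so
      the transpositions stay disjoint.\<close>
    have pb: "i \<le> prev_black c j" using b(4)[of i] c i by fastforce
    have nw: "next_white c i \<le> j" using a(4)[of j] c i by fastforce
    have ne: "next_white c i \<noteq> prev_black c j" using a(2) b(2) by auto
    have e: "sh (i + 1) j = j + 1" 
       "sh (i + 1) (prev_black c j) = (if prev_black c j \<le> i then i else prev_black c j + 1)"
       "sh (j + 1) (i + 1) = i + 1"
       "sh (j + 1) (next_white c i + 1) = (if next_white c i < j then next_white c i else j + 1) + 1"
      using i nw pb by (auto simp: sh_def)
    have T: "transpose (i + 1) ((if next_white c i < j then next_white c i else j + 1) + 1)
        \<circ> transpose (sh (i + 1) j) (sh (i + 1) (prev_black c j))
      = transpose (j + 1) (if prev_black c j \<le> i then i else prev_black c j + 1)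
        \<circ> transpose (sh (j + 1) (i + 1)) (sh (j + 1) (next_white c i + 1))"
      unfolding e using i a(1) b(1) pb nw ne by (intro transpose_commute_disjoint) auto
    show ?thesis unfolding B using i by (intro transpose_ins_commute T) auto
  next
    assume c: "c i = White" "c j = Black"
    note a = word_prev_black[OF w c(1) i(1) i2(2)] and b = word_next_white[OF w c(2) i2(1) i(3)]
    note n1 = prev_black_blow_after[OF w i c(1)] and n2 = next_white_blow_before[OF w i c(2)]
    note B = blow_perm_white[where c = "blow_col j c" and i = i, unfolded ci, OF c(1) n1]
      blow_perm_black[where c = "blow_col i c" and i = "j + 1", unfolded ci, OF c(2) n2]
      blow_perm_white[where c = c, OF c(1) refl] blow_perm_black[where c = c, OF c(2) refl]
    have e: "sh i (j + 1) = j + 1 + 1" "sh i (next_white c j + 1) = next_white c j + 1 + 1"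
       "sh (j + 1 + 1) i = i" "sh (j + 1 + 1) (prev_black c i) = prev_black c i"
      using i a(1) b(1) by (auto simp: sh_def)
    have T: "transpose i (prev_black c i) \<circ> transpose (sh i (j + 1)) (sh i (next_white c j + 1))
      = transpose (j + 1 + 1) (next_white c j + 1 + 1)
        \<circ> transpose (sh (j + 1 + 1) i) (sh (j + 1 + 1) (prev_black c i))"
      unfolding e using i a(1) b(1) by (intro transpose_commute_disjoint) auto
    show ?thesis unfolding B using i by (intro transpose_ins_commute T) auto
  next
    assume c: "c i = White" "c j = White"
    note a = word_prev_black[OF w c(1) i(1) i2(2)] and b = word_prev_black[OF w c(2) i2(1) i(3)]
    note n1 = prev_black_blow_after[OF w i c(1)] and n2 = prev_black_blow_before[OF w i c(2)]
    note B = blow_perm_white[where c = "blow_col j c" and i = i, unfolded ci, OF c(1) n1]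
      blow_perm_white[where c = "blow_col i c" and i = "j + 1", unfolded ci, OF c(2) n2]
      blow_perm_white[where c = c, OF c(1) refl] blow_perm_white[where c = c, OF c(2) refl]
    have *: "prev_black c j \<noteq> i" using b(2) c i by auto
    have e: "sh i j = j + 1" "sh (j + 1) i = i" "sh (j + 1) (prev_black c i) = prev_black c i"
      using i a(1) by (auto simp: sh_def)
    have T: "transpose i (prev_black c i) \<circ> transpose (sh i j) (sh i (prev_black c j))
      = transpose (j + 1) (if prev_black c j \<le> i then i else prev_black c j + 1)
        \<circ> transpose (sh (j + 1) i) (sh (j + 1) (prev_black c i))"
    proof (cases "prev_black c j < i")
      case True
      then have p: "prev_black c i = prev_black c j"
        using a(1,2) a(4)[of "prev_black c j"] b(2) b(4)[of "prev_black c i"] i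
        by (cases "prev_black c i" "prev_black c j" rule: linorder_cases) auto
      have s: "sh i (prev_black c j) = prev_black c j" "(if prev_black c j \<le> i then i else prev_black c j + 1) = i"
          "sh (j + 1) (prev_black c j) = prev_black c j"
        using True i by (auto simp: sh_def)
      show ?thesis unfolding e p s using True i
        by (auto simp: transpose_def fun_eq_iff)
    next
      case False
      then have s: "sh i (prev_black c j) = prev_black c j + 1" "(if prev_black c j \<le> i then i else prev_black c j + 1) = prev_black c j + 1"
        using * by (auto simp: sh_def)
      show ?thesis unfolding e s using i a(1) b(1) False * by (intro transpose_commute_disjoint) auto
    qed
    show ?thesis unfolding B using i by (intro transpose_ins_commute T) auto
  qed
qed

section \<open>Path pairs and their permutations\<close>

text \<open>The values outside 1 to 4 are chosen to agree with the empty path word, so that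
  statements about colours can be equalities of functions.\<close>

definition col0 :: "nat \<Rightarrow> colour" where
  "col0 x = (if x = 2 \<or> 4 \<le> x then Black else White)"

definition perm0 :: "nat \<Rightarrow> nat" where
  "perm0 = id(1 := 3, 2 := 4, 3 := 1, 4 := 2)"

(* c x is the colour of the vertex adjacent to boundary vertex x, and f is the trip permutation;
   these two determine how both change under further blow-ups. *)
inductive bcfw_state :: "nat \<Rightarrow> nat \<Rightarrow> (nat \<Rightarrow> colour) \<Rightarrow> (nat \<Rightarrow> nat) \<Rightarrow> bool" where
  base: "bcfw_state 4 2 col0 perm0"
| blow: "bcfw_state n k c f \<Longrightarrow> 1 < i \<Longrightarrow> i < n \<Longrightarrow>
    bcfw_state (n + 1) (if c i = Black then k else k + 1) (blow_col i c) (blow_perm i c f)"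

text \<open>The canonical blow-ups: if all letters strictly between \<open>i\<close> and
  \<open>n\<close> are white, then \<open>i\<close> is the last black place before \<open>n\<close>
  or a white place after it.\<close>

inductive tail_state :: "nat \<Rightarrow> nat \<Rightarrow> (nat \<Rightarrow> colour) \<Rightarrow> (nat \<Rightarrow> nat) \<Rightarrow> bool" where
  base: "tail_state 4 2 col0 perm0"
| blow: "tail_state n k c f \<Longrightarrow> 1 < i \<Longrightarrow> i < n \<Longrightarrow> (\<And>x. i < x \<Longrightarrow> x < n \<Longrightarrow> c x = White) \<Longrightarrow>
    tail_state (n + 1) (if c i = Black then k else k + 1) (blow_col i c) (blow_perm i c f)"

lemma word_col0: "word 4 col0"
  by (simp add: word_def col0_def)

lemma tail_state_word: "tail_state n k c f \<Longrightarrow> word n c"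
  by (induction rule: tail_state.induct) (auto simp: word_col0 intro: word_blow[simplified])

(* Blow-ups at i < m commute up to shifting m, so all of them can be done from left to right. *)
lemma tail_state_blow:
  "tail_state n k c f \<Longrightarrow> 1 < i \<Longrightarrow> i < n \<Longrightarrow>
    tail_state (n + 1) (if c i = Black then k else k + 1) (blow_col i c) (blow_perm i c f)"
proof (induction arbitrary: i rule: tail_state.induct)
  case base
  then have "i = 2 \<or> i = 3" by auto
  then show ?case
    by (intro tail_state.blow tail_state.base) (auto simp: col0_def)
next
  case (blow n k c f m)
  let ?k = "if c m = Black then k else k + 1"
  note w = tail_state_word[OF blow.hyps(1)]
  show ?case
  proof (cases "m \<le> i")
    case True
    have s: "tail_state (n + 1) ?k (blow_col m c) (blow_perm m c f)"
      by (rule tail_state.blow[OF blow.hyps])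
    show ?thesis
    proof (rule tail_state.blow[OF s blow.prems])
      \<comment> \<open>All letters after the square at \<open>m\<close> are white up to the last
        one, so a later place is canonical already.\<close>
      fix x assume "i < x" "x < n + 1"
      with True blow.hyps(4)[of "x - 1"] show "blow_col m c x = White"
        by (cases "x = m + 1") (auto simp: blow_col_def)
    qed
  next
    case False
    then have i: "1 < i" "i < m" "m < n" using blow by auto
    let ?c = "blow_col i c" and ?l = "if c i = Black then k else k + 1"
    have e: "blow_col m c i = c i" "?c (m + 1) = c m"
      using i by (auto simp: blow_col_def)
    \<comment> \<open>The blow-up at \<open>i\<close> is moved in front of the one at
      \<open>m\<close>, which then takes place at \<open>m + 1\<close> and stays canonical.\<close>
    have "tail_state (n + 1) ?l ?c (blow_perm i c f)"
      using blow.IH[of i] i by simp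
    then have "tail_state (n + 1 + 1) (if ?c (m + 1) = Black then ?l else ?l + 1)
        (blow_col (m + 1) ?c) (blow_perm (m + 1) ?c (blow_perm i c f))"
    proof (rule tail_state.blow)
      fix x assume "m + 1 < x" "x < n + 1"
      with i blow.hyps(4)[of "x - 1"] show "?c x = White"
        by (auto simp: blow_col_def)
    qed (use i in auto)
    moreover have "(if ?c (m + 1) = Black then ?l else ?l + 1)
        = (if blow_col m c i = Black then ?k else ?k + 1)"
      unfolding e by simp
    ultimately show ?thesis
      by (simp only: blow_col_commute[OF i(2)] blow_perm_commute[OF w i])
  qed
qed

lemma bcfw_state_eq_tail_state: "bcfw_state = tail_state"
proof (intro ext iffI)
  fix n k c f
  show "bcfw_state n k c f \<Longrightarrow> tail_state n k c f"
    by (induction rule: bcfw_state.induct) (blast intro: tail_state.base tail_state_blow)+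
  show "tail_state n k c f \<Longrightarrow> bcfw_state n k c f"
    by (induction rule: tail_state.induct) (blast intro: bcfw_state.intros)+
qed

section \<open>Lattice steps as canonical blow-ups\<close>

fun step_colour :: "step \<Rightarrow> colour" where
  "step_colour South = Black"
| "step_colour West = White"

(* Between the fixed ends White, Black and White, Black, the colours are the steps of the lower path. *)
definition path_col :: "step list \<Rightarrow> nat \<Rightarrow> colour" where
  "path_col q x = (if x \<le> 1 then White else if x = 2 then Black
     else if x < length q + 3 then step_colour (q ! (x - 3))
     else if x = length q + 3 then White else Black)"

(* Positions are counted from 1; the value is 0 if there is no south step. *)
fun last_south :: "step list \<Rightarrow> nat" where
  "last_south [] = 0"
| "last_south (x # xs) = (if South \<in> set (x # xs) then Suc (last_south xs) else 0)"

(* Here n and k are those of the diagrams: the graphs have parameter k + 2. The case west is a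
   blow-up at the last black vertex before n, the case south one at a white vertex after it; the
   upper path p records which of the two was used. *)
inductive path_state :: "nat \<Rightarrow> nat \<Rightarrow> step list \<Rightarrow> step list \<Rightarrow> (nat \<Rightarrow> nat) \<Rightarrow> bool" where
  base: "path_state 4 0 [] [] perm0"
| west: "path_state n k p q f \<Longrightarrow> path_state (n + 1) k (p @ [West]) (q @ [West])
    (blow_perm (last_south q + 2) (path_col q) f)"
| south: "path_state n k p (q @ replicate m West) f \<Longrightarrow>
    path_state (n + 1) (k + 1) (p @ [South]) (q @ South # replicate m West)
    (blow_perm (length q + 3) (path_col (q @ replicate m West)) f)"

lemma last_south_notin: "South \<notin> set q \<Longrightarrow> last_south q = 0"
  by (cases q) auto

lemma last_south_append_west [simp]: "last_south (q @ replicate m West) = last_south q"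
  by (induction q) (auto simp: last_south_notin)

lemma last_south_append_west1 [simp]: "last_south (q @ [West]) = last_south q"
  using last_south_append_west[of q 1] by simp

lemma last_south_append_south [simp]: "last_south (q @ South # replicate m West) = length q + 1"
  by (induction q) (auto simp: last_south_notin)

lemma last_south_le: "last_south q \<le> length q"
  by (induction q) auto

lemma last_south_eq_0_iff: "last_south q = 0 \<longleftrightarrow> South \<notin> set q"
  by (cases q) auto

lemma last_south_nth: "0 < last_south q \<Longrightarrow> q ! (last_south q - 1) = South"
proof (induction q)
  case (Cons x q)
  then have S: "South \<in> set (x # q)" using last_south_eq_0_iff by (metis less_irrefl)
  show ?case
  proof (cases "South \<in> set q")
    case True
    then obtain m where "last_south q = Suc m" using last_south_eq_0_iff not0_implies_Suc by blast
    with Cons.IH S show ?thesis by auto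
  next
    case False
    then show ?thesis using S by (simp add: last_south_notin)
  qed
qed simp

lemma last_south_after: "last_south q \<le> x \<Longrightarrow> x < length q \<Longrightarrow> q ! x = West"
proof (induction q arbitrary: x)
  case (Cons y q)
  show ?case
  proof (cases "South \<in> set (y # q)")
    case True
    then show ?thesis using Cons by (cases x) auto
  next
    case False
    then have "(y # q) ! x \<noteq> South" using Cons.prems(2) by (metis nth_mem)
    then show ?thesis by (metis step.exhaust)
  qed
qed simp

lemma path_col_last_south: "path_col q (last_south q + 2) = Black"
  using last_south_nth[of q] last_south_le[of q]
  by (cases "last_south q = 0") (auto simp: path_col_def)

lemma path_col_after_last_south:
  "last_south q + 2 < x \<Longrightarrow> x < length q + 4 \<Longrightarrow> path_col q x = White"
  using last_south_after[of q "x - 3"] by (auto simp: path_col_def)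

lemma path_col_Nil: "path_col [] = col0"
  by (rule ext) (auto simp: path_col_def col0_def)

text \<open>The last black letter is replaced by Black, White. Only white letters follow up to the
  final Black, so the extra white one may be counted at the end of the path.\<close>

lemma blow_path_col_west:
  "blow_col (last_south q + 2) (path_col q) = path_col (q @ [West])"
proof
  fix x
  note l = last_south_le[of q]
  consider "x < last_south q + 2" | "x = last_south q + 2" | "last_south q + 2 < x" "x < length q + 5"
    | "length q + 5 \<le> x" by linarith
  then show "blow_col (last_south q + 2) (path_col q) x = path_col (q @ [West]) x"
  proof cases
    case 1
    then show ?thesis using l by (auto simp: blow_col_def path_col_def nth_append)
  next
    case 2
    then show ?thesis using path_col_last_south[of "q @ [West]"] by (simp add: blow_col_def)
  next
    case 3
    then have "path_col (q @ [West]) x = White"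
      using path_col_after_last_south[of "q @ [West]" x] by simp
    moreover have "blow_col (last_south q + 2) (path_col q) x = White"
      using 3 path_col_after_last_south[of q "x - 1"] by (auto simp: blow_col_def)
    ultimately show ?thesis by simp
  next
    case 4
    then show ?thesis using l by (auto simp: blow_col_def path_col_def)
  qed
qed

lemma path_col_tail:
  "length q + 2 < x \<Longrightarrow> path_col (q @ replicate m West) x = (if x < length q + m + 4 then White else Black)"
  by (auto simp: path_col_def nth_append)

lemma path_col_tail_west: 
  "length q + 2 < x \<Longrightarrow> x < length q + m + 4 \<Longrightarrow> path_col (q @ replicate m West) x = White"
  by (simp add: path_col_tail)

lemma path_col_append: "x < length q + 3 \<Longrightarrow> path_col (q @ r) x = path_col (q @ r') x"
  by (auto simp: path_col_def nth_append)

text \<open>The blown-up white letter survives behind the new black one, which is the new south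
  step; for \<open>m = 0\<close> it is the fixed white letter after the path.\<close>

lemma blow_path_col_south:
  "blow_col (length q + 3) (path_col (q @ replicate m West)) = path_col (q @ South # replicate m West)"
proof
  fix x
  consider "x < length q + 3" | "x = length q + 3" | "x = length q + 4" | "length q + 4 < x" by linarith
  then show "blow_col (length q + 3) (path_col (q @ replicate m West)) x = path_col (q @ South # replicate m West) x"
  proof cases
    case 1
    then show ?thesis by (simp add: blow_col_def) (rule path_col_append)
  next
    case 2
    then show ?thesis by (simp add: blow_col_def path_col_def)
  next
    case 3
    then show ?thesis using path_col_tail[of "q @ [South]" x m] by (simp add: blow_col_def)
  next
    case 4
    then show ?thesis using path_col_tail[of "q @ [South]" x m] path_col_tail[of q "x - 1" m]
      by (auto simp: blow_col_def)
  qed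
qed

lemma path_state_length: "path_state n k p q f \<Longrightarrow> length p = length q \<and> n = length q + 4"
  by (induction rule: path_state.induct) auto

lemma path_state_tail_state: "path_state n k p q f \<Longrightarrow> tail_state n (k + 2) (path_col q) f"
proof (induction rule: path_state.induct)
  case base
  show ?case unfolding path_col_Nil add_0 by (rule tail_state.base)
next
  case (west n k p q f)
  have n: "n = length q + 4" using path_state_length[OF west(1)] by simp
  have "last_south q + 2 < n" using last_south_le[of q] n by simp
  from tail_state.blow[OF west(2) _ this]
  show ?case using path_col_after_last_south[of q] n
    by (simp add: path_col_last_south[simplified] blow_path_col_west[simplified])
next
  case (south n k p q m f)
  have n: "n = length q + m + 4" using path_state_length[OF south(1)] by simp
  have "length q + 3 < n" using n by simp
  from tail_state.blow[OF south(2) _ this]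
  show ?case using path_col_tail_west[of q _ m] n
    by (simp add: blow_path_col_south)
qed

lemma tail_state_path_state:
  "tail_state n k c f \<Longrightarrow> \<exists>k' p q. k = k' + 2 \<and> c = path_col q \<and> path_state n k' p q f"
proof (induction rule: tail_state.induct)
  case base
  show ?case
    by (intro exI[of _ 0] exI[of _ "[]"]) (simp add: path_state.base path_col_Nil)
next
  case (blow n k c f i)
  then obtain k' p q where *: "k = k' + 2" "c = path_col q" "path_state n k' p q f" by blast
  have n: "n = length q + 4" using path_state_length[OF *(3)] by simp
  show ?case
  proof (cases "c i")
    case Black
    \<comment> \<open>Since everything between \<open>i\<close> and \<open>n\<close> is white, a
      black \<open>i\<close> can only be the last black place.\<close>
    have "i = last_south q + 2"
    proof (cases i "last_south q + 2" rule: linorder_cases)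
      case less
      then have "path_col q (last_south q + 2) = White"
        using blow(4)[of "last_south q + 2"] last_south_le[of q] n * by simp
      then show ?thesis by (simp add: path_col_last_south[simplified])
    next
      case greater
      then show ?thesis using path_col_after_last_south[of q i] Black * n blow by simp
    qed simp
    then show ?thesis using path_state.west[OF *(3)] Black * blow_path_col_west[of q]
      by auto
  next
    case White
    have i: "last_south q + 2 < i"
    proof (cases i "last_south q + 2" rule: linorder_cases)
      case less
      then have "path_col q (last_south q + 2) = White"
        using blow(4)[of "last_south q + 2"] last_south_le[of q] n * by simp
      then show ?thesis by (simp add: path_col_last_south[simplified])
    next
      case equal
      then show ?thesis using path_col_last_south[of q] White * by simp
    qed simp
    \<comment> \<open>The letter at place \<open>i\<close> is the step with index
      \<open>i - 3\<close>. As \<open>i\<close> lies behind the last south step, only west steps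
      follow from this index on.\<close>
    define q0 where "q0 = take (i - 3) q"
    define m where "m = length q - (i - 3)"
    have "drop (i - 3) q = replicate m West"
      using last_south_after[of q] i by (intro nth_equalityI) (auto simp: m_def)
    then have q: "q = q0 @ replicate m West" by (metis append_take_drop_id q0_def)
    have "length q0 + 3 = i" using i blow n by (auto simp: q0_def)
    then show ?thesis using path_state.south[OF *(3)[unfolded q]] White * blow_path_col_south[of q0 m] q
      by (metis (no_types, lifting) add_2_eq_Suc' add_Suc_right colour.distinct(1) Suc_eq_plus1)
  qed
qed

lemma count_list_replicate: "count_list (replicate m x) y = (if x = y then m else 0)"
  by (induction m) auto

lemma count_take_le: "count_list (take t xs) y \<le> count_list xs y"
  by (metis append_take_drop_id count_list_append le_add1)

lemma length_count_steps: "length p = count_list p South + count_list p West"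
  by (induction p) (auto, metis step.exhaust)

text \<open>The upper path gets its new south step at the very end, the lower one before the
  trailing west steps, so the lower path stays below.\<close>

lemma path_state_path_pairs: "path_state n k p q f \<Longrightarrow> (p, q) \<in> path_pairs n k \<and> k + 4 \<le> n"
proof (induction rule: path_state.induct)
  case base
  show ?case by (simp add: path_pairs_def lattice_paths_def weakly_below_def)
next
  case (west n k p q f)
  have l: "length p = length q" using path_state_length[OF west(1)] by simp
  show ?case using west(2) l
    by (auto simp: path_pairs_def lattice_paths_def weakly_below_def take_Cons')
next
  case (south n k p q m f)
  have l: "length p = length q + m" using path_state_length[OF south(1)] by simp
  have w: "count_list (take t p) South \<le> count_list (take t (q @ replicate m West)) South" for t
    using south(2) by (simp add: path_pairs_def weakly_below_def)
  have c: "count_list p South = k" "count_list p West = n - k - 4" "count_list q South = k" "count_list q West + m = n - k - 4"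
    using south(2) by (auto simp: path_pairs_def lattice_paths_def count_list_replicate)
  have "count_list (take t (p @ [South])) South \<le> count_list (take t (q @ South # replicate m West)) South" for t
  proof (cases "t \<le> length q")
    case True
    then show ?thesis using w[of t] l by simp
  next
    case False
    then have "take t (q @ South # replicate m West) = q @ South # take (t - length q - 1) (replicate m West)"
      by (simp add: take_Cons')
    then have "count_list (take t (q @ South # replicate m West)) South = k + 1"
      using c by (simp add: count_list_replicate)
    then show ?thesis using count_take_le[of t "p @ [South]" South] c by simp
  qed
  then show ?case using c south(2)
    by (auto simp: path_pairs_def lattice_paths_def weakly_below_def count_list_replicate)
qed

lemma no_south_replicate: "South \<notin> set xs \<Longrightarrow> xs = replicate (length xs) West"
  by (induction xs) (auto, metis step.exhaust)

text \<open>Remove the last step of \<open>p\<close>. If it is west, then \<open>q\<close> also ends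
  with west, as otherwise \<open>q\<close> would have fewer south steps than \<open>p\<close> just
  before the end. If it is south, the last south step of \<open>q\<close> is removed, wherever it
  stands.\<close>

lemma path_pairs_path_state:
  "(p, q) \<in> path_pairs n k \<Longrightarrow> k + 4 \<le> n \<Longrightarrow> \<exists>f. path_state n k p q f"
proof (induction p arbitrary: q n k rule: rev_induct)
  case Nil
  then have "k = 0" "n = 4" "count_list q South = 0" "count_list q West = 0"
    by (auto simp: path_pairs_def lattice_paths_def)
  then show ?case using length_count_steps[of q] path_state.base by auto
next
  case (snoc x p)
  have w: "count_list (take t (p @ [x])) South \<le> count_list (take t q) South" for t
    using snoc(2) by (simp add: path_pairs_def weakly_below_def)
  have c: "count_list (p @ [x]) South = k" "count_list (p @ [x]) West = n - k - 4" 
      "count_list q South = k" "count_list q West = n - k - 4"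
    using snoc(2) by (auto simp: path_pairs_def lattice_paths_def)
  then have l: "length q = length (p @ [x])" using length_count_steps by metis
  show ?case
  proof (cases x)
    case West
    obtain q0 y where q: "q = q0 @ [y]" using l by (metis append_Nil2 length_0_conv length_append_singleton nat.distinct(1) rev_exhaust)
    have lq: "length q0 = length p" using l q by simp
    have "y = West"
    proof (rule ccontr)
      assume "y \<noteq> West"
      then have "y = South" by (metis step.exhaust)
      then have "count_list q0 South + 1 = k" using c q by simp
      then show False using w[of "length p"] lq q c West by simp
    qed
    moreover have "count_list (take t p) South \<le> count_list (take t q0) South" for t
      using w[of "min t (length p)"] q lq by (simp add: min_def split: if_splits)
    ultimately have "(p, q0) \<in> path_pairs (n - 1) k" "k + 4 \<le> n - 1" "n = n - 1 + 1"
      using c q West snoc(3) by (auto simp: path_pairs_def lattice_paths_def weakly_below_def)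
    then show ?thesis using snoc(1) path_state.west[of "n - 1" k p q0] q \<open>y = West\<close> West by metis
  next
    case South
    then have "South \<in> set q" using c by (auto simp: count_list_0_iff intro: ccontr)
    then obtain q0 r where q: "q = q0 @ South # r" "South \<notin> set r" by (metis split_list_last)
    define m where "m = length r"
    have r: "r = replicate m West" using no_south_replicate[OF q(2)] m_def by simp
    have "count_list (take t p) South \<le> count_list (take t (q0 @ replicate m West)) South" for t
    proof (cases "t \<le> length q0")
      case True
      then show ?thesis using w[of t] l q m_def by simp
    next
      case False
      \<comment> \<open>Past the removed step the shortened lower path has made all its south steps,
        as many as the shortened \<open>p\<close> has in total.\<close>
      then have "count_list (take t (q0 @ replicate m West)) South = k - 1"
        using c q by (simp add: count_list_replicate r)
      then show ?thesis using count_take_le[of t p South] c South by simp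
    qed
    then have "(p, q0 @ replicate m West) \<in> path_pairs (n - 1) (k - 1)" "k - 1 + 4 \<le> n - 1" "n = n - 1 + 1" "k = k - 1 + 1"
      using c q South snoc(3) r by (auto simp: path_pairs_def lattice_paths_def weakly_below_def count_list_replicate)
    then show ?thesis using snoc(1) path_state.south[of "n - 1" "k - 1" p q0 m] q r South by metis
  qed
qed


section \<open>Permutations belonging to path pairs\<close>

lemma blow_perm_permutes:
  assumes "word n c" "1 < i" "i < n" "f permutes {1..n}"
  shows "blow_perm i c f permutes {1..n+1}"
proof (cases "c i")
  case Black
  note a = word_next_white[OF assms(1) Black assms(2,3)]
  have "transpose (i + 1) (next_white c i + 1) permutes {1..n+1}"
    using a(1,3) assms by (intro permutes_swap_id) auto
  then show ?thesis using assms Black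
    by (auto simp: blow_perm_def intro!: permutes_compose ins_permutes[simplified])
next
  case White
  note a = word_prev_black[OF assms(1) White assms(2,3)]
  have "transpose i (prev_black c i) permutes {1..n+1}"
    using a(1,3) assms by (intro permutes_swap_id) auto
  then show ?thesis using assms White
    by (auto simp: blow_perm_def intro!: permutes_compose ins_permutes[simplified])
qed

lemma perm0_permutes: "perm0 permutes {1..4}"
proof -
  have "bij perm0"
  proof (rule o_bij)
    show "perm0 \<circ> perm0 = id" "perm0 \<circ> perm0 = id" by (auto simp: perm0_def fun_eq_iff)
  qed
  then show ?thesis by (auto simp: permutes_def bij_iff perm0_def)
qed

lemma bcfw_state_permutes: "bcfw_state n k c f \<Longrightarrow> f permutes {1..n} \<and> word n c"
proof (induction rule: bcfw_state.induct)
  case base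
  show ?case using perm0_permutes word_col0 by simp
next
  case (blow n k c f i)
  then show ?case using blow_perm_permutes word_blow by blast
qed

lemma path_state_permutes: "path_state n k p q f \<Longrightarrow> f permutes {1..n}"
  using path_state_tail_state bcfw_state_permutes bcfw_state_eq_tail_state by metis

text \<open>The letter after the last black one is white, so the transposition exchanges two
  neighbouring values. One of them is the inserted value, and the effect is just to insert a value
  larger by one.\<close>

lemma blow_perm_west:
  "blow_perm (last_south q + 2) (path_col q) f = ins (last_south q + 2) (last_south q + 4) f"
proof -
  let ?l = "last_south q + 2"
  have "next_white (path_col q) ?l = ?l + 1"
    using path_col_after_last_south[of q "?l + 1"] last_south_le[of q]
    by (intro next_whiteI) auto
  then have "blow_perm ?l (path_col q) f = transpose (?l + 1) (?l + 1 + 1) \<circ> ins ?l (?l + 1) f"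
    by (rule blow_perm_black[where c = "path_col q", OF path_col_last_south])
  also have "\<dots> = ins ?l (?l + 2) f"
    by (rule ext) (auto simp: ins_def sh_def transpose_def)
  finally show ?thesis by (simp add: eval_nat_numeral)
qed

lemma blow_perm_south:
  "blow_perm (length q + 3) (path_col (q @ replicate m West)) f
     = transpose (length q + 3) (last_south q + 2) \<circ> ins (length q + 4) (length q + 3) f"
proof -
  have "path_col (q @ replicate m West) (length q + 3) = White"
    by (rule path_col_tail_west) auto
  moreover have "prev_black (path_col (q @ replicate m West)) (length q + 3) = last_south q + 2"
    using path_col_after_last_south[of "q @ replicate m West"] path_col_last_south[of "q @ replicate m West"]
       last_south_le[of q]
    by (intro prev_blackI) auto
  ultimately show ?thesis by (subst blow_perm_white) (auto simp: eval_nat_numeral)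
qed

text \<open>This makes the last south step of the lower path visible in the permutation. A west step
  leaves the value alone, and in a south step the transposition moves it to the new black
  place.\<close>

lemma path_state_last: "path_state n k p q f \<Longrightarrow> f n = last_south q + 2"
proof (induction rule: path_state.induct)
  case base
  show ?case by (simp add: perm0_def)
next
  case (west n k p q f)
  have "last_south q + 2 < n + 1" 
    using path_state_length[OF west(1)] last_south_le[of q] by simp
  then show ?case using west(2) by (simp add: blow_perm_west[simplified] ins_def unsh_def sh_def)
next
  case (south n k p q m f)
  have "n = length q + m + 4" using path_state_length[OF south(1)] by simp
  then have "ins (length q + 4) (length q + 3) f (n + 1) = sh (length q + 3) (f n)"
    by (simp add: ins_def unsh_def ac_simps)
  also have "\<dots> = last_south q + 2" using south(2) last_south_le[of q] by (simp add: sh_def)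
  finally show ?case unfolding blow_perm_south by simp
qed

text \<open>Used twice. A value \<open>x + 1\<close> at \<open>x\<close> would be needed if one
  permutation arose both by a west and by a south step; after rotation it would become
  \<open>x - 1\<close>, the only value for which raising by one destroys the inequality
  \<open>h x < x\<close>.\<close>

lemma path_state_no_short:
  "path_state n k p q f \<Longrightarrow> f x \<noteq> x + 1 \<and> (1 \<le> x \<longrightarrow> x \<le> n \<longrightarrow> f x \<noteq> x)"
proof (induction arbitrary: x rule: path_state.induct)
  case base
  show ?case by (simp add: perm0_def)
next
  case (west n k p q f)
  let ?l = "last_south q + 2"
  have l: "?l + 2 \<le> n" 
    using path_state_length[OF west(1)] last_south_le[of q] by simp
  have f0: "f 0 = 0" using path_state_permutes[OF west(1)] by (simp add: permutes_def)
  show ?case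
  proof (cases "x = ?l")
    case True
    then show ?thesis by (simp add: blow_perm_west[simplified] ins_def)
  next
    case False
    then obtain y where y: "x = sh ?l y" by (metis sh_unsh)
    then have "blow_perm ?l (path_col q) f x = sh (?l + 2) (f y)"
      unfolding blow_perm_west by (simp add: ins_def eval_nat_numeral)
    moreover have "sh (?l + 2) (f y) \<noteq> x + 1 \<and> (1 \<le> x \<longrightarrow> x \<le> n + 1 \<longrightarrow> sh (?l + 2) (f y) \<noteq> x)"
      using west(2)[of y] l f0 y by (cases "y = 0") (auto simp: sh_def)
    ultimately show ?thesis by simp
  qed
next
  case (south n k p q m f)
  let ?i = "length q + 3"
  have n: "n = length q + m + 4" using path_state_length[OF south(1)] by simp
  have b: "f n = last_south q + 2" using path_state_last[OF south(1)] by simp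
  have fb: "f y = last_south q + 2 \<longleftrightarrow> y = n" for y
    using b path_state_permutes[OF south(1)] by (metis permutes_inj injD)
  have f0: "f 0 = 0" using path_state_permutes[OF south(1)] by (simp add: permutes_def)
  note l = last_south_le[of q]
  define g where "g = blow_perm ?i (path_col (q @ replicate m West)) f"
  have g: "g = transpose ?i (last_south q + 2) \<circ> ins (?i + 1) ?i f"
    unfolding g_def blow_perm_south by (simp add: eval_nat_numeral)
  have "g x \<noteq> x + 1 \<and> (1 \<le> x \<longrightarrow> x \<le> n + 1 \<longrightarrow> g x \<noteq> x)"
  proof (cases "x = ?i + 1")
    case True
    then have "g x = last_south q + 2" unfolding g by simp
    then show ?thesis using True l by simp
  next
    case False
    then obtain y where y: "x = sh (?i + 1) y" by (metis sh_unsh)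
    then have gx: "g x = transpose ?i (last_south q + 2) (sh ?i (f y))" unfolding g by simp
    show ?thesis
    proof (cases "y = n")
      case True
      then have "sh ?i (f y) = last_south q + 2" using b l by (simp add: sh_def)
      then have "g x = ?i" using gx by simp
      moreover have "x = n + 1" using y True n by (simp add: sh_def)
      ultimately show ?thesis using n by simp
    next
      case False
      then have "f y \<noteq> last_south q + 2" using fb by simp
      then have "sh ?i (f y) \<noteq> last_south q + 2" using l by (auto simp: sh_def)
      then have "g x = sh ?i (f y)" using gx by (simp add: transpose_def)
      moreover have "sh ?i (f y) \<noteq> x + 1 \<and> (1 \<le> x \<longrightarrow> x \<le> n + 1 \<longrightarrow> sh ?i (f y) \<noteq> x)"
        using south(2)[of y] f0 y n by (cases "y = 0") (auto simp: sh_def)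
      ultimately show ?thesis by simp
    qed
  qed
  then show ?case by (simp add: g_def)
qed

section \<open>Rotation by the square of the long cycle\<close>

definition back2 :: "nat \<Rightarrow> (nat \<Rightarrow> nat) \<Rightarrow> nat \<Rightarrow> nat" where
  "back2 n f = cyc n \<circ> cyc n \<circ> f"

lemma cyc2:
  assumes "2 \<le> n"
  shows "v = 0 \<or> n < v \<Longrightarrow> cyc n (cyc n v) = v"
    and "3 \<le> v \<Longrightarrow> v \<le> n \<Longrightarrow> cyc n (cyc n v) = v - 2"
    and "cyc n (cyc n 1) = n - 1"
    and "cyc n (cyc n 2) = n"
proof -
  show "cyc n (cyc n v) = v" if "v = 0 \<or> n < v"
  proof -
    have "cyc n v = v" using that assms by (auto simp: cyc_def)
    then show ?thesis by simp
  qed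
  show "cyc n (cyc n v) = v - 2" if "3 \<le> v" "v \<le> n"
  proof -
    have "cyc n v = v - 1" "cyc n (v - 1) = v - 1 - 1" using that by (auto simp: cyc_def)
    then show ?thesis by simp
  qed
  have "cyc n 1 = n" "cyc n n = n - 1" "cyc n 2 = 1" using assms by (auto simp: cyc_def)
  then show "cyc n (cyc n 1) = n - 1" "cyc n (cyc n 2) = n" by simp_all
qed

text \<open>Values from 3 on are lowered by 2, so a gap at \<open>s + 2\<close> becomes one at
  \<open>s\<close>. The values 1 and 2 lie below the first gap but wrap around to the top, above the
  second; this agrees because the longer cycle sends them one higher.\<close>

lemma cyc2_sh:
  assumes "1 \<le> s" "s + 1 \<le> n"
  shows "cyc (n + 1) (cyc (n + 1) (sh (s + 2) v)) = sh s (cyc n (cyc n v))"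
proof -
  consider "v = 0" | "n < v" | "v = 1" | "v = 2" | "3 \<le> v" "v \<le> n" "v < s + 2" | "3 \<le> v" "v \<le> n" "s + 2 \<le> v"
    by linarith
  then show ?thesis
  proof cases
    case 1
    then show ?thesis using assms cyc2(1)[of n 0] cyc2(1)[of "n + 1" 0] by (simp add: sh_def)
  next
    case 2
    then show ?thesis using assms cyc2(1)[of n v] cyc2(1)[of "n + 1" "v + 1"] by (simp add: sh_def)
  next
    case 3
    then have "sh (s + 2) v = 1" "cyc n (cyc n v) = n - 1" "cyc (n + 1) (cyc (n + 1) 1) = n"
      using assms cyc2(3)[of n] cyc2(3)[of "n + 1"] by (auto simp: sh_def)
    then show ?thesis using assms by (simp add: sh_def)
  next
    case 4
    then have "sh (s + 2) v = 2" "cyc n (cyc n v) = n" "cyc (n + 1) (cyc (n + 1) 2) = n + 1"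
      using assms cyc2(4)[of n] cyc2(4)[of "n + 1"] by (auto simp: sh_def)
    then show ?thesis using assms by (simp add: sh_def)
  next
    case 5
    then have "sh (s + 2) v = v" by (simp add: sh_def)
    then show ?thesis using 5 cyc2(2)[of n v] cyc2(2)[of "n + 1" v] by (simp add: sh_def)
  next
    case 6
    then have "sh (s + 2) v = v + 1" by (simp add: sh_def)
    then show ?thesis using 6 cyc2(2)[of n v] cyc2(2)[of "n + 1" "v + 1"] by (auto simp: sh_def)
  qed
qed

text \<open>The inserted value exceeds its place by 2, which the rotation takes off: a fixed point
  is inserted.\<close>

lemma back2_west:
  assumes "path_state n k p q f"
  shows "back2 (n + 1) (blow_perm (last_south q + 2) (path_col q) f)
       = ins (last_south q + 2) (last_south q + 2) (back2 n f)"
proof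
  fix x
  let ?l = "last_south q + 2"
  have l: "?l + 2 \<le> n" 
    using path_state_length[OF assms] last_south_le[of q] by simp
  have "cyc (n + 1) (cyc (n + 1) (?l + 2)) = ?l" using l cyc2(2)[of "n + 1" "?l + 2"] by simp
  moreover have "cyc (n + 1) (cyc (n + 1) (sh (?l + 2) v)) = sh ?l (cyc n (cyc n v))" for v
    using l by (intro cyc2_sh) auto
  ultimately show "back2 (n + 1) (blow_perm ?l (path_col q) f) x = ins ?l ?l (back2 n f) x"
    by (simp add: back2_def blow_perm_west[simplified] ins_def eval_nat_numeral)
qed

(* The 5-cycle s, s+1, s+2, s+3, m. *)
definition cycle5 :: "nat \<Rightarrow> nat \<Rightarrow> nat \<Rightarrow> nat" where
  "cycle5 s m x = (if s \<le> x \<and> x < s + 3 then x + 1 else if x = s + 3 then m else if x = m then s else x)"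

lemma back2_south:
  assumes "path_state n k p (q @ replicate m West) f"
  shows "back2 (n + 1) (blow_perm (length q + 3) (path_col (q @ replicate m West)) f)
       = ins (length q + 1) (length q + 1) (back2 n f) \<circ> cycle5 (length q + 1) (n + 1)"
proof
  fix x
  let ?s = "length q + 1" and ?b = "last_south q + 2"
  have n: "n = ?s + m + 3" using path_state_length[OF assms] by simp
  have b: "f n = ?b" using path_state_last[OF assms] by simp
  have fb: "f y = ?b \<longleftrightarrow> y = n" for y
    using b path_state_permutes[OF assms] by (metis permutes_inj injD)
  note l = last_south_le[of q]
  have sh: "cyc (n + 1) (cyc (n + 1) (sh (?s + 2) v)) = sh ?s (cyc n (cyc n v))" for v
    using n by (intro cyc2_sh) auto
  have s: "cyc (n + 1) (cyc (n + 1) (?s + 2)) = ?s" using n cyc2(2)[of "n + 1" "?s + 2"] by simp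
  have shb: "sh (?s + 2) ?b = ?b" using l by (simp add: sh_def)
  define g where "g = blow_perm (length q + 3) (path_col (q @ replicate m West)) f"
  have g: "g = transpose (?s + 2) ?b \<circ> ins (?s + 3) (?s + 2) f"
    unfolding g_def blow_perm_south by (simp add: eval_nat_numeral)
  have g1: "g (?s + 3) = ?b" by (simp add: g)
  have g2: "g (n + 1) = ?s + 2"
    using ins_sh[of "?s+3" "?s+2" f n] n b shb l by (simp add: g sh_def eval_nat_numeral)
  have g3: "g x = sh (?s + 2) (f (unsh (?s + 3) x))" if "x \<noteq> ?s + 3" "x \<noteq> n + 1"
  proof -
    have "unsh (?s + 3) x \<noteq> n" using that n by (auto simp: unsh_def)
    then have "f (unsh (?s + 3) x) \<noteq> ?b" using fb by simp
    then have "sh (?s + 2) (f (unsh (?s + 3) x)) \<noteq> ?b" using shb by (metis sh_inject)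
    then show ?thesis using that by (simp add: g ins_def transpose_def)
  qed
  have r: "back2 (n + 1) g x = cyc (n + 1) (cyc (n + 1) (g x))" by (simp add: back2_def)
  consider "x = ?s + 3" | "x = n + 1" | "x \<noteq> ?s + 3" "x \<noteq> n + 1" by blast
  then have "back2 (n + 1) g x = ins ?s ?s (back2 n f) (cycle5 ?s (n + 1) x)"
  proof cases
    case 1
    have "back2 (n + 1) g x = sh ?s (cyc n (cyc n ?b))" using sh[of ?b] shb r 1 g1 by simp
    moreover have "cycle5 ?s (n + 1) x = n + 1" using 1 n by (simp add: cycle5_def)
    moreover have "ins ?s ?s (back2 n f) (n + 1) = sh ?s (back2 n f n)" using n by (simp add: ins_def unsh_def)
    ultimately show ?thesis using b by (simp add: back2_def)
  next
    case 2
    then have "back2 (n + 1) g x = ?s" using r g2 s by simp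
    moreover have "cycle5 ?s (n + 1) x = ?s" using 2 n by (simp add: cycle5_def)
    ultimately show ?thesis by simp
  next
    case 3
    \<comment> \<open>Away from the two places with exchanged values, the 5-cycle only converts an
      insertion at place \<open>s + 3\<close> into one at place \<open>s\<close>.\<close>
    have "cycle5 ?s (n + 1) x = sh ?s (unsh (?s + 3) x)"
      using 3 by (auto simp: cycle5_def sh_def unsh_def)
    then show ?thesis using r g3[OF 3] sh by (simp add: back2_def)
  qed
  then show "back2 (n + 1) (blow_perm (length q + 3) (path_col (q @ replicate m West)) f) x
       = (ins ?s ?s (back2 n f) \<circ> cycle5 ?s (n + 1)) x"
    by (simp add: g_def)
qed

lemma back2_permutes: "f permutes {1..n} \<Longrightarrow> 2 \<le> n \<Longrightarrow> back2 n f permutes {1..n}"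
proof -
  assume f: "f permutes {1..n}" and n: "2 \<le> n"
  have "bij (cyc n)"
  proof (rule o_bij)
    define d where "d i = (if i = n then 1 else if i \<in> {1..n} then i + 1 else i)" for i
    show "d \<circ> cyc n = id" "cyc n \<circ> d = id"
      using n by (auto simp: d_def cyc_def fun_eq_iff)
  qed
  then have "cyc n permutes {1..n}" using n by (auto simp: permutes_def bij_iff cyc_def)
  then show ?thesis using f by (auto simp: back2_def intro!: permutes_compose)
qed

lemma cyc_inject: "2 \<le> n \<Longrightarrow> cyc n x = cyc n y \<Longrightarrow> x = y"
  by (auto simp: cyc_def split: if_splits)

lemma back2_inject: "2 \<le> n \<Longrightarrow> back2 n f = back2 n g \<Longrightarrow> f = g"
  using cyc_inject by (auto simp: back2_def fun_eq_iff)

lemma transpose_comp_involutory: "transpose a b \<circ> transpose a b = id"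
  by (rule ext) (auto simp: transpose_def)

text \<open>The value at the last place gives the last black place \<open>l\<close>. If one
  derivation ended with west, the value at \<open>l\<close> would be \<open>l + 2\<close>; if the
  other ended with south, this would force the value \<open>l + 1\<close> at \<open>l\<close> one
  step earlier, contrary to \<open>path_state_no_short\<close>. With equal last steps, transposition
  and insertion can be undone.\<close>

lemma path_state_inject:
  "path_state n k p q f \<Longrightarrow> path_state n k' p' q' f \<Longrightarrow> p = p' \<and> q = q'"
proof (induction arbitrary: k' p' q' rule: path_state.induct)
  case base
  then show ?case using path_state_length[OF base] by auto
next
  case (west n k p q f)
  let ?g = "blow_perm (last_south q + 2) (path_col q) f"
  have n: "n = length q + 4" using path_state_length[OF west(1)] by simp
  have e: "last_south q' = last_south q"
    using path_state_last[OF path_state.west[OF west(1)]] path_state_last[OF west(3)] by simp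
  from west(3) show ?case
  proof (cases rule: path_state.cases)
    case base
    then show ?thesis using n by simp
  next
    case (west n1 p1 q1 f1)
    then have "f1 = f" using e by (simp add: blow_perm_west[simplified])
    then show ?thesis using west \<open>\<And>k' p' q'. path_state n k' p' q' f \<Longrightarrow> _\<close> by auto
  next
    case (south n1 k1 p1 q1 m f1)
    have n1: "n = n1" "n1 = length q1 + m + 4" using south path_state_length[OF \<open>path_state n1 k1 p1 (q1 @ replicate m West) f1\<close>] by auto
    have l: "last_south q = length q1 + 1" using south e by simp
    have "?g (length q1 + 3) = length q1 + 5" unfolding blow_perm_west unfolding l by (simp add: ins_def)
    then have "transpose (length q1 + 3) (last_south q1 + 2) (sh (length q1 + 3) (f1 (length q1 + 3))) = length q1 + 5"
      using south unfolding blow_perm_south by (simp add: ins_def unsh_def)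
    then have "sh (length q1 + 3) (f1 (length q1 + 3)) = length q1 + 5"
      using last_south_le[of q1] by (auto simp: transpose_def split: if_splits)
    then have "f1 (length q1 + 3) = length q1 + 3 + 1" by (auto simp: sh_def split: if_splits)
    then show ?thesis using path_state_no_short[OF \<open>path_state n1 k1 p1 (q1 @ replicate m West) f1\<close>] south by blast
  qed
next
  case (south n k p q m f)
  let ?g = "blow_perm (length q + 3) (path_col (q @ replicate m West)) f"
  have n: "n = length q + m + 4" using path_state_length[OF south(1)] by simp
  have e: "last_south q' = length q + 1"
    using path_state_last[OF path_state.south[OF south(1)]] path_state_last[OF south(3)] by simp
  from south(3) show ?case
  proof (cases rule: path_state.cases)
    case base
    then show ?thesis using n by simp
  next
    case (west n1 p1 q1 f1)
    then have l: "last_south q1 = length q + 1" using e by simp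
    have "?g = ins (length q + 3) (length q + 5) f1"
      using west l blow_perm_west[of q1 f1] by (simp add: eval_nat_numeral)
    then have "?g (length q + 3) = length q + 5" by simp
    then have "transpose (length q + 3) (last_south q + 2) (sh (length q + 3) (f (length q + 3))) = length q + 5"
      unfolding blow_perm_south by (simp add: ins_def unsh_def)
    then have "sh (length q + 3) (f (length q + 3)) = length q + 5"
      using last_south_le[of q] by (auto simp: transpose_def split: if_splits)
    then have "f (length q + 3) = length q + 3 + 1" by (auto simp: sh_def split: if_splits)
    then show ?thesis using path_state_no_short[OF south(1)] by blast
  next
    case (south n1 k1 p1 q1 m1 f1)
    have l: "length q1 = length q" using e south by simp
    have m: "m1 = m" using n south path_state_length[OF \<open>path_state n1 k1 p1 (q1 @ replicate m1 West) f1\<close>] l by simp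
    have g: "?g = blow_perm (length q1 + 3) (path_col (q1 @ replicate m1 West)) f1"
      using south by simp
    \<comment> \<open>The transposition involves the previous last south step. It is read off at the
      inserted place, after which the transposition can be cancelled.\<close>
    have "?g (length q + 4) = last_south q + 2" unfolding blow_perm_south by simp
    moreover have "blow_perm (length q1 + 3) (path_col (q1 @ replicate m1 West)) f1 (length q1 + 4) = last_south q1 + 2"
      unfolding blow_perm_south by simp
    then have "?g (length q + 4) = last_south q1 + 2" unfolding g l .
    ultimately have "last_south q1 = last_south q" by simp
    then have "transpose (length q + 3) (last_south q + 2) \<circ> ins (length q + 4) (length q + 3) f
        = transpose (length q + 3) (last_south q + 2) \<circ> ins (length q + 4) (length q + 3) f1"
      using g[unfolded blow_perm_south[of q] blow_perm_south[of q1]] l by simp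
    then have "ins (length q + 4) (length q + 3) f = ins (length q + 4) (length q + 3) f1"
      by (metis comp_assoc id_comp transpose_comp_involutory)
    then have "f1 = f" by simp
    then have "p = p1 \<and> q @ replicate m West = q1 @ replicate m1 West"
      using \<open>\<And>k' p' q'. path_state n k' p' q' f \<Longrightarrow> _\<close> south by auto
    then show ?thesis using l m south by simp
  qed
qed

text \<open>With all fixed points black, the number of anti-excedances is the dimension of the
  subspaces in the cell; this is needed for nonemptiness. A west step adds a fixed point, a south
  step the anti-excedance at \<open>n + 1\<close>.\<close>

lemma path_state_count:
  "path_state n k p q f \<Longrightarrow> card {x \<in> {1..n}. back2 n f x < x} = k"
proof (induction rule: path_state.induct)
  case base
  have "back2 4 perm0 x = x" for x
    by (cases "x \<in> {1, 2, 3, 4}") (auto simp: back2_def cyc_def perm0_def)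
  then have "{x \<in> {1..4}. back2 4 perm0 x < x} = {}" by simp
  then show ?case by simp
next
  case (west n k p q f)
  let ?l = "last_south q + 2" and ?h = "back2 n f"
  have l: "?l + 2 \<le> n" 
    using path_state_length[OF west(1)] last_south_le[of q] by simp
  have "{x \<in> {1..n + 1}. ins ?l ?l ?h x < x} = sh ?l ` {x \<in> {1..n}. ?h x < x}" (is "?A = ?B")
  proof (intro subset_antisym subsetI)
    fix x assume x: "x \<in> ?A"
    then have "x \<noteq> ?l" by auto
    then have "x = sh ?l (unsh ?l x)" by (simp add: sh_unsh)
    moreover have "unsh ?l x \<in> {x \<in> {1..n}. ?h x < x}"
      using x \<open>x \<noteq> ?l\<close> l by (auto simp: ins_def sh_def unsh_def split: if_splits)
    ultimately show "x \<in> ?B" by blast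
  next
    fix x assume "x \<in> ?B"
    then show "x \<in> ?A" using l by (auto simp: sh_def ins_def unsh_def split: if_splits)
  qed
  moreover have "card (sh ?l ` {x \<in> {1..n}. ?h x < x}) = k"
    using west(2) by (subst card_image) (auto simp: inj_on_def)
  ultimately show ?case by (simp only: back2_west[OF west(1)])
next
  case (south n k p q m f)
  let ?s = "length q + 1" and ?h = "back2 n f"
  have n: "n = ?s + m + 3" using path_state_length[OF south(1)] by simp
  have fr: "1 \<le> f x \<and> f x \<le> n" if "1 \<le> x" "x \<le> n" for x
    using permutes_in_image[OF path_state_permutes[OF south(1)], of x] that by simp
  have h: "?h x = (if 3 \<le> f x then f x - 2 else f x + n - 2)" if x: "1 \<le> x" "x \<le> n" for x
  proof -
    consider "f x = 1" | "f x = 2" | "3 \<le> f x" using fr[OF x] by linarith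
    then show ?thesis using fr[OF x] n cyc2(2)[of n "f x"] cyc2(3,4)[of n]
      by cases (simp_all add: back2_def)
  qed
  \<comment> \<open>For a place that does not move, raising its value by one could spoil
    \<open>h x < x\<close> only in this case.\<close>
  have ne: "?h x \<noteq> x - 1" if "1 \<le> x" "x < n" for x
    using h[of x] fr[of x] that path_state_no_short[OF south(1), of x] n by auto
  have hn: "?h n = (if 1 \<le> last_south q then last_south q else n)"
    using h[of n] path_state_last[OF south(1)] n by simp
  let ?A = "{x \<in> {1..n}. ?h x < x}"
  let ?h' = "ins ?s ?s ?h \<circ> cycle5 ?s (n + 1)"
  have v: "?h' x = sh ?s (?h (unsh (?s + 3) x))" if "x \<noteq> ?s + 3" "x \<noteq> n + 1" for x
  proof -
    have "cycle5 ?s (n + 1) x = sh ?s (unsh (?s + 3) x)"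
      using that by (auto simp: cycle5_def sh_def unsh_def)
    then show ?thesis by simp
  qed
  have v1: "?h' (?s + 3) = sh ?s (?h n)" using n by (simp add: cycle5_def ins_def unsh_def)
  have v2: "?h' (n + 1) = ?s" using n by (simp add: cycle5_def)
  \<comment> \<open>Where the value of an old place is found after the step, up to the shift at
    \<open>s\<close>: places up to \<open>s + 2\<close> stay, \<open>n\<close> goes to the inserted
    place \<open>s + 3\<close>, the others move up by one.\<close>
  define r where "r x = (if x \<le> ?s + 2 then x else if x = n then ?s + 3 else x + 1)" for x
  have r: "?h' (r x) < r x \<longleftrightarrow> ?h x < x" if x: "1 \<le> x" "x \<le> n" for x
  proof -
    consider "x = n" | "x < n" "x \<le> ?s + 2" | "x < n" "?s + 2 < x" using x n by linarith
    then show ?thesis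
    proof cases
      case 1
      then have "r x = ?s + 3" using n by (simp add: r_def)
      then show ?thesis using v1 hn 1 n last_south_le[of q] by (auto simp: sh_def split: if_splits)
    next
      case 2
      then have e: "r x = x" "x \<noteq> ?s + 3" "x \<noteq> n + 1" by (auto simp: r_def)
      have "?h' x = sh ?s (?h x)" using v[OF e(2,3)] 2 by (simp add: unsh_def)
      then show ?thesis using e ne[of x] 2 x by (auto simp: sh_def)
    next
      case 3
      then have e: "r x = x + 1" "x + 1 \<noteq> ?s + 3" "x + 1 \<noteq> n + 1" by (auto simp: r_def)
      have "?h' (x + 1) = sh ?s (?h x)" using v[OF e(2,3)] 3 by (simp add: unsh_def)
      then show ?thesis using e 3 by (auto simp: sh_def)
    qed
  qed
  have rr: "r x \<in> {1..n}" if "x \<in> {1..n}" for x using that n by (auto simp: r_def)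
  have inj: "inj_on r {1..n}"
  proof (rule inj_onI)
    fix x y assume a: "x \<in> {1..n}" "y \<in> {1..n}" "r x = r y"
    have b: "x \<le> n" "y \<le> n" using a by auto
    show "x = y" using a(3) b n unfolding r_def
      by (cases "x \<le> ?s + 2"; cases "y \<le> ?s + 2"; cases "x = n"; cases "y = n") simp_all
  qed
  then have "r ` {1..n} = {1..n}" using rr by (intro card_subset_eq) (auto simp: card_image)
  have "{x \<in> {1..n + 1}. ?h' x < x} = insert (n + 1) (r ` ?A)"
  proof (intro subset_antisym subsetI)
    fix x assume x: "x \<in> {x \<in> {1..n + 1}. ?h' x < x}"
    show "x \<in> insert (n + 1) (r ` ?A)"
    proof (cases "x = n + 1")
      case False
      then have "x \<in> r ` {1..n}" using x \<open>r ` {1..n} = {1..n}\<close> by auto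
      then show ?thesis using r x by auto
    qed simp
  next
    fix x assume "x \<in> insert (n + 1) (r ` ?A)"
    then consider "x = n + 1" | y where "x = r y" "y \<in> ?A" by blast
    then show "x \<in> {x \<in> {1..n + 1}. ?h' x < x}"
    proof cases
      case 1
      then show ?thesis using v2 n by auto
    next
      case 2
      then show ?thesis using r[of y] rr[of y] by auto
    qed
  qed
  moreover have "card (r ` ?A) = k"
  proof -
    have "?A \<subseteq> {1..n}" by auto
    from card_image[OF inj_on_subset[OF inj this]] show ?thesis using south(2) by simp
  qed
  moreover have "n + 1 \<notin> r ` ?A"
  proof
    assume "n + 1 \<in> r ` ?A"
    then obtain x where "x \<in> ?A" "n + 1 = r x" by (rule imageE)
    with rr[of x] show False by simp
  qed
  ultimately have "card {x \<in> {1..n + 1}. ?h' x < x} = k + 1" by simp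
  then show ?case by (simp only: back2_south[OF south(1)])
qed

section \<open>Recursion for the diagrams\<close>

fun path_rows :: "step list \<Rightarrow> nat list" where
  "path_rows [] = []"
| "path_rows (West # q) = path_rows q"
| "path_rows (South # q) = count_list q West # path_rows q"

definition shape :: "nat list \<Rightarrow> (nat \<times> nat) set" where
  "shape L = {(r, c). r < length L \<and> c < L ! r}"

lemma length_path_rows [simp]: "length (path_rows q) = count_list q South"
  by (induction q rule: path_rows.induct) auto

lemma young_Nil [simp]: "young_of_path [] = {}"
  by (auto simp: young_of_path_def)

lemma young_West: "young_of_path (West # q) = young_of_path q"
proof -
  have "(\<exists>p1 p2. West # q = p1 @ South # p2 \<and> count_list p1 South = r \<and> c < count_list p2 West)
      \<longleftrightarrow> (\<exists>p1 p2. q = p1 @ South # p2 \<and> count_list p1 South = r \<and> c < count_list p2 West)" (is "?A \<longleftrightarrow> ?B") for r c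
  proof
    assume ?A
    then obtain p1 p2 where 1: "West # q = p1 @ South # p2" "count_list p1 South = r" "c < count_list p2 West" by blast
    then obtain p1' where "p1 = West # p1'" by (cases p1) auto
    with 1 show ?B by auto
  next
    assume ?B
    then obtain p1 p2 where 1: "q = p1 @ South # p2" "count_list p1 South = r" "c < count_list p2 West" by blast
    then show ?A by (intro exI[of _ "West # p1"] exI[of _ p2]) auto
  qed
  then show ?thesis by (simp add: young_of_path_def)
qed

lemma young_South: "young_of_path (South # q) = {0} \<times> {0..<count_list q West} \<union> (\<lambda>(r, c). (Suc r, c)) ` young_of_path q"
proof (intro subset_antisym subsetI)
  fix b assume "b \<in> young_of_path (South # q)"
  then obtain r c p1 p2 where 1: "b = (r, c)" "South # q = p1 @ South # p2" "count_list p1 South = r" "c < count_list p2 West"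
    by (auto simp: young_of_path_def)
  show "b \<in> {0} \<times> {0..<count_list q West} \<union> (\<lambda>(r, c). (Suc r, c)) ` young_of_path q"
  proof (cases p1)
    case Nil
    then show ?thesis using 1 by auto
  next
    case (Cons a p1')
    then have "(count_list p1' South, c) \<in> young_of_path q" using 1 by (auto simp: young_of_path_def)
    then show ?thesis using 1 Cons by force
  qed
next
  fix b assume "b \<in> {0} \<times> {0..<count_list q West} \<union> (\<lambda>(r, c). (Suc r, c)) ` young_of_path q"
  then consider c where "b = (0, c)" "c < count_list q West"
    | r c p1 p2 where "b = (Suc r, c)" "q = p1 @ South # p2" "count_list p1 South = r" "c < count_list p2 West"
    by (auto simp: young_of_path_def)
  then show "b \<in> young_of_path (South # q)"
  proof cases
    case 1
    then show ?thesis by (auto simp: young_of_path_def intro: exI[of _ "[]"])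
  next
    case 2
    then have "\<exists>p1' p2'. South # q = p1' @ South # p2' \<and> count_list p1' South = Suc r \<and> c < count_list p2' West"
      by (intro exI[of _ "South # p1"] exI[of _ p2]) simp
    then show ?thesis using 2 by (simp add: young_of_path_def)
  qed
qed

lemma shape_Cons: "shape (a # L) = {0} \<times> {0..<a} \<union> (\<lambda>(r, c). (Suc r, c)) ` shape L"
proof -
  have "(r, c) \<in> shape (a # L) \<longleftrightarrow> r = 0 \<and> c < a \<or> (\<exists>r'. r = Suc r' \<and> (r', c) \<in> shape L)" for r c
    by (cases r) (auto simp: shape_def)
  moreover have "(r, c) \<in> (\<lambda>(r, c). (Suc r, c)) ` S \<longleftrightarrow> (\<exists>r'. r = Suc r' \<and> (r', c) \<in> S)" for r c :: nat and S
    by force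
  ultimately show ?thesis by (intro Set.set_eqI) (simp add: split_paired_all)
qed

lemma young_eq_shape: "young_of_path q = shape (path_rows q)"
  by (induction q rule: path_rows.induct) (simp_all add: young_West young_South shape_Cons, simp add: shape_def)

lemma path_rows_append_west [simp]: "path_rows (q @ [West]) = map Suc (path_rows q)"
  by (induction q rule: path_rows.induct) auto

lemma path_rows_replicate [simp]: "path_rows (replicate m West) = []"
  by (induction m) auto

lemma path_rows_append_south: "path_rows (q @ South # replicate m West) = path_rows (q @ replicate m West) @ [m]"
  by (induction q rule: path_rows.induct) (auto simp: count_list_replicate)

lemma path_rows_le: "x \<in> set (path_rows q) \<Longrightarrow> x \<le> count_list q West"
  by (induction q rule: path_rows.induct) auto

lemma path_rows_ge: "x \<in> set (path_rows (q @ replicate m West)) \<Longrightarrow> m \<le> x"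
  by (induction q rule: path_rows.induct) (auto simp: count_list_replicate)

lemma sorted_path_rows: "sorted_wrt (\<ge>) (path_rows q)"
  by (induction q rule: path_rows.induct) (auto dest: path_rows_le)

lemma add_four_shape: "length L = k \<Longrightarrow> add_four_columns k (shape L) = shape (map (\<lambda>x. x + 4) L)"
proof -
  assume k: "length L = k"
  have "(r, c) \<in> add_four_columns k (shape L) \<longleftrightarrow> (r, c) \<in> shape (map (\<lambda>x. x + 4) L)" for r c
  proof (cases "c < 4")
    case True
    then show ?thesis using k by (auto simp: add_four_columns_def shape_def)
  next
    case False
    then obtain c' where c: "c = c' + 4" by (metis add.commute le_Suc_ex not_less)
    then show ?thesis using k by (auto simp: add_four_columns_def shape_def image_def)
  qed
  then show ?thesis by auto
qed

section \<open>Fillings when a column or a bottom row is added\<close>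

definition filling :: "(nat \<times> nat) set \<Rightarrow> nat list \<Rightarrow> diagram" where
  "filling Y hs = fill_rest Y (place_pluses Y (fold (place_zeros Y) hs (fill_ends Y)))"

(* Without this the GREATEST in place_zeros would be arbitrary. *)
fun placeable :: "(nat \<times> nat) set \<Rightarrow> nat list \<Rightarrow> diagram \<Rightarrow> bool" where
  "placeable Y [] F = True"
| "placeable Y (i # hs) F = ((i = 0 \<or> (\<exists>c. \<forall>r<i. (r, c) \<in> Y \<and> F (r, c) = None)) \<and> placeable Y hs (place_zeros Y i F))"

lemma place_zeros_0 [simp]: "place_zeros Y 0 F = F"
  by (auto simp: place_zeros_def)

lemma Greatest_eq_bounded:
  fixes P :: "nat \<Rightarrow> bool"
  assumes "\<exists>c. P c" "\<And>c. P c \<Longrightarrow> c < b"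
  shows "P (GREATEST c. P c)" "\<And>c. P c \<Longrightarrow> c \<le> (GREATEST c. P c)"
proof -
  have b: "\<And>c. P c \<Longrightarrow> c \<le> b" using assms(2) less_imp_le by blast
  show "P (GREATEST c. P c)" using assms(1) GreatestI_nat[of P _ b] b by blast
  show "\<And>c. P c \<Longrightarrow> c \<le> (GREATEST c. P c)" using Greatest_le_nat[of P _ b] b by blast
qed

lemma sh_less: "sh v c < sh v d \<longleftrightarrow> c < d"
  by (auto simp: sh_def)

lemma sh_mono: "c \<le> d \<Longrightarrow> sh v c \<le> sh v d"
  by (auto simp: sh_def)

(* Appending a west step to both paths inserts a column of zeros at c0; all entries of the larger
   filling outside it are those of the smaller one. *)
locale west_move =
  fixes L :: "nat list" and k c0 :: nat
  assumes len: "length L = k" and k: "0 < k" and c0: "1 \<le> c0" "L ! (k - 1) = c0 + 1"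
    and ge: "r < k \<Longrightarrow> c0 + 1 \<le> L ! r"
begin

abbreviation "Y \<equiv> shape L"
abbreviation "Y' \<equiv> shape (map Suc L)"

lemma in_Y: "(r, c) \<in> Y \<longleftrightarrow> r < k \<and> c < L ! r" "(r, c) \<in> Y' \<longleftrightarrow> r < k \<and> c < Suc (L ! r)"
  using len by (auto simp: shape_def)

lemma in_Y': "(r, sh c0 c) \<in> Y' \<longleftrightarrow> (r, c) \<in> Y"
  using ge[of r] by (auto simp: in_Y sh_def)

text \<open>The relation between the fillings of the two shapes that is carried through the four
  filling steps.\<close>

definition zero_column :: "diagram \<Rightarrow> diagram \<Rightarrow> bool" where
  "zero_column F F' \<longleftrightarrow> (\<forall>r c. F' (r, sh c0 c) = F (r, c)) \<and> (\<forall>r. F' (r, c0) = (if r < k then Some Zero else None))"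

lemma zero_column_I:
  assumes "\<And>r c. F' (r, sh c0 c) = F (r, c)" "\<And>r. F' (r, c0) = (if r < k then Some Zero else None)"
  shows "zero_column F F'"
  using assms by (simp add: zero_column_def)

text \<open>The additional height is \<open>k\<close> and is processed before all others. In the
  larger shape the bottom row ends with a plus in column \<open>c0 + 1\<close>, and column
  \<open>c0\<close> is still empty in every row, so the zeros go there.\<close>

lemma zero_column_ends: "zero_column (fill_ends Y) (place_zeros Y' k (fill_ends Y'))"
proof -
  have "(GREATEST c. \<forall>r<k. (r, c) \<in> Y' \<and> fill_ends Y' (r, c) = None) = c0"
  proof (rule Greatest_equality)
    show "\<forall>r<k. (r, c0) \<in> Y' \<and> fill_ends Y' (r, c0) = None"
      using ge c0 by (force simp: in_Y fill_ends_def)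
    fix c assume "\<forall>r<k. (r, c) \<in> Y' \<and> fill_ends Y' (r, c) = None"
    then have "(k - 1, c) \<in> Y' \<and> fill_ends Y' (k - 1, c) = None" using k by simp
    then show "c \<le> c0" using c0 k by (auto simp: in_Y fill_ends_def split: if_splits)
  qed
  then have pz: "place_zeros Y' k (fill_ends Y') = (\<lambda>(r, c). if r < k \<and> c = c0 then Some Zero else fill_ends Y' (r, c))"
    by (simp add: place_zeros_def)
  show ?thesis
  proof (rule zero_column_I)
    fix r c
    have "sh c0 c = 0 \<longleftrightarrow> c = 0" using c0 by (auto simp: sh_def)
    moreover have "(r, Suc (sh c0 c)) \<in> Y' \<longleftrightarrow> (r, Suc c) \<in> Y" if "r < k"
      using ge[OF that] by (auto simp: in_Y sh_def)
    ultimately have "fill_ends Y' (r, sh c0 c) = fill_ends Y (r, c)"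
      using in_Y'[of r c] by (auto simp: fill_ends_def in_Y)
    then show "place_zeros Y' k (fill_ends Y') (r, sh c0 c) = fill_ends Y (r, c)" by (simp add: pz)
  next
    fix r
    show "place_zeros Y' k (fill_ends Y') (r, c0) = (if r < k then Some Zero else None)"
      unfolding pz by (auto simp: fill_ends_def in_Y)
  qed
qed

lemma zero_column_zeros:
  assumes z: "zero_column F F'" and ex: "i = 0 \<or> (\<exists>c. \<forall>r<i. (r, c) \<in> Y \<and> F (r, c) = None)"
  shows "zero_column (place_zeros Y i F) (place_zeros Y' i F')"
    and "i = 0 \<or> (\<exists>c. \<forall>r<i. (r, c) \<in> Y' \<and> F' (r, c) = None)"
proof -
  let ?P = "\<lambda>c. \<forall>r<i. (r, c) \<in> Y \<and> F (r, c) = None"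
  let ?P' = "\<lambda>c. \<forall>r<i. (r, c) \<in> Y' \<and> F' (r, c) = None"
  have PP: "?P' (sh c0 c) = ?P c" for c using z by (simp add: zero_column_def in_Y')
  show ex': "i = 0 \<or> (\<exists>c. ?P' c)" using ex PP by blast
  show "zero_column (place_zeros Y i F) (place_zeros Y' i F')"
  proof (cases "i = 0")
    case True
    then show ?thesis using z by simp
  next
    case False
    \<comment> \<open>The inserted column is occupied in row 0 already. Hence the eligible columns
      of both shapes correspond under \<open>sh c0\<close>, and so do the rightmost ones.\<close>
    have P0: "\<not> ?P' c0"
    proof
      assume "?P' c0"
      then have "F' (0, c0) = None" using False by blast
      then show False using z k by (simp add: zero_column_def)
    qed
    have e: "\<exists>c. ?P c" using ex False by blast
    have bd: "?P c \<Longrightarrow> c < L ! 0" for c using False by (auto simp: in_Y)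
    note G = Greatest_eq_bounded[of ?P, OF e bd]
    have G': "(GREATEST c. ?P' c) = sh c0 (GREATEST c. ?P c)"
    proof (rule Greatest_equality)
      show "?P' (sh c0 (GREATEST c. ?P c))" using G(1) PP by blast
      fix c assume c: "?P' c"
      then have "c \<noteq> c0" using P0 by blast
      then have c2: "c = sh c0 (unsh c0 c)" by (simp add: sh_unsh)
      then have "?P (unsh c0 c)" using c PP by metis
      then have "unsh c0 c \<le> (GREATEST c. ?P c)" using G(2) by blast
      then have "sh c0 (unsh c0 c) \<le> sh c0 (GREATEST c. ?P c)" by (rule sh_mono)
      then show "c \<le> sh c0 (GREATEST c. ?P c)" by (simp only: c2[symmetric])
    qed
    show ?thesis
      by (rule zero_column_I) (use z in \<open>auto simp: place_zeros_def G' zero_column_def\<close>)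
  qed
qed

lemma zero_column_fold:
  assumes "zero_column F F'" "placeable Y hs F"
  shows "zero_column (fold (place_zeros Y) hs F) (fold (place_zeros Y') hs F') \<and> placeable Y' hs F'"
  using assms
proof (induction hs arbitrary: F F')
  case (Cons i hs)
  then show ?case using zero_column_zeros[OF Cons.prems(1), of i] by simp
qed simp

text \<open>No box of the inserted column is empty, so the number of empty boxes to the right of a
  given box does not change.\<close>

lemma zero_column_pluses:
  assumes z: "zero_column F F'"
  shows "zero_column (place_pluses Y F) (place_pluses Y' F')"
proof (rule zero_column_I)
  fix r c
  have "{c'. sh c0 c < c' \<and> (r, c') \<in> Y' \<and> F' (r, c') = None} = sh c0 ` {c'. c < c' \<and> (r, c') \<in> Y \<and> F (r, c') = None}" (is "?A = ?B")
  proof (intro subset_antisym subsetI)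
    fix d assume d: "d \<in> ?A"
    then have "d \<noteq> c0" using z by (auto simp: zero_column_def in_Y)
    then have "d = sh c0 (unsh c0 d)" by (simp add: sh_unsh)
    moreover then have "sh c0 c < sh c0 (unsh c0 d) \<and> (r, sh c0 (unsh c0 d)) \<in> Y' \<and> F' (r, sh c0 (unsh c0 d)) = None" using d by simp
    then have "unsh c0 d \<in> {c'. c < c' \<and> (r, c') \<in> Y \<and> F (r, c') = None}"
      using z in_Y' by (simp add: zero_column_def sh_less)
    ultimately show "d \<in> ?B" by blast
  next
    fix d assume "d \<in> ?B"
    then obtain e where "d = sh c0 e" "c < e" "(r, e) \<in> Y" "F (r, e) = None" by auto
    then show "d \<in> ?A" using z in_Y' by (simp add: zero_column_def sh_less)
  qed
  then have "card {c'. sh c0 c < c' \<and> (r, c') \<in> Y' \<and> F' (r, c') = None} = card {c'. c < c' \<and> (r, c') \<in> Y \<and> F (r, c') = None}"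
    by (simp add: card_image inj_on_def)
  then show "place_pluses Y' F' (r, sh c0 c) = place_pluses Y F (r, c)"
    using z by (simp add: place_pluses_def zero_column_def in_Y')
next
  fix r show "place_pluses Y' F' (r, c0) = (if r < k then Some Zero else None)"
    using z by (simp add: place_pluses_def zero_column_def in_Y)
qed

lemma zero_column_rest:
  assumes z: "zero_column F F'"
  shows "zero_column (fill_rest Y F) (fill_rest Y' F')"
proof (rule zero_column_I)
  show "fill_rest Y' F' (r, sh c0 c) = fill_rest Y F (r, c)" for r c
    using z by (simp add: fill_rest_def zero_column_def in_Y')
  show "fill_rest Y' F' (r, c0) = (if r < k then Some Zero else None)" for r
    using z by (simp add: fill_rest_def zero_column_def in_Y)
qed

lemma filling_west:
  assumes "placeable Y hs (fill_ends Y)"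
  shows "zero_column (filling Y hs) (filling Y' (k # hs))" "placeable Y' (k # hs) (fill_ends Y')"
proof -
  note f = zero_column_fold[OF zero_column_ends assms]
  show "zero_column (filling Y hs) (filling Y' (k # hs))"
    using zero_column_rest[OF zero_column_pluses[OF conjunct1[OF f]]] by (simp add: filling_def)
  have "\<forall>r<k. (r, c0) \<in> Y' \<and> fill_ends Y' (r, c0) = None"
    using ge c0 by (force simp: in_Y fill_ends_def)
  then show "placeable Y' (k # hs) (fill_ends Y')" using f by auto
qed

end

locale south_move =
  fixes L :: "nat list" and k m :: nat
  assumes len: "length L = k"
begin

abbreviation "Y \<equiv> shape L"
abbreviation "Y' \<equiv> shape (L @ [m + 4])"

lemma in_Y: "(r, c) \<in> Y \<longleftrightarrow> r < k \<and> c < L ! r"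
  and in_Y': "(r, c) \<in> Y' \<longleftrightarrow> (r, c) \<in> Y \<or> r = k \<and> c < m + 4"
  using len by (auto simp: shape_def nth_append)

definition new_row :: "(nat \<Rightarrow> symbol option) \<Rightarrow> diagram \<Rightarrow> diagram \<Rightarrow> bool" where
  "new_row R F F' \<longleftrightarrow> (\<forall>r c. F' (r, c) = (if r = k then R c else F (r, c)))"

lemma new_row_ends: "new_row (\<lambda>c. if c = 0 \<or> c = m + 3 then Some Plus else None) (fill_ends Y) (fill_ends Y')"
  by (auto simp: new_row_def fill_ends_def in_Y in_Y')

text \<open>An available column has \<open>i\<close> boxes in the old shape, hence \<open>i\<close>
  is at most \<open>k\<close> and the bottom row is never reached.\<close>

lemma new_row_zeros:
  assumes z: "new_row R F F'" and ex: "i = 0 \<or> (\<exists>c. \<forall>r<i. (r, c) \<in> Y \<and> F (r, c) = None)"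
  shows "new_row R (place_zeros Y i F) (place_zeros Y' i F')"
    and "i = 0 \<or> (\<exists>c. \<forall>r<i. (r, c) \<in> Y' \<and> F' (r, c) = None)"
proof -
  have ik: "i \<le> k"
  proof (rule ccontr)
    assume "\<not> i \<le> k"
    then obtain c where "\<forall>r<i. (r, c) \<in> Y" using ex by auto
    then have "(k, c) \<in> Y" using \<open>\<not> i \<le> k\<close> by auto
    then show False by (simp add: in_Y)
  qed
  have PP: "(\<forall>r<i. (r, c) \<in> Y' \<and> F' (r, c) = None) = (\<forall>r<i. (r, c) \<in> Y \<and> F (r, c) = None)" for c
    using z ik by (auto simp: new_row_def in_Y')
  show "i = 0 \<or> (\<exists>c. \<forall>r<i. (r, c) \<in> Y' \<and> F' (r, c) = None)" using ex PP by simp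
  show "new_row R (place_zeros Y i F) (place_zeros Y' i F')"
    unfolding new_row_def place_zeros_def PP using z ik by (auto simp: new_row_def Let_def)
qed

lemma new_row_fold:
  assumes "new_row R F F'" "placeable Y hs F"
  shows "new_row R (fold (place_zeros Y) hs F) (fold (place_zeros Y') hs F') \<and> placeable Y' hs F'"
  using assms
proof (induction hs arbitrary: F F')
  case (Cons i hs)
  then show ?case using new_row_zeros[OF Cons.prems(1), of i] by simp
qed simp

text \<open>In the bottom row only the two ends are filled when the pluses are placed, so the
  further pluses go next to the right end. With the ends they are the four pluses that produce the
  5-cycle.\<close>

lemma filling_south:
  assumes "placeable Y hs (fill_ends Y)"
  shows "new_row (\<lambda>c. if c \<in> {0, m + 1, m + 2, m + 3} then Some Plus else if c < m + 4 then Some Zero else None)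
      (filling Y hs) (filling Y' hs)" and "placeable Y' hs (fill_ends Y')"
proof -
  let ?R = "\<lambda>c. if c = 0 \<or> c = m + 3 then Some Plus else None :: symbol option"
  let ?F = "fold (place_zeros Y) hs (fill_ends Y)" and ?F' = "fold (place_zeros Y') hs (fill_ends Y')"
  note f = new_row_fold[OF new_row_ends assms]
  show "placeable Y' hs (fill_ends Y')" using f by simp
  have z: "?F' (r, c) = (if r = k then ?R c else ?F (r, c))" for r c using f by (simp add: new_row_def)
  have c1: "place_pluses Y' ?F' (k, c) = (if c \<in> {0, m + 1, m + 2, m + 3} then Some Plus else None)" for c
  proof -
    have "{c'. c < c' \<and> (k, c') \<in> Y' \<and> ?F' (k, c') = None} = {max 1 (c + 1)..<m + 3}"
      by (auto simp: z in_Y' in_Y)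
    then have "card {c'. c < c' \<and> (k, c') \<in> Y' \<and> ?F' (k, c') = None} = m + 3 - (c + 1)" by simp
    then have "place_pluses Y' ?F' (k, c) = (if (k, c) \<in> Y' \<and> ?F' (k, c) = None \<and> m + 3 - (c + 1) < 2 then Some Plus else ?F' (k, c))"
      by (simp only: place_pluses_def prod.case)
    also have "\<dots> = (if c \<in> {0, m + 1, m + 2, m + 3} then Some Plus else None)"
      unfolding z by (auto simp: in_Y' in_Y)
    finally show ?thesis .
  qed
  have c2: "place_pluses Y' ?F' (r, c) = place_pluses Y ?F (r, c)" if "r \<noteq> k" for r c
    using that by (simp add: place_pluses_def z in_Y')
  show "new_row (\<lambda>c. if c \<in> {0, m + 1, m + 2, m + 3} then Some Plus else if c < m + 4 then Some Zero else None)
      (filling Y hs) (filling Y' hs)"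
    unfolding new_row_def filling_def fill_rest_def using c1 c2 by (auto simp: in_Y' in_Y)
qed

end

section \<open>Pipes of the diagrams\<close>

lemma cycle5_below: "x < s \<Longrightarrow> s \<le> m \<Longrightarrow> cycle5 s m x = x"
  by (simp add: cycle5_def)

lemma cycle5_above: "s + 3 < x \<Longrightarrow> x \<noteq> m \<Longrightarrow> cycle5 s m x = x"
  by (simp add: cycle5_def)

lemma cycle5_last: "s + 3 < m \<Longrightarrow> cycle5 s m m = s"
  by (simp add: cycle5_def)

text \<open>The pipe permutation on lines instead of labels, which separates the course of the pipes
  from the relabelling of the border.\<close>

definition outgoing :: "nat list \<Rightarrow> diagram \<Rightarrow> line \<Rightarrow> line" where
  "outgoing L D l = line_of (pipe_end D (southeast_edge (shape L) l))"

(* The last clause yields that fixed points label columns, hence are black. *)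
definition realizes :: "nat \<Rightarrow> nat \<Rightarrow> nat list \<Rightarrow> diagram \<Rightarrow> (nat \<Rightarrow> nat) \<Rightarrow> bool" where
  "realizes n k L D f \<longleftrightarrow> k \<le> n \<and> length L = k \<and> dom D = shape L \<and> (\<forall>r<k. L ! r \<le> n - k) \<and>
     label k n (shape L) ` lines k n = {1..n} \<and>
     (\<forall>l\<in>lines k n. outgoing L D l \<in> lines k n \<and>
        f (label k n (shape L) l) = label k n (shape L) (outgoing L D l)) \<and>
     (\<forall>r<k. f (label k n (shape L) (Row r)) \<noteq> label k n (shape L) (Row r))"

lemma row_length_shape: "row_length (shape L) r = (if r < length L then L ! r else 0)"
proof -
  have "{c. (r, c) \<in> shape L} = (if r < length L then {..<L ! r} else {})" by (auto simp: shape_def)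
  then show ?thesis by (simp add: row_length_def)
qed

lemma col_height_shape: "col_height (shape L) c = card {r. r < length L \<and> c < L ! r}"
  by (simp add: col_height_def shape_def)

lemma col_height_full: "(\<And>r. r < length L \<Longrightarrow> c < L ! r) \<Longrightarrow> col_height (shape L) c = length L"
proof -
  assume "\<And>r. r < length L \<Longrightarrow> c < L ! r"
  then have "{r. r < length L \<and> c < L ! r} = {..<length L}" by auto
  then show ?thesis by (simp add: col_height_shape)
qed

lemma col_height_le: "col_height (shape L) c \<le> length L"
proof -
  have "card {r. r < length L \<and> c < L ! r} \<le> card {..<length L}" by (intro card_mono) auto
  then show ?thesis by (simp add: col_height_shape)
qed

lemma lines_iff: "Row r \<in> lines k n \<longleftrightarrow> r < k" "Column c \<in> lines k n \<longleftrightarrow> c < n - k"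
  by (auto simp: lines_def)

lemma finite_lines [simp]: "finite (lines k n)" by (simp add: lines_def)

lemma card_lines: "k \<le> n \<Longrightarrow> card (lines k n) = n"
proof -
  assume "k \<le> n"
  have "card (Row ` {0..<k} \<union> Column ` {0..<n - k}) = card (Row ` {0..<k}) + card (Column ` {0..<n - k})"
    by (intro card_Un_disjoint) auto
  then show ?thesis using \<open>k \<le> n\<close> by (simp add: lines_def card_image inj_on_def)
qed

lemma realizes_decorated_perm:
  assumes "realizes n k L D f" "f permutes {1..n}"
  shows "diagram_decorated_perm k n D = black_decorated n f"
proof -
  let ?lab = "label k n (shape L)"
  have a: "k \<le> n" "dom D = shape L" "?lab ` lines k n = {1..n}"
    "\<And>l. l \<in> lines k n \<Longrightarrow> f (?lab l) = ?lab (outgoing L D l)"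
    "\<And>r. r < k \<Longrightarrow> f (?lab (Row r)) \<noteq> ?lab (Row r)"
    using assms(1) by (auto simp: realizes_def)
  \<comment> \<open>There are \<open>n\<close> lines and the labels cover \<open>{1..n}\<close>, so
    no label is used twice and \<open>line_labelled\<close> is well defined.\<close>
  have inj: "inj_on ?lab (lines k n)"
    using a by (intro eq_card_imp_inj_on) (simp_all add: card_lines)
  have ll: "line_labelled k n (dom D) (?lab l) = l" if "l \<in> lines k n" for l
    unfolding line_labelled_def a(2) using inj that by (intro the_equality) (auto dest: inj_onD)
  have ex: "\<exists>l\<in>lines k n. i = ?lab l" if "i \<in> {1..n}" for i using a(3) that by blast
  have dp: "diagram_perm k n D = f"
  proof
    fix i
    show "diagram_perm k n D i = f i"
    proof (cases "i \<in> {1..n}")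
      case True
      then obtain l where l: "l \<in> lines k n" "i = ?lab l" using ex by blast
      then show ?thesis using ll[OF l(1)] a True by (simp only: diagram_perm_def if_True outgoing_def)
    next
      case False
      then show ?thesis using permutes_not_in[OF assms(2) False] by (simp only: diagram_perm_def if_False)
    qed
  qed
  have "(case line_labelled k n (dom D) i of Column c \<Rightarrow> Black | Row r \<Rightarrow> White) = Black"
    if "i \<in> {1..n}" "f i = i" for i
  proof -
    from ex[OF that(1)] obtain l where l: "l \<in> lines k n" "i = ?lab l" by blast
    then have "l \<noteq> Row r" for r using that(2) a(5)[of r] by (auto simp: lines_iff)
    then show ?thesis using ll[OF l(1)] l(2) by (cases l) auto
  qed
  then show ?thesis unfolding diagram_decorated_perm_def black_decorated_def dp by auto
qed

text \<open>Unlike \<open>west_move\<close> this covers \<open>k = 0\<close> too. No boxes exist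
  then, and \<open>c0 = n - 1\<close> is chosen only to give the new column the label 2.\<close>

locale west_pipes =
  fixes n k :: nat and L :: "nat list" and D :: diagram and f :: "nat \<Rightarrow> nat" and D' :: diagram and c0 s :: nat
  assumes r: "realizes n k L D f"
    and c0: "1 \<le> c0" "k = 0 \<Longrightarrow> c0 + 1 = n" "0 < k \<Longrightarrow> L ! (k - 1) = c0 + 1"
    and ge: "r < k \<Longrightarrow> c0 + 1 \<le> L ! r"
    and old: "D' (r, sh c0 c) = D (r, c)"
    and new: "D' (r, c0) = (if r < k then Some Zero else None)"
    and s: "s = n - (c0 + 1)"
begin

text \<open>An old edge with number \<open>c0\<close> could be placed on either border of the new
  column, which pipes cross straight; the left border is taken.\<close>

fun shift_edge :: "edge \<Rightarrow> edge" where
  "shift_edge (VEdge r c) = VEdge r (if c \<le> c0 then c else c + 1)"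
| "shift_edge (HEdge r c) = HEdge r (sh c0 c)"

fun shift_line :: "line \<Rightarrow> line" where
  "shift_line (Row r) = Row r"
| "shift_line (Column c) = Column (sh c0 c)"

lemma line_of_shift: "line_of (shift_edge e) = shift_line (line_of e)"
  by (cases e) auto

lemma not_plus: "D' (r, c0) \<noteq> Some Plus" by (simp add: new)

lemma pipe_straight: "pipe_end D' (HEdge r c0) = HEdge 0 c0"
  by (induction r) (simp_all add: not_plus)

lemma pipe_cross: "pipe_end D' (VEdge r (Suc c0)) = pipe_end D' (VEdge r c0)"
  by (simp add: not_plus)

lemma pipe_shift_aux:
  "(\<And>r c. D' (r, sh c0 c) = E (r, c)) \<Longrightarrow> pipe_end D' (shift_edge e) = shift_edge (pipe_end E e)"
proof (induction E e rule: pipe_end.induct)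
  case (2 E r c)
  note E = 2(3)[of r c]
  consider "Suc c \<le> c0" | "c = c0" | "c0 < c" by linarith
  then show ?case
  proof cases
    case 1
    then have "sh c0 c = c" by (simp add: sh_def)
    then show ?thesis using 2 E 1 by (auto simp: sh_def)
  next
    \<comment> \<open>If the pipe goes straight through this box, it has to cross the new column as
      well before it reaches the shifted edge.\<close>
    case eq: 2
    then have "sh c0 c = Suc c" by (simp add: sh_def)
    then show ?thesis using 2 E eq pipe_cross[of r] by (auto simp: sh_def)
  next
    case 3
    then have "sh c0 c = Suc c" by (simp add: sh_def)
    then show ?thesis using 2 E 3 by (auto simp: sh_def)
  qed
next
  case (4 E r c)
  have e: "pipe_end D' (VEdge r (sh c0 c)) = pipe_end D' (shift_edge (VEdge r c))"
    using pipe_cross[of r] by (cases "c = c0") (auto simp: sh_def)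
  show ?case using 4 e by simp
qed (auto simp: sh_def)

lemmas pipe_shift = pipe_shift_aux[of D, OF old]

abbreviation "L' \<equiv> map Suc L"
abbreviation "lab \<equiv> label k n (shape L)"
abbreviation "lab' \<equiv> label k (n + 1) (shape L')"

lemma facts: "k \<le> n" "length L = k" "dom D = shape L" "\<And>r. r < k \<Longrightarrow> L ! r \<le> n - k"
  "lab ` lines k n = {1..n}"
  "\<And>l. l \<in> lines k n \<Longrightarrow> outgoing L D l \<in> lines k n \<and> f (lab l) = lab (outgoing L D l)"
  "\<And>r. r < k \<Longrightarrow> f (lab (Row r)) \<noteq> lab (Row r)"
  using r by (auto simp: realizes_def)

lemma c0_less: "c0 < n - k"
proof (cases "k = 0")
  case False
  then show ?thesis using facts(4)[of "k - 1"] c0(3) by simp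
qed (use c0 in simp)

lemma in_shape': "(r, sh c0 c) \<in> shape L' \<longleftrightarrow> (r, c) \<in> shape L"
  using ge[of r] facts(2) by (auto simp: shape_def sh_def)

lemma dom': "dom D' = shape L'"
proof -
  have "(r, c) \<in> dom D' \<longleftrightarrow> (r, c) \<in> shape L'" for r c
  proof (cases "c = c0")
    case True
    then show ?thesis using new[of r] ge[of r] facts(2) by (cases "r < k") (auto simp: shape_def dom_def)
  next
    case False
    then have c: "c = sh c0 (unsh c0 c)" by (simp add: sh_unsh)
    have "(r, sh c0 (unsh c0 c)) \<in> dom D' \<longleftrightarrow> (r, unsh c0 c) \<in> dom D" using old by (simp add: dom_def)
    then show ?thesis using in_shape'[of r "unsh c0 c"] facts(3) c by simp
  qed
  then show ?thesis by auto
qed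

lemma col_height': "col_height (shape L') (sh c0 c) = col_height (shape L) c" "col_height (shape L') c0 = k"
proof -
  show "col_height (shape L') (sh c0 c) = col_height (shape L) c"
    using in_shape' by (simp add: col_height_def)
  show "col_height (shape L') c0 = k"
    using ge facts(2) by (subst col_height_full) (auto simp: Suc_le_eq less_Suc_eq)
qed

lemma col_height_left: "c \<le> c0 \<Longrightarrow> col_height (shape L) c = k"
  using ge facts(2) by (subst col_height_full) force+

lemma s_le: "s + 1 \<le> n" "k \<le> s" "s = k + (n - k) - (c0 + 1)"
  using c0_less s facts(1) by auto

lemma lab'_new: "lab' (Column c0) = s + 2"
  using c0_less s by (simp add: col_height'(2))

lemma lab'_old: "l \<in> lines k n \<Longrightarrow> lab' (shift_line l) = sh (s + 2) (lab l)"
proof (cases l)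
  case (Row x1)
  assume "l \<in> lines k n"
  then have x: "x1 < k" using Row by (simp add: lines_iff)
  then show ?thesis using Row ge[OF x] facts(1,2) facts(4)[OF x] s c0_less
    by (auto simp: row_length_shape sh_def)
next
  case (Column c)
  assume "l \<in> lines k n"
  then have c: "c < n - k" using Column by (simp add: lines_iff)
  show ?thesis
  proof (cases "c < c0")
    case True
    then show ?thesis using Column c s c0_less facts(1) col_height_left[of c] col_height'(1)[of c]
      by (auto simp: sh_def)
  next
    case False
    have "col_height (shape L) c \<le> k" using col_height_le[of L c] facts(2) by simp
    then show ?thesis using Column False c s c0_less facts(1) col_height'(1)[of c]
      by (auto simp: sh_def)
  qed
qed

lemma lines': "lines k (n + 1) = insert (Column c0) (shift_line ` lines k n)"
proof (intro subset_antisym subsetI)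
  fix l assume l: "l \<in> lines k (n + 1)"
  show "l \<in> insert (Column c0) (shift_line ` lines k n)"
  proof (cases l)
    case (Row x)
    then have "l = shift_line (Row x)" "Row x \<in> lines k n" using l by (auto simp: lines_iff)
    then show ?thesis by blast
  next
    case (Column c)
    show ?thesis
    proof (cases "c = c0")
      case False
      then have "l = shift_line (Column (unsh c0 c))" "Column (unsh c0 c) \<in> lines k n"
        using Column l c0_less by (auto simp: lines_iff sh_unsh) (auto simp: unsh_def)
      then show ?thesis by blast
    qed (use Column in simp)
  qed
next
  fix l assume "l \<in> insert (Column c0) (shift_line ` lines k n)"
  then show "l \<in> lines k (n + 1)" using c0_less by (auto simp: lines_def sh_def)
qed

lemma se_new: "southeast_edge (shape L') (Column c0) = HEdge k c0"
  by (simp add: col_height'(2))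

lemma se_old: "l \<in> lines k n \<Longrightarrow> southeast_edge (shape L') (shift_line l) = shift_edge (southeast_edge (shape L) l)"
proof (cases l)
  case (Row x)
  assume "l \<in> lines k n"
  then have "x < k" using Row by (simp add: lines_iff)
  then show ?thesis using Row ge[of x] facts(2) by (simp add: row_length_shape)
qed (simp add: col_height'(1))

lemma outgoing_old: "l \<in> lines k n \<Longrightarrow> outgoing L' D' (shift_line l) = shift_line (outgoing L D l)"
  by (simp add: outgoing_def se_old pipe_shift line_of_shift)

lemma outgoing_new: "outgoing L' D' (Column c0) = Column c0"
  by (simp only: outgoing_def se_new pipe_straight line_of.simps)

text \<open>The pipe of the new column runs straight to the top, so its label \<open>s + 2\<close>
  becomes a fixed point. The other pipes and labels are merely shifted.\<close>

lemma realizes_west: "realizes (n + 1) k L' D' (ins (s + 2) (s + 2) f)"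
proof -
  let ?g = "ins (s + 2) (s + 2) f"
  have im: "lab' ` lines k (n + 1) = {1..n + 1}"
  proof -
    have "lab' ` lines k (n + 1) = insert (s + 2) ((\<lambda>l. sh (s + 2) (lab l)) ` lines k n)"
      unfolding lines' using lab'_new lab'_old by (simp add: image_image)
    also have "(\<lambda>l. sh (s + 2) (lab l)) ` lines k n = sh (s + 2) ` {1..n}"
      using facts(5) by (metis image_image)
    also have "insert (s + 2) (sh (s + 2) ` {1..n}) = {1..n + 1}"
    proof (intro subset_antisym subsetI)
      fix x assume x: "x \<in> {1..n + 1}"
      show "x \<in> insert (s + 2) (sh (s + 2) ` {1..n})"
      proof (cases "x = s + 2")
        case False
        then have "x = sh (s + 2) (unsh (s + 2) x)" by (simp add: sh_unsh)
        moreover have "unsh (s + 2) x \<in> {1..n}" using False x s_le by (auto simp: unsh_def)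
        ultimately show ?thesis by blast
      qed simp
    qed (use s_le in \<open>auto simp: sh_def\<close>)
    finally show ?thesis .
  qed
  have "outgoing L' D' l \<in> lines k (n + 1) \<and> ?g (lab' l) = lab' (outgoing L' D' l)" if l: "l \<in> lines k (n + 1)" for l
  proof -
    consider "l = Column c0" | m where "m \<in> lines k n" "l = shift_line m" using l lines' by auto
    then show ?thesis
    proof cases
      case 1
      then show ?thesis using l unfolding 1 outgoing_new lab'_new by simp
    next
      case 2
      note o = conjunct1[OF facts(6)[OF 2(1)]]
      have "outgoing L' D' l = shift_line (outgoing L D m)" using outgoing_old 2 by simp
      moreover have "shift_line (outgoing L D m) \<in> lines k (n + 1)" using o lines' by blast
      moreover have "?g (lab' l) = sh (s + 2) (f (lab m))" using lab'_old 2 by (simp only: ins_sh)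
      moreover have "lab' (shift_line (outgoing L D m)) = sh (s + 2) (lab (outgoing L D m))" using lab'_old[OF o] .
      ultimately show ?thesis using facts(6)[OF 2(1)] by simp
    qed
  qed
  moreover have "?g (lab' (Row x)) \<noteq> lab' (Row x)" if "x < k" for x
  proof -
    have "lab' (Row x) = sh (s + 2) (lab (Row x))" using lab'_old[of "Row x"] that by (simp add: lines_iff)
    then show ?thesis using facts(7)[OF that] by (simp only: ins_sh sh_inject not_False_eq_True)
  qed
  moreover have "\<forall>x<k. L' ! x \<le> n + 1 - k" using facts(1,2,4) by (simp add: Suc_diff_le)
  ultimately show ?thesis using im dom' facts(1,2) unfolding realizes_def by simp
qed

end

text \<open>The new bottom row has \<open>m + 4\<close> boxes, and \<open>s\<close> is its label:
  \<open>k\<close> south steps and \<open>n - k - m - 4\<close> west steps precede it on the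
  border.\<close>

locale south_pipes =
  fixes n k :: nat and L :: "nat list" and D :: diagram and f :: "nat \<Rightarrow> nat" and D' :: diagram and m s :: nat
  assumes r: "realizes n k L D f"
    and m: "m + 4 \<le> n - k"
    and ge: "r < k \<Longrightarrow> m + 4 \<le> L ! r"
    and D': "D' (r, c) = (if r = k then if c \<in> {0, m + 1, m + 2, m + 3} then Some Plus
        else if c < m + 4 then Some Zero else None else D (r, c))"
    and s: "s = n - m - 3"
begin

abbreviation "L' \<equiv> L @ [m + 4]"
abbreviation "lab \<equiv> label k n (shape L)"
abbreviation "lab' \<equiv> label (k + 1) (n + 1) (shape L')"

lemma facts: "k \<le> n" "length L = k" "dom D = shape L" "\<And>r. r < k \<Longrightarrow> L ! r \<le> n - k"
  "lab ` lines k n = {1..n}"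
  "\<And>l. l \<in> lines k n \<Longrightarrow> outgoing L D l \<in> lines k n \<and> f (lab l) = lab (outgoing L D l)"
  "\<And>r. r < k \<Longrightarrow> f (lab (Row r)) \<noteq> lab (Row r)"
  using r by (auto simp: realizes_def)

lemma pipe_same_aux:
  "(\<And>r c. r < k \<Longrightarrow> D' (r, c) = E (r, c)) \<Longrightarrow>
   (case e of VEdge r c \<Rightarrow> r < k | HEdge r c \<Rightarrow> r \<le> k) \<Longrightarrow> pipe_end D' e = pipe_end E e"
  by (induction E e rule: pipe_end.induct) auto

lemma pipe_same: "r < k \<Longrightarrow> pipe_end D' (VEdge r c) = pipe_end D (VEdge r c)"
  "r \<le> k \<Longrightarrow> pipe_end D' (HEdge r c) = pipe_end D (HEdge r c)"
  by (rule pipe_same_aux; simp add: D')+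

lemma dom': "dom D' = shape L'"
proof -
  have "(r, c) \<in> dom D' \<longleftrightarrow> (r, c) \<in> shape L'" for r c
  proof -
    have "(r, c) \<in> dom D \<longleftrightarrow> (r, c) \<in> shape L" using facts(3) by simp
    then show ?thesis using facts(2) by (auto simp: D' shape_def nth_append dom_def)
  qed
  then show ?thesis by auto
qed

lemma row_length': "row_length (shape L') r = (if r = k then m + 4 else row_length (shape L) r)"
  using facts(2) by (auto simp: row_length_shape nth_append)

lemma col_height': "col_height (shape L') c = (if c < m + 4 then k + 1 else col_height (shape L) c)"
proof (cases "c < m + 4")
  case True
  then have "col_height (shape L') c = length L'"
    using ge facts(2) by (intro col_height_full) (auto simp: nth_append less_Suc_eq dest: less_le_trans)
  then show ?thesis using True facts(2) by simp
next
  case False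
  then have "{r. r < length L' \<and> c < L' ! r} = {r. r < length L \<and> c < L ! r}"
    by (auto simp: nth_append less_Suc_eq)
  then show ?thesis using False by (simp add: col_height_shape)
qed

lemma col_height_left: "c < m + 4 \<Longrightarrow> col_height (shape L) c = k"
  using ge facts(2) by (subst col_height_full) (auto dest: less_le_trans)

lemma col_height_right: "col_height (shape L) c \<le> k"
  using col_height_le[of L c] facts(2) by simp

lemma s_bounds: "1 \<le> s" "s + m + 3 = n"
  using s m facts(1) by auto

lemma lab'_new: "lab' (Row k) = s"
  using m s facts(1) by (simp add: row_length')

lemma lab_left: "c < m + 4 \<Longrightarrow> lab (Column c) = n - c"
  using m facts(1) by (simp add: col_height_left)

lemma lab'_old: "l \<in> lines k n \<Longrightarrow> lab' l = sh s (lab l)"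
proof (cases l)
  case (Row x)
  assume "l \<in> lines k n"
  then have x: "x < k" using Row by (simp add: lines_iff)
  then show ?thesis using Row ge[OF x] facts(1,2) facts(4)[OF x] s m
    by (auto simp: row_length_shape nth_append sh_def)
next
  case (Column c)
  assume "l \<in> lines k n"
  then have c: "c < n - k" using Column by (simp add: lines_iff)
  then show ?thesis using Column s m facts(1) col_height_left[of c] col_height'[of c] col_height_right[of c]
    by (auto simp: sh_def)
qed

lemma lines': "lines (k + 1) (n + 1) = insert (Row k) (lines k n)"
  using facts(1) by (auto simp: lines_def less_Suc_eq)

lemma lab_small: "r < k \<Longrightarrow> lab (Row r) < s" "c < n - k \<Longrightarrow> m + 4 \<le> c \<Longrightarrow> lab (Column c) < s"
  using ge[of r] facts(1,2) facts(4)[of r] s m col_height_right[of c] by (auto simp: row_length_shape)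

text \<open>Going left through the zeros, the pipe meets the plus in column 0 and turns up
  there.\<close>

lemma pipe_zeros: "c \<le> m + 1 \<Longrightarrow> pipe_end D' (VEdge k c) = (if c = 0 then VEdge k 0 else pipe_end D (HEdge k 0))"
proof (induction c)
  case (Suc c)
  show ?case
  proof (cases "c = 0")
    case True
    then show ?thesis using pipe_same(2)[of k 0] by (simp add: D')
  next
    case False
    then show ?thesis using Suc by (simp add: D')
  qed
qed simp

lemma outgoing_row: "outgoing L' D' (Row k) = outgoing L D (Column (m + 3))"
proof -
  have 1: "row_length (shape L') k = Suc (m + 3)" by (simp add: row_length')
  have 2: "pipe_end D' (VEdge k (Suc (m + 3))) = pipe_end D (HEdge k (m + 3))"
    unfolding pipe_end.simps(2) by (simp add: D' pipe_same(2))
  have 3: "col_height (shape L) (m + 3) = k" by (rule col_height_left) simp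
  show ?thesis by (simp only: outgoing_def southeast_edge.simps 1 2 3)
qed

text \<open>A pipe that enters the new row from below at a plus turns left and goes up at the next
  plus to the left; from the leftmost plus it reaches the left border. Columns with a zero are
  passed straight, and above the new row everything happens in the old diagram.\<close>

lemma outgoing_old:
  assumes "l \<in> lines k n"
  shows "outgoing L' D' l = (case l of Row r \<Rightarrow> outgoing L D l
     | Column c \<Rightarrow> if c = 0 then Row k else if c = m + 1 then outgoing L D (Column 0)
         else if c \<in> {m + 2, m + 3} then outgoing L D (Column (c - 1)) else outgoing L D l)"
proof (cases l)
  case (Row x)
  then have x: "x < k" using assms by (simp add: lines_iff)
  then show ?thesis using Row facts(2) by (simp add: outgoing_def row_length' pipe_same)
next
  case (Column c)
  consider "c = 0" | "c = m + 1" | "c = m + 2" | "c = m + 3" | "m + 4 \<le> c" | "1 \<le> c" "c \<le> m" by linarith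
  then show ?thesis
  proof cases
    case 1
    then show ?thesis using Column by (simp add: outgoing_def col_height' D')
  next
    case 2
    have "pipe_end D' (VEdge k (m + 1)) = pipe_end D (HEdge k 0)" using pipe_zeros[of "m + 1"] by simp
    then show ?thesis using Column 2 by (simp add: outgoing_def col_height' col_height_left D')
  next
    case 3
    have "pipe_end D' (VEdge k (m + 2)) = pipe_end D (HEdge k (m + 1))"
      using pipe_same(2)[of k "m + 1"] by (simp add: D' numeral_2_eq_2)
    then show ?thesis using Column 3 by (simp add: outgoing_def col_height' col_height_left D')
  next
    case 4
    have "pipe_end D' (VEdge k (m + 3)) = pipe_end D (HEdge k (m + 2))"
      using pipe_same(2)[of k "m + 2"] by (simp add: D' numeral_3_eq_3 numeral_2_eq_2)
    then show ?thesis using Column 4 by (simp add: outgoing_def col_height' col_height_left D')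
  next
    case 5
    then show ?thesis using Column pipe_same(2)[OF col_height_right[of c]] by (simp add: outgoing_def col_height')
  next
    case 6
    then show ?thesis using Column by (simp add: outgoing_def col_height' col_height_left D' pipe_same)
  qed
qed

lemma realizes_south: "realizes (n + 1) (k + 1) L' D' (ins s s f \<circ> cycle5 s (n + 1))"
proof -
  let ?g = "ins s s f \<circ> cycle5 s (n + 1)"
  have im: "lab' ` lines (k + 1) (n + 1) = {1..n + 1}"
  proof -
    have "lab' ` lines (k + 1) (n + 1) = insert s ((\<lambda>l. sh s (lab l)) ` lines k n)"
      unfolding lines' using lab'_new lab'_old by simp
    also have "(\<lambda>l. sh s (lab l)) ` lines k n = sh s ` {1..n}"
      using facts(5) by (metis image_image)
    also have "insert s (sh s ` {1..n}) = {1..n + 1}"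
    proof (intro subset_antisym subsetI)
      fix x assume x: "x \<in> {1..n + 1}"
      show "x \<in> insert s (sh s ` {1..n})"
      proof (cases "x = s")
        case False
        then have "x = sh s (unsh s x)" by (simp add: sh_unsh)
        moreover have "unsh s x \<in> {1..n}" using False x s_bounds by (auto simp: unsh_def)
        ultimately show ?thesis by blast
      qed simp
    qed (use s_bounds in \<open>auto simp: sh_def\<close>)
    finally show ?thesis .
  qed
  have col: "Column c \<in> lines k n" if "c < m + 4" for c using that m by (simp add: lines_iff)
  have fcol: "f (n - c) = lab (outgoing L D (Column c)) \<and> outgoing L D (Column c) \<in> lines k n" if "c < m + 4" for c
    using facts(6)[OF col[OF that]] lab_left[OF that] by simp
  \<comment> \<open>For pipes that continue upwards in column \<open>c\<close> of the old diagram,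
    whose label there is \<open>n - c\<close>.\<close>
  have key: "outgoing L' D' l \<in> lines (k + 1) (n + 1) \<and> ?g (lab' l) = lab' (outgoing L' D' l)"
    if "outgoing L' D' l = outgoing L D (Column c)" "c < m + 4" "cycle5 s (n + 1) (lab' l) = sh s (n - c)" for l c
    using that fcol[OF that(2)] lab'_old[of "outgoing L D (Column c)"] lines' by simp
  have same: "outgoing L' D' l \<in> lines (k + 1) (n + 1) \<and> ?g (lab' l) = lab' (outgoing L' D' l)"
    if "l \<in> lines k n" "outgoing L' D' l = outgoing L D l" "cycle5 s (n + 1) (lab' l) = lab' l" for l
    using that facts(6)[OF that(1)] lab'_old lines' by simp
  have main: "outgoing L' D' l \<in> lines (k + 1) (n + 1) \<and> ?g (lab' l) = lab' (outgoing L' D' l)"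
    if l: "l \<in> lines (k + 1) (n + 1)" for l
  proof (cases "l = Row k")
    case True
    have "cycle5 s (n + 1) (lab' l) = sh s (n - (m + 3))"
      unfolding True lab'_new using s_bounds by (auto simp: cycle5_def sh_def)
    then show ?thesis using key[of l "m + 3"] outgoing_row True by simp
  next
    case False
    then have lo: "l \<in> lines k n" using l lines' by simp
    note o = outgoing_old[OF lo]
    show ?thesis
    proof (cases l)
      case (Row x)
      then have "lab' l < s" using lab_small(1)[of x] lo lab'_old[OF lo] by (simp add: lines_iff sh_def)
      then have "cycle5 s (n + 1) (lab' l) = lab' l" using s_bounds by (intro cycle5_below) auto
      then show ?thesis using same[OF lo] o Row by simp
    next
      case (Column c)
      have c: "c < n - k" using lo Column by (simp add: lines_iff)
      have lb: "lab' l = sh s (n - c)" if "c < m + 4"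
        unfolding lab'_old[OF lo] unfolding Column by (subst lab_left) (use that in simp_all)
      consider "c = 0" | "c = m + 1" | "c = m + 2" | "c = m + 3" | "m + 4 \<le> c" | "1 \<le> c" "c \<le> m" by linarith
      then show ?thesis
      proof cases
        case 1
        then have "lab' l = n + 1" using lb s_bounds by (auto simp: sh_def)
        moreover have "cycle5 s (n + 1) (n + 1) = s" using s_bounds(2) by (intro cycle5_last) linarith
        ultimately have "?g (lab' l) = s" by (simp only: comp_apply ins_self)
        moreover have "outgoing L' D' l = Row k" using o Column 1 by simp
        ultimately show ?thesis using lab'_new lines' by simp
      next
        case 2
        then have "lab' l = s + 3" using lb s_bounds by (auto simp: sh_def)
        then have "cycle5 s (n + 1) (lab' l) = sh s (n - 0)" using s_bounds by (auto simp: cycle5_def sh_def)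
        then show ?thesis using key[of l 0] o Column 2 by simp
      next
        case 3
        then have "lab' l = s + 2" using lb s_bounds by (auto simp: sh_def)
        then have "cycle5 s (n + 1) (lab' l) = sh s (n - (m + 1))" using s_bounds by (auto simp: cycle5_def sh_def)
        then show ?thesis using key[of l "m + 1"] o Column 3 by simp
      next
        case 4
        then have "lab' l = s + 1" using lb s_bounds by (auto simp: sh_def)
        then have "cycle5 s (n + 1) (lab' l) = sh s (n - (m + 2))" using s_bounds by (auto simp: cycle5_def sh_def)
        then show ?thesis using key[of l "m + 2"] o Column 4 by simp
      next
        case 5
        then have "lab' l < s" using lab_small(2)[of c] c lab'_old[OF lo] Column by (simp add: sh_def)
        then have "cycle5 s (n + 1) (lab' l) = lab' l" using s_bounds by (intro cycle5_below) auto
        then show ?thesis using same[OF lo] o Column 5 by simp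
      next
        case 6
        then have "lab' l = n - c + 1" using lb s_bounds by (auto simp: sh_def)
        then have "cycle5 s (n + 1) (lab' l) = lab' l" using 6 s_bounds by (intro cycle5_above) linarith+
        then show ?thesis using same[OF lo] o Column 6 by simp
      qed
    qed
  qed
  have rows: "?g (lab' (Row x)) \<noteq> lab' (Row x)" if "x < k + 1" for x
  proof (cases "x = k")
    case True
    \<comment> \<open>The pipe of the new row ends on an old line, and shifted labels avoid
      \<open>s\<close>.\<close>
    have "cycle5 s (n + 1) s = s + 1" by (simp add: cycle5_def)
    then have "?g s = sh s (f s)" by (simp add: ins_def unsh_def)
    then show ?thesis unfolding True lab'_new by simp
  next
    case False
    then have x: "x < k" using that by simp
    have e: "lab' (Row x) = sh s (lab (Row x))" using lab'_old[of "Row x"] x by (simp add: lines_iff)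
    then have "lab' (Row x) < s" using lab_small(1)[OF x] by (simp add: sh_def)
    then have "cycle5 s (n + 1) (lab' (Row x)) = lab' (Row x)" using s_bounds by (intro cycle5_below) auto
    then have "?g (lab' (Row x)) = sh s (f (lab (Row x)))" using e by simp
    then show ?thesis using facts(7)[OF x] e by simp
  qed
  have "\<forall>x<k + 1. L' ! x \<le> n + 1 - (k + 1)" using facts(2,4) m by (auto simp: nth_append less_Suc_eq)
  then show ?thesis unfolding realizes_def
    using im dom' facts(1,2) main rows by (intro conjI) auto
qed

end

text \<open>The steps behind the last south step are all west, and their number is the length of the
  last row. This translates the place of a blow-up into a column of the diagram.\<close>

lemma last_south_path_rows:
  "last_south q + (if South \<in> set q then last (path_rows q) else length q) = length q"
proof (induction q rule: rev_induct)
  case (snoc x q)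
  show ?case
  proof (cases x)
    case West
    then show ?thesis using snoc length_path_rows[of q] last_south_notin[of q] 
      by (cases "South \<in> set q") (auto simp: last_map count_list_0_iff simp flip: length_0_conv)
  next
    case South
    then show ?thesis using last_south_append_south[of q 0] path_rows_append_south[of q 0] by simp
  qed
qed simp

definition heights :: "nat \<Rightarrow> nat \<Rightarrow> step list \<Rightarrow> nat list" where
  "heights n k p = map (col_height (shape (path_rows p))) [0..<n - k - 4]"

lemma fold_place_zeros_0: "\<forall>i\<in>set hs. i = 0 \<Longrightarrow> fold (place_zeros Y) hs F = F"
  by (induction hs) auto

lemma filling_empty: "(\<And>i. i \<in> set hs \<Longrightarrow> i = 0) \<Longrightarrow> filling (shape []) hs = (\<lambda>_. None)"
proof -
  assume h: "\<And>i. i \<in> set hs \<Longrightarrow> i = 0"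
  have "fold (place_zeros (shape [])) hs F = F" for F
    using fold_place_zeros_0 h by blast
  then show ?thesis by (auto simp: filling_def fill_ends_def fill_rest_def place_pluses_def shape_def)
qed

lemma placeable_zeros: "(\<And>i. i \<in> set hs \<Longrightarrow> i = 0) \<Longrightarrow> placeable Y hs F"
  by (induction hs arbitrary: F) auto

lemma path_state_realizes:
  "path_state n k p q f \<Longrightarrow>
     placeable (shape (map (\<lambda>x. x + 4) (path_rows q))) (heights n k p) (fill_ends (shape (map (\<lambda>x. x + 4) (path_rows q)))) \<and>
     realizes n k (map (\<lambda>x. x + 4) (path_rows q))
       (filling (shape (map (\<lambda>x. x + 4) (path_rows q))) (heights n k p)) (back2 n f)"
proof (induction rule: path_state.induct)
  case base
  have e: "back2 4 perm0 x = x" for x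
    by (cases "x \<in> {1, 2, 3, 4}") (auto simp: back2_def cyc_def perm0_def)
  have l: "lines 0 4 = {Column 0, Column 1, Column 2, Column 3}" by (auto simp: lines_def)
  have h: "col_height (shape []) c = 0" for c by (simp add: col_height_shape)
  have J: "{1..4} = {1, 2, 3, 4 :: nat}" by auto
  have "heights 4 0 [] = []" by (simp add: heights_def)
  moreover have "filling (shape []) [] = (\<lambda>_. None)" by (rule filling_empty) simp
  moreover have "realizes 4 0 [] (\<lambda>_. None) (back2 4 perm0)"
  proof -
    have o: "outgoing [] (\<lambda>_. None) (Column c) = Column c" for c by (simp add: outgoing_def h)
    have lb: "label 0 4 (shape []) (Column c) = 4 - 1 - c + 1" for c by (simp add: h)
    have im: "label 0 4 (shape []) ` lines 0 4 = {1..4}" unfolding l J by (simp add: lb h insert_commute numeral_eq_Suc)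
    have "dom (\<lambda>_. None) = shape []" by (auto simp: shape_def)
    moreover have "\<forall>l\<in>lines 0 4. outgoing [] (\<lambda>_. None) l \<in> lines 0 4 \<and>
        back2 4 perm0 (label 0 4 (shape []) l) = label 0 4 (shape []) (outgoing [] (\<lambda>_. None) l)"
      unfolding l e by (simp only: ball_simps o) simp
    ultimately show ?thesis using im by (simp only: realizes_def) simp
  qed
  ultimately show ?case by simp
next
  case (west n k p q f)
  let ?L = "map (\<lambda>x. x + 4) (path_rows q)"
  have pq: "(p, q) \<in> path_pairs n k" "k + 4 \<le> n" using path_state_path_pairs[OF west(1)] by auto
  then have cnt: "count_list q South = k" "count_list p South = k" "count_list q West = n - k - 4"
    by (auto simp: path_pairs_def lattice_paths_def)
  have nq: "n = length q + 4" using path_state_length[OF west(1)] by simp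
  \<comment> \<open>The column of the last box in the old bottom row. The new column takes its
    position and pushes that box to the right.\<close>
  define c0 where "c0 = (if k = 0 then n - 1 else ?L ! (k - 1) - 1)"
  have len: "length ?L = k" using cnt by simp
  have c01: "1 \<le> c0" "k = 0 \<Longrightarrow> c0 + 1 = n" "0 < k \<Longrightarrow> ?L ! (k - 1) = c0 + 1"
    using pq(2) len by (auto simp: c0_def)
  have ge: "c0 + 1 \<le> ?L ! r" if "r < k" for r
  proof -
    have "path_rows q ! (k - 1) \<le> path_rows q ! r"
      using sorted_wrt_nth_less[OF sorted_path_rows[of q], of r "k - 1"] that cnt by (cases "r = k - 1") auto
    then show ?thesis using that c01(3) cnt by simp
  qed
  have s: "last_south q = n - (c0 + 1)"
  proof (cases "k = 0")
    case True
    then have "South \<notin> set q" using cnt count_list_0_iff[of q South] by simp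
    then show ?thesis using True c01(2) by (simp add: last_south_notin)
  next
    case False
    then have S: "South \<in> set q" using cnt count_list_0_iff[of q South] by auto
    have "last (path_rows q) = path_rows q ! (k - 1)" using False cnt by (metis last_conv_nth length_0_conv length_path_rows)
    then show ?thesis using last_south_path_rows[of q] S False c01(3) cnt nq by simp
  qed
  have rows': "map (\<lambda>x. x + 4) (path_rows (q @ [West])) = map Suc ?L" by simp
  \<comment> \<open>Lengthening every row of the upper diagram amounts to a new full column at its
    left, which is the first one to be read.\<close>
  have hs': "heights (n + 1) k (p @ [West]) = k # heights n k p"
  proof -
    have "[0..<n + 1 - k - 4] = 0 # map Suc [0..<n - k - 4]"
      using pq(2) by (metis Suc_diff_le add_diff_add add.commute diff_diff_left map_Suc_upt plus_1_eq_Suc upt_conv_Cons zero_less_Suc)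
    moreover have "col_height (shape (map Suc (path_rows p))) 0 = k"
      using cnt by (subst col_height_full) auto
    moreover have "col_height (shape (map Suc (path_rows p))) (Suc c) = col_height (shape (path_rows p)) c" for c
    proof -
      have "{r. r < length (path_rows p) \<and> Suc c < map Suc (path_rows p) ! r} = {r. r < length (path_rows p) \<and> c < path_rows p ! r}" by auto
      then show ?thesis by (simp add: col_height_shape)
    qed
    ultimately show ?thesis by (simp add: heights_def)
  qed
  have D': "placeable (shape (map Suc ?L)) (k # heights n k p) (fill_ends (shape (map Suc ?L))) \<and>
     (\<forall>r c. filling (shape (map Suc ?L)) (k # heights n k p) (r, sh c0 c) = filling (shape ?L) (heights n k p) (r, c)) \<and>
     (\<forall>r. filling (shape (map Suc ?L)) (k # heights n k p) (r, c0) = (if r < k then Some Zero else None))"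
  proof (cases "k = 0")
    case True
    then have e: "path_rows q = []" "path_rows p = []" using cnt by (metis length_0_conv length_path_rows)+
    have h: "i = 0" if "i \<in> set (k # heights n k p)" for i
      using that True by (auto simp: heights_def e col_height_shape)
    have "filling (shape []) (k # heights n k p) = (\<lambda>_. None)" by (rule filling_empty[OF h])
    moreover have "filling (shape []) (heights n k p) = (\<lambda>_. None)" by (rule filling_empty) (use h in simp)
    ultimately show ?thesis using placeable_zeros[OF h] True by (simp add: e)
  next
    case False
    interpret west_move ?L k c0
      by unfold_locales (use len False c01 ge in auto)
    note w = filling_west[OF conjunct1[OF west(2)]]
    show ?thesis using w by (simp add: zero_column_def)
  qed
  interpret west_pipes n k ?L "filling (shape ?L) (heights n k p)" "back2 n f"
    "filling (shape (map Suc ?L)) (k # heights n k p)" c0 "last_south q"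
    by unfold_locales (use west(2) c01 ge s D' in auto)
  show ?case unfolding hs' rows' back2_west[OF west(1)] using D' realizes_west by blast
next
  case (south n k p q m f)
  let ?L = "map (\<lambda>x. x + 4) (path_rows (q @ replicate m West))"
  have pq: "(p, q @ replicate m West) \<in> path_pairs n k" "k + 4 \<le> n" using path_state_path_pairs[OF south(1)] by auto
  then have cnt: "count_list q South = k" "count_list q West + m = n - k - 4"
    by (auto simp: path_pairs_def lattice_paths_def count_list_replicate)
  have nq: "n = length q + m + 4" using path_state_length[OF south(1)] by simp
  have len: "length ?L = k" using cnt by (simp add: count_list_replicate)
  have rows': "map (\<lambda>x. x + 4) (path_rows (q @ South # replicate m West)) = ?L @ [m + 4]"
    by (simp add: path_rows_append_south)
  \<comment> \<open>A final south step of the upper path adds an empty row, so no column height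
    changes.\<close>
  have hs': "heights (n + 1) (k + 1) (p @ [South]) = heights n k p"
  proof -
    have "path_rows (p @ [South]) = path_rows p @ [0]" using path_rows_append_south[of p 0] by simp
    moreover have "{r. r < length (path_rows p @ [0]) \<and> c < (path_rows p @ [0]) ! r} = {r. r < length (path_rows p) \<and> c < path_rows p ! r}" for c
      by (auto simp: nth_append less_Suc_eq)
    ultimately show ?thesis by (simp add: heights_def col_height_shape)
  qed
  interpret M: south_move ?L k m by unfold_locales (rule len)
  note w = M.filling_south[OF conjunct1[OF south(2)]]
  interpret south_pipes n k ?L "filling (shape ?L) (heights n k p)" "back2 n f"
    "filling (shape (?L @ [m + 4])) (heights n k p)" m "length q + 1"
  proof
    show "realizes n k ?L (filling (shape ?L) (heights n k p)) (back2 n f)" using south(2) by blast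
    show "m + 4 \<le> n - k" using cnt pq(2) by simp
    show "m + 4 \<le> ?L ! r" if "r < k" for r
    proof -
      have "path_rows (q @ replicate m West) ! r \<in> set (path_rows (q @ replicate m West))" using that len by (intro nth_mem) simp
      then have "m \<le> path_rows (q @ replicate m West) ! r" by (rule path_rows_ge)
      then show ?thesis using that len by simp
    qed
    show "length q + 1 = n - m - 3" using nq by simp
  qed (use w(1) in \<open>simp add: M.new_row_def\<close>)
  show ?case unfolding hs' rows' back2_south[OF south(1)] using w(2) realizes_south by blast
qed

lemma Omega_eq_filling:
  assumes "path_state n k p q f"
  shows "Omega_LD n k (p, q) = filling (shape (map (\<lambda>x. x + 4) (path_rows q))) (heights n k p)"
proof -
  have "count_list q South = k" using path_state_path_pairs[OF assms] by (auto simp: path_pairs_def lattice_paths_def)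
  then have "add_four_columns k (young_of_path q) = shape (map (\<lambda>x. x + 4) (path_rows q))"
    unfolding young_eq_shape by (intro add_four_shape) simp
  then show ?thesis by (simp add: Omega_LD_def filling_def heights_def young_eq_shape Let_def)
qed

lemma Omega_decorated_perm:
  assumes "path_state n k p q f"
  shows "diagram_decorated_perm k n (Omega_LD n k (p, q)) = black_decorated n (back2 n f)"
proof -
  have "2 \<le> n" using path_state_length[OF assms] by simp
  then have "back2 n f permutes {1..n}" using back2_permutes path_state_permutes[OF assms] by blast
  then show ?thesis
    using path_state_realizes[OF assms] realizes_decorated_perm unfolding Omega_eq_filling[OF assms] by blast
qed

section \<open>Adding one column to another\<close>

text \<open>Columns are treated as functions on all row indices, zero from row \<open>k\<close> on,
  so that spans do not refer to a dimension.\<close>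

definition fscale :: "real \<Rightarrow> (nat \<Rightarrow> real) \<Rightarrow> nat \<Rightarrow> real" where
  "fscale x v = (\<lambda>r. x * v r)"

lemma fscale_apply: "fscale x v r = x * v r"
  by (simp add: fscale_def)

interpretation fv: vector_space fscale
  by unfold_locales (auto simp: fscale_def fun_eq_iff algebra_simps)

text \<open>The columns met on the way from \<open>l\<close> to \<open>m\<close> around the circle,
  without \<open>l\<close> itself unless a full turn is made.\<close>

definition arc :: "nat \<Rightarrow> nat \<Rightarrow> nat \<Rightarrow> nat set" where
  "arc n l m = residue n ` {l<..m}"

definition first_ret :: "nat \<Rightarrow> (nat \<Rightarrow> nat \<Rightarrow> real) \<Rightarrow> nat \<Rightarrow> nat" where
  "first_ret n a l = (LEAST m. l \<le> m \<and> a l \<in> fv.span (a ` arc n l m))"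

lemma residue_le: "1 \<le> t \<Longrightarrow> t \<le> n \<Longrightarrow> residue n t = t"
  by (simp add: residue_def)

lemma residue_wrap: "n < t \<Longrightarrow> t \<le> 2 * n \<Longrightarrow> residue n t = t - n"
proof -
  assume "n < t" "t \<le> 2 * n"
  then have "(t - 1) mod n = t - 1 - n" by (simp add: mod_if le_mod_geq)
  then show ?thesis using \<open>n < t\<close> by (simp add: residue_def)
qed

lemma residue_range: "0 < n \<Longrightarrow> residue n t \<in> {1..n}"
  by (auto simp: residue_def Suc_leI)

lemma arc_iff:
  assumes "1 \<le> l" "l \<le> n" "m \<le> l + n"
  shows "y \<in> arc n l m \<longleftrightarrow> 1 \<le> y \<and> y \<le> n \<and> (l < y \<and> y \<le> m \<or> l < y + n \<and> y + n \<le> m)"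
proof
  assume "y \<in> arc n l m"
  then obtain t where t: "y = residue n t" "l < t" "t \<le> m" by (auto simp: arc_def)
  show "1 \<le> y \<and> y \<le> n \<and> (l < y \<and> y \<le> m \<or> l < y + n \<and> y + n \<le> m)"
  proof (cases "t \<le> n")
    case True
    then show ?thesis using t residue_le[of t n] by auto
  next
    case False
    then have "y = t - n" using t residue_wrap[of n t] assms by simp
    then show ?thesis using t False assms by auto
  qed
next
  assume y: "1 \<le> y \<and> y \<le> n \<and> (l < y \<and> y \<le> m \<or> l < y + n \<and> y + n \<le> m)"
  then consider "l < y" "y \<le> m" | "l < y + n" "y + n \<le> m" by blast
  then show "y \<in> arc n l m"
  proof cases
    case 1
    then show ?thesis using y residue_le[of y n] unfolding arc_def by force
  next
    case 2
    then have "residue n (y + n) = y" using y residue_wrap[of n "y + n"] by simp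
    then show ?thesis using 2 unfolding arc_def by force
  qed
qed

lemma arc_mono: "m \<le> m' \<Longrightarrow> arc n l m \<subseteq> arc n l m'"
  by (auto simp: arc_def)

lemma self_in_arc: "1 \<le> l \<Longrightarrow> l \<le> n \<Longrightarrow> l \<in> arc n l (l + n)"
  by (simp add: arc_iff)

lemma first_ret_props:
  assumes "1 \<le> l" "l \<le> n"
  shows "l \<le> first_ret n a l" "first_ret n a l \<le> l + n" "a l \<in> fv.span (a ` arc n l (first_ret n a l))"
proof -
  have p: "l \<le> l + n \<and> a l \<in> fv.span (a ` arc n l (l + n))"
    using self_in_arc[OF assms] by (auto intro: fv.span_base)
  show "l \<le> first_ret n a l" "a l \<in> fv.span (a ` arc n l (first_ret n a l))"
    using LeastI[of "\<lambda>m. l \<le> m \<and> a l \<in> fv.span (a ` arc n l m)", OF p] by (auto simp: first_ret_def)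
  show "first_ret n a l \<le> l + n"
    using Least_le[of "\<lambda>m. l \<le> m \<and> a l \<in> fv.span (a ` arc n l m)", OF p] by (simp add: first_ret_def)
qed

lemma in_span_iff:
  assumes "1 \<le> l" "l \<le> n" "l \<le> m"
  shows "a l \<in> fv.span (a ` arc n l m) \<longleftrightarrow> first_ret n a l \<le> m"
proof
  assume "a l \<in> fv.span (a ` arc n l m)"
  then show "first_ret n a l \<le> m" unfolding first_ret_def using assms(3) by (intro Least_le) simp
next
  assume "first_ret n a l \<le> m"
  then have "a ` arc n l (first_ret n a l) \<subseteq> a ` arc n l m" using arc_mono by blast
  then show "a l \<in> fv.span (a ` arc n l m)"
    using first_ret_props(3)[OF assms(1,2)] fv.span_mono by blast
qed

lemma first_ret_eqI:
  assumes "l \<le> q" "a l \<in> fv.span (a ` arc n l q)" "\<And>m. l \<le> m \<Longrightarrow> m < q \<Longrightarrow> a l \<notin> fv.span (a ` arc n l m)"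
  shows "first_ret n a l = q"
  unfolding first_ret_def
proof (rule Least_equality)
  show "l \<le> q \<and> a l \<in> fv.span (a ` arc n l q)" using assms by simp
  show "q \<le> m" if "l \<le> m \<and> a l \<in> fv.span (a ` arc n l m)" for m
    using assms(3)[of m] that by (meson not_le)
qed

lemma first_ret_cong:
  assumes "1 \<le> l" "l \<le> n" "\<And>m. l \<le> m \<Longrightarrow> m \<le> l + n \<Longrightarrow> a l \<in> fv.span (a ` arc n l m) \<longleftrightarrow> b l \<in> fv.span (b ` arc n l m)"
  shows "first_ret n a l = first_ret n b l"
proof (rule first_ret_eqI)
  note p = first_ret_props[OF assms(1,2), of b]
  show "l \<le> first_ret n b l" by (rule p)
  show "a l \<in> fv.span (a ` arc n l (first_ret n b l))" using assms(3)[OF p(1,2)] p(3) by simp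
  show "a l \<notin> fv.span (a ` arc n l m)" if "l \<le> m" "m < first_ret n b l" for m
    using assms(3)[of m] that p(2) in_span_iff[OF assms(1,2) that(1), of b] by simp
qed

(* Adding a multiple of column i to column j exchanges the first returns of i and j, provided that
   the columns strictly between them are zero or independent of all the others. *)
locale bridge =
  fixes n i j :: nat and a :: "nat \<Rightarrow> nat \<Rightarrow> real" and t :: real
  assumes ij: "1 \<le> i" "i < j" "j \<le> n" and t: "t \<noteq> 0"
    and between: "i < l \<Longrightarrow> l < j \<Longrightarrow> a l = 0 \<or> a l \<notin> fv.span (a ` ({1..n} - {l}))"
    and ret: "j \<le> first_ret n a j" "first_ret n a j < first_ret n a i"
begin

definition "b = a(j := a j + fscale t (a i))"
abbreviation "p \<equiv> first_ret n a j"
abbreviation "q \<equiv> first_ret n a i"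

lemma b_simps: "b j = a j + fscale t (a i)" "l \<noteq> j \<Longrightarrow> b l = a l" "b i = a i"
  using ij by (auto simp: b_def)

lemma q_le: "q \<le> i + n" using first_ret_props(2)[of i n a] ij by simp

lemma image_same: "j \<notin> S \<Longrightarrow> b ` S = a ` S"
  using b_simps(2) by (metis image_cong)

lemma span_same: "i \<in> S \<Longrightarrow> j \<in> S \<Longrightarrow> fv.span (b ` S) = fv.span (a ` S)"
proof -
  assume S: "i \<in> S" "j \<in> S"
  have 1: "b l \<in> fv.span (a ` S)" if "l \<in> S" for l
  proof (cases "l = j")
    case True
    have "a j \<in> fv.span (a ` S)" "a i \<in> fv.span (a ` S)" using S by (simp_all add: fv.span_base)
    then have "a j + fscale t (a i) \<in> fv.span (a ` S)" by (intro fv.span_add fv.span_scale)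
    then show ?thesis using True b_simps(1) by simp
  next
    case False
    then show ?thesis using that b_simps(2)[of l] by (simp add: fv.span_base)
  qed
  have 2: "a l \<in> fv.span (b ` S)" if "l \<in> S" for l
  proof (cases "l = j")
    case True
    have "b j - fscale t (b i) \<in> fv.span (b ` S)"
    proof -
      have "b j \<in> fv.span (b ` S)" "b i \<in> fv.span (b ` S)" using S by (simp_all add: fv.span_base)
      then show ?thesis by (intro fv.span_diff fv.span_scale)
    qed
    moreover have "b j - fscale t (b i) = a j" by (simp add: b_simps)
    ultimately show ?thesis using True by simp
  next
    case False
    then have "a l = b l" by (simp add: b_simps)
    then show ?thesis using that by (auto intro: fv.span_base)
  qed
  show ?thesis unfolding fv.span_eq using 1 2 by blast
qed

lemma eliminate:
  assumes "finite B" "B \<subseteq> {i<..<j}" "T \<inter> {i<..<j} = {}" "T \<subseteq> {1..n}" "w \<in> {1..n}" "w \<notin> {i<..<j}"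
    and "a w \<in> fv.span (a ` (T \<union> B))"
  shows "a w \<in> fv.span (a ` T)"
  using assms(1,2,7)
proof (induction B rule: finite_induct)
  case (insert l B)
  have l: "i < l" "l < j" using insert by auto
  have "a w \<in> fv.span (insert (a l) (a ` (T \<union> B)))" using insert.prems by simp
  then obtain x where x: "a w - fscale x (a l) \<in> fv.span (a ` (T \<union> B))" by (auto simp: fv.span_breakdown_eq)
  have "a w \<in> fv.span (a ` (T \<union> B))"
  proof (cases "a l = 0 \<or> x = 0")
    case True
    then have z: "fscale x (a l) = 0" by (auto simp: fun_eq_iff fscale_apply)
    then show ?thesis using x unfolding z by simp
  next
    case False
    let ?R = "{1..n} - {l}"
    have "l \<in> {i<..<j}" "B \<subseteq> {i<..<j}" "l \<notin> B" using insert by auto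
    moreover have "{i<..<j} \<subseteq> {1..n}" using ij by auto
    ultimately have "T \<union> B \<subseteq> ?R" using assms(3,4) by blast
    then have sub: "a ` (T \<union> B) \<subseteq> a ` ?R" by blast
    have "w \<in> ?R" using assms(5,6) l by auto
    then have "a w \<in> fv.span (a ` ?R)" by (intro fv.span_base) blast
    moreover have "a w - fscale x (a l) \<in> fv.span (a ` ?R)" using x fv.span_mono[OF sub] by blast
    ultimately have "a w - (a w - fscale x (a l)) \<in> fv.span (a ` ?R)" by (rule fv.span_diff)
    then have "fscale x (a l) \<in> fv.span (a ` ?R)" by simp
    then have "fscale (1 / x) (fscale x (a l)) \<in> fv.span (a ` ?R)" by (rule fv.span_scale)
    moreover have "fscale (1 / x) (fscale x (a l)) = a l" using False by (simp add: fun_eq_iff fscale_apply)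
    ultimately show ?thesis using between[OF l] False by simp
  qed
  then show ?case using insert by simp
qed simp

lemma arc_i: "j \<le> m \<Longrightarrow> m \<le> i + n \<Longrightarrow> arc n i m = insert j (arc n j m) \<union> {i<..<j}"
proof -
  assume m: "j \<le> m" "m \<le> i + n"
  have "y \<in> arc n i m \<longleftrightarrow> y \<in> insert j (arc n j m) \<union> {i<..<j}" for y
    using m ij arc_iff[of i n m y] arc_iff[of j n m y] by auto
  then show ?thesis by blast
qed

lemma arc_j: "m \<le> i + n \<Longrightarrow> j \<notin> arc n j m \<and> arc n j m \<inter> {i<..<j} = {} \<and> arc n j m \<subseteq> {1..n}"
  "m < i + n \<Longrightarrow> i \<notin> arc n j m" "i \<in> arc n j (i + n)"
  using ij arc_iff[of j n m] arc_iff[of j n "i + n"] by auto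

lemma span_j: "m \<le> i + n \<Longrightarrow> fv.span (b ` arc n j m) = fv.span (a ` arc n j m)"
  using arc_j(1)[of m] image_same by simp

lemma aj_iff: "j \<le> m \<Longrightarrow> a j \<in> fv.span (a ` arc n j m) \<longleftrightarrow> p \<le> m"
  using in_span_iff[of j n m a] ij by simp

lemma ai_iff: "i \<le> m \<Longrightarrow> a i \<in> fv.span (a ` arc n i m) \<longleftrightarrow> q \<le> m"
  using in_span_iff[of i n m a] ij by simp

text \<open>From \<open>p\<close> on the column \<open>a j\<close> is redundant, and the columns
  strictly between are eliminated, so the arc of \<open>i\<close> may be replaced by that of
  \<open>j\<close>.\<close>

lemma ai_reduce:
  assumes "p \<le> m" "m \<le> i + n" "q \<le> m"
  shows "a i \<in> fv.span (a ` arc n j m)"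
proof -
  have m: "j \<le> m" using assms ret by simp
  have "a i \<in> fv.span (a ` (insert j (arc n j m) \<union> {i<..<j}))"
    using ai_iff[of m] arc_i[OF m assms(2)] assms m ij by simp
  then have "a i \<in> fv.span (a ` insert j (arc n j m))"
  proof (rule eliminate[of "{i<..<j}", rotated -1])
    note aj = arc_j(1)[OF assms(2)]
    show "insert j (arc n j m) \<inter> {i<..<j} = {}" using aj by simp
    show "insert j (arc n j m) \<subseteq> {1..n}" using aj ij by simp
    show "i \<in> {1..n}" "i \<notin> {i<..<j}" using ij by simp_all
  qed simp_all
  then have "a i \<in> fv.span (insert (a j) (a ` arc n j m))" by simp
  then show ?thesis using fv.span_redundant[of "a j" "a ` arc n j m"] aj_iff[OF m] assms(1) by simp
qed

lemma ret_j: "first_ret n b j = q"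
proof (rule first_ret_eqI)
  show jq: "j \<le> q" using ret by simp
  have s: "fv.span (b ` arc n j q) = fv.span (a ` arc n j q)" using span_j q_le by simp
  have "a j \<in> fv.span (a ` arc n j q)" using aj_iff[OF jq] ret by simp
  moreover have "a i \<in> fv.span (a ` arc n j q)" using ai_reduce[of q] ret q_le by simp
  ultimately show "b j \<in> fv.span (b ` arc n j q)"
    unfolding s b_simps by (intro fv.span_add fv.span_scale)
  fix m assume m: "j \<le> m" "m < q"
  \<comment> \<open>Otherwise \<open>a i\<close>, a multiple of \<open>b j - a j\<close>, would lie
    in the span of the arc of \<open>i\<close> before \<open>q\<close>.\<close>
  show "b j \<notin> fv.span (b ` arc n j m)"
  proof
    assume "b j \<in> fv.span (b ` arc n j m)"
    then have b: "b j \<in> fv.span (a ` arc n j m)" using span_j m q_le by simp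
    have sub: "fv.span (a ` arc n j m) \<subseteq> fv.span (a ` arc n i m)" "a j \<in> fv.span (a ` arc n i m)"
      using arc_i[of m] m q_le by (auto intro!: fv.span_mono fv.span_base)
    have "b j - a j \<in> fv.span (a ` arc n i m)" using b sub by (intro fv.span_diff) auto
    then have "fscale t (a i) \<in> fv.span (a ` arc n i m)" by (simp add: b_simps)
    then have "fscale (1 / t) (fscale t (a i)) \<in> fv.span (a ` arc n i m)" by (rule fv.span_scale)
    moreover have "fscale (1 / t) (fscale t (a i)) = a i" using t by (simp add: fun_eq_iff fscale_apply)
    ultimately show False using ai_iff[of m] m ij by simp
  qed
qed

lemma ret_i: "first_ret n b i = p"
proof (rule first_ret_eqI)
  have pq: "p < i + n" using ret q_le by simp
  show "i \<le> p" using ret ij by simp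
  have arc_eq: "arc n i m = insert j (arc n j m \<union> {i<..<j})" if "j \<le> m" "m \<le> p" for m
    using arc_i[of m] that pq by auto
  show "b i \<in> fv.span (b ` arc n i p)"
  proof -
    have sub: "fv.span (b ` arc n j p) \<subseteq> fv.span (b ` arc n i p)"
      using arc_eq[of p] ret by (intro fv.span_mono) auto
    have "a j \<in> fv.span (b ` arc n j p)" using aj_iff[of p] ret span_j pq by simp
    then have "a j \<in> fv.span (b ` arc n i p)" using sub by blast
    moreover have "b j \<in> fv.span (b ` arc n i p)" using arc_eq[of p] ret by (simp add: fv.span_base)
    ultimately have "b j - a j \<in> fv.span (b ` arc n i p)" by (intro fv.span_diff)
    then have "fscale t (a i) \<in> fv.span (b ` arc n i p)" by (simp add: b_simps)
    then have "fscale (1 / t) (fscale t (a i)) \<in> fv.span (b ` arc n i p)" by (rule fv.span_scale)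
    moreover have "fscale (1 / t) (fscale t (a i)) = a i" using t by (simp add: fun_eq_iff fscale_apply)
    ultimately show ?thesis by (simp add: b_simps)
  qed
  fix m assume m: "i \<le> m" "m < p"
  have nai: "a i \<notin> fv.span (a ` arc n i m)" using ai_iff[OF m(1)] m ret by simp
  show "b i \<notin> fv.span (b ` arc n i m)"
  proof (cases "j \<le> m")
    case False
    then have "j \<notin> arc n i m" using m pq ij by (auto simp: arc_iff)
    then show ?thesis using nai image_same b_simps(3) by simp
  next
    case True
    let ?U = "arc n j m \<union> {i<..<j}"
    have U: "j \<notin> ?U" using arc_j(1)[of m] m pq by auto
    have Ui: "arc n i m = insert j ?U" using arc_eq True m by simp
    show ?thesis
    proof
      assume "b i \<in> fv.span (b ` arc n i m)"
      then have "a i \<in> fv.span (insert (b j) (a ` ?U))"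
        using Ui image_same[OF U] b_simps(3) by simp
      then obtain x where x: "a i - fscale x (b j) \<in> fv.span (a ` ?U)" by (auto simp: fv.span_breakdown_eq)
      let ?u = "a i - fscale x (b j)"
      have sub: "fv.span (a ` ?U) \<subseteq> fv.span (a ` arc n i m)" "a j \<in> fv.span (a ` arc n i m)"
        using Ui by (auto intro!: fv.span_mono fv.span_base)
      show False
      \<comment> \<open>In \<open>a i - x * b j\<close> the column \<open>a i\<close> has the
        coefficient \<open>1 - x * t\<close>. If it is nonzero, \<open>a i\<close> would return
        before \<open>q\<close>; if it is zero, only a multiple of \<open>a j\<close> is left, and
        \<open>a j\<close> would return before \<open>p\<close>.\<close>
      proof (cases "1 - x * t = 0")
        case False
        have "?u + fscale x (a j) \<in> fv.span (a ` arc n i m)"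
          using x sub by (intro fv.span_add fv.span_scale) auto
        then have "fscale (1 / (1 - x * t)) (?u + fscale x (a j)) \<in> fv.span (a ` arc n i m)" by (rule fv.span_scale)
        moreover have "fscale (1 / (1 - x * t)) (?u + fscale x (a j)) = a i"
        proof
          fix r
          define y where "y = (?u + fscale x (a j)) r"
          have "y = (1 - x * t) * a i r" by (simp add: y_def b_simps fscale_apply algebra_simps)
          then show "fscale (1 / (1 - x * t)) (?u + fscale x (a j)) r = a i r"
            unfolding fscale_apply y_def[symmetric] using False by simp
        qed
        ultimately show False using nai by simp
      next
        case True
        then have xt: "x * t = 1" "x \<noteq> 0" by auto
        have "fscale (- 1 / x) ?u \<in> fv.span (a ` ?U)" using x by (rule fv.span_scale)
        moreover have "fscale (- 1 / x) ?u = a j"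
        proof
          fix r
          have "?u r = - x * a j r + (1 - x * t) * a i r" by (simp add: b_simps fscale_apply algebra_simps)
          then show "fscale (- 1 / x) ?u r = a j r" using xt True by (simp add: fscale_apply)
        qed
        ultimately have "a j \<in> fv.span (a ` arc n j m)"
          using eliminate[of "{i<..<j}" "arc n j m" j] arc_j(1)[of m] m pq ij by simp
        then show False using aj_iff[OF \<open>j \<le> m\<close>] m by simp
      qed
    qed
  qed
qed

lemma ret_other:
  assumes l: "1 \<le> l" "l \<le> n" "l \<noteq> i" "l \<noteq> j"
  shows "first_ret n b l = first_ret n a l"
proof (rule first_ret_cong[OF l(1,2)])
  fix m assume m: "l \<le> m" "m \<le> l + n"
  have bl: "b l = a l" using l by (simp add: b_simps)
  show "b l \<in> fv.span (b ` arc n l m) \<longleftrightarrow> a l \<in> fv.span (a ` arc n l m)"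
  proof (cases "i < l \<and> l < j")
    case False
    \<comment> \<open>Starting outside the interval from \<open>i\<close> to \<open>j\<close>, one
      meets \<open>i\<close> before \<open>j\<close>; and the span of a set of columns containing
      both is unchanged.\<close>
    have "j \<in> arc n l m \<Longrightarrow> i \<in> arc n l m"
      using False l ij m by (auto simp: arc_iff)
    then show ?thesis using image_same span_same bl by (cases "j \<in> arc n l m") simp_all
  next
    case True
    show ?thesis
    proof (cases "a l = 0 \<or> m = l + n")
      case True
      then show ?thesis
      proof
        assume "a l = 0"
        then show ?thesis using bl fv.span_zero by simp
      next
        assume e: "m = l + n"
        have "b l \<in> fv.span (b ` arc n l (l + n))" "a l \<in> fv.span (a ` arc n l (l + n))"
          using self_in_arc[OF l(1,2)] by (simp_all add: fv.span_base)
        then show ?thesis unfolding e by simp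
      qed
    next
      case False
      let ?R = "{1..n} - {l}"
      have sub: "arc n l m \<subseteq> ?R" using False l m by (auto simp: arc_iff)
      have "a l \<notin> fv.span (a ` ?R)" using between[of l] True False by blast
      moreover have "fv.span (b ` ?R) = fv.span (a ` ?R)" using span_same[of ?R] ij l by auto
      moreover have "fv.span (a ` arc n l m) \<subseteq> fv.span (a ` ?R)" "fv.span (b ` arc n l m) \<subseteq> fv.span (b ` ?R)"
        using sub by (auto intro!: fv.span_mono)
      ultimately show ?thesis using bl by auto
    qed
  qed
qed

end

section \<open>Minors indexed by lists of columns\<close>

definition minor :: "nat \<Rightarrow> (nat \<Rightarrow> nat \<Rightarrow> real) \<Rightarrow> nat list \<Rightarrow> real" where
  "minor k a xs = det (mat k k (\<lambda>(r, s). a (xs ! s) r))"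

lemma minor_cong: "length xs = k \<Longrightarrow> (\<And>x. x \<in> set xs \<Longrightarrow> a x = b x) \<Longrightarrow> minor k a xs = minor k b xs"
proof -
  assume "length xs = k" "\<And>x. x \<in> set xs \<Longrightarrow> a x = b x"
  then have "mat k k (\<lambda>(r, s). a (xs ! s) r) = mat k k (\<lambda>(r, s). b (xs ! s) r)"
    by (intro eq_matI) auto
  then show ?thesis by (simp add: minor_def)
qed

lemma minor_zero_row:
  assumes "r < k" "length xs = k" "\<And>x. x \<in> set xs \<Longrightarrow> a x r = 0"
  shows "minor k a xs = 0"
proof -
  let ?M = "mat k k (\<lambda>(r, s). a (xs ! s) r)"
  have "det ?M = (\<Sum>s<k. ?M $$ (r, s) * cofactor ?M r s)"
    using assms(1) by (intro laplace_expansion_row) auto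
  also have "\<dots> = 0" using assms by (intro sum.neutral) auto
  finally show ?thesis by (simp add: minor_def)
qed

lemma minor_zero_column:
  assumes "x \<in> set xs" "length xs = k" "a x = 0"
  shows "minor k a xs = 0"
proof -
  obtain s where s: "s < k" "xs ! s = x" using assms by (metis in_set_conv_nth)
  let ?M = "mat k k (\<lambda>(r, s). a (xs ! s) r)"
  have "det ?M = (\<Sum>r<k. ?M $$ (r, s) * cofactor ?M r s)"
    using s(1) by (intro laplace_expansion_column) auto
  also have "\<dots> = 0" using assms s by (intro sum.neutral) auto
  finally show ?thesis by (simp add: minor_def)
qed

lemma minor_repeat:
  assumes "\<not> distinct xs" "length xs = k"
  shows "minor k a xs = 0"
proof -
  obtain s u where "s < k" "u < k" "s \<noteq> u" "xs ! s = xs ! u"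
    using assms by (auto simp: distinct_conv_nth)
  then show ?thesis unfolding minor_def
    by (intro det_identical_columns[of _ k s u]) (auto intro!: eq_vecI)
qed

text \<open>Expansion along the column \<open>j\<close>. The second list need not be increasing,
  which is why minors are indexed by lists.\<close>

lemma minor_linear:
  assumes "length (xs @ j # zs) = k" "j \<notin> set xs" "j \<notin> set zs"
  shows "minor k (a(j := a j + fscale t (a i))) (xs @ j # zs) = minor k a (xs @ j # zs) + t * minor k a (xs @ i # zs)"
proof -
  let ?s = "length xs" and ?b = "a(j := a j + fscale t (a i))"
  have s: "?s < k" using assms by simp
  let ?B = "mat k k (\<lambda>(r, s). ?b ((xs @ j # zs) ! s) r)"
  let ?A = "mat k k (\<lambda>(r, s). a ((xs @ j # zs) ! s) r)"
  let ?C = "mat k k (\<lambda>(r, s). a ((xs @ i # zs) ! s) r)"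
  have off: "?B $$ (r, s) = ?A $$ (r, s)" "?C $$ (r, s) = ?A $$ (r, s)" if "r < k" "s < k" "s \<noteq> ?s" for r s
  proof -
    have "(xs @ j # zs) ! s \<noteq> j"
    proof (cases "s < ?s")
      case True
      then show ?thesis using assms(2) by (metis nth_append nth_mem)
    next
      case False
      then have "(xs @ j # zs) ! s = zs ! (s - ?s - 1)" "s - ?s - 1 < length zs"
        using that assms(1) by (auto simp: nth_append nth_Cons')
      then show ?thesis using assms(3) by (metis nth_mem)
    qed
    moreover have "(xs @ i # zs) ! s = (xs @ j # zs) ! s" using that by (auto simp: nth_append nth_Cons')
    ultimately show "?B $$ (r, s) = ?A $$ (r, s)" "?C $$ (r, s) = ?A $$ (r, s)" using that by simp_all
  qed
  have cof: "cofactor ?B r ?s = cofactor ?A r ?s" "cofactor ?C r ?s = cofactor ?A r ?s" for r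
  proof -
    have "mat_delete ?B r ?s = mat_delete ?A r ?s" "mat_delete ?C r ?s = mat_delete ?A r ?s"
      using off unfolding mat_delete_def by (intro eq_matI; force)+
    then show "cofactor ?B r ?s = cofactor ?A r ?s" "cofactor ?C r ?s = cofactor ?A r ?s"
      by (simp_all add: cofactor_def)
  qed
  have L: "det M = (\<Sum>r<k. M $$ (r, ?s) * cofactor M r ?s)" if "M \<in> carrier_mat k k" for M :: "real mat"
    using laplace_expansion_column[OF that s] .
  have "det ?B = (\<Sum>r<k. ?B $$ (r, ?s) * cofactor ?B r ?s)" by (rule L) simp
  also have "\<dots> = (\<Sum>r<k. ?A $$ (r, ?s) * cofactor ?A r ?s + t * (?C $$ (r, ?s) * cofactor ?C r ?s))"
  proof (rule sum.cong[OF refl])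
    fix r assume "r \<in> {..<k}"
    then have e: "?B $$ (r, ?s) = a j r + t * a i r" "?A $$ (r, ?s) = a j r" "?C $$ (r, ?s) = a i r"
      using s by (simp_all add: fscale_apply)
    show "?B $$ (r, ?s) * cofactor ?B r ?s = ?A $$ (r, ?s) * cofactor ?A r ?s + t * (?C $$ (r, ?s) * cofactor ?C r ?s)"
      unfolding cof e by (simp add: algebra_simps)
  qed
  also have "\<dots> = det ?A + t * det ?C"
    unfolding sum.distrib sum_distrib_left[symmetric] by (subst (1 2) L) simp_all
  finally show ?thesis by (simp add: minor_def)
qed

lemma minor_swap:
  assumes "length (xs @ x # y # zs) = k"
  shows "minor k a (xs @ x # y # zs) = - minor k a (xs @ y # x # zs)"
proof -
  let ?s = "length xs"
  let ?A = "mat k k (\<lambda>(r, s). a ((xs @ y # x # zs) ! s) r)"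
  have s: "?s < k" "Suc ?s < k" using assms by auto
  have "mat k k (\<lambda>(r, s). a ((xs @ x # y # zs) ! s) r) = swapcols ?s (Suc ?s) ?A"
  proof (rule eq_matI)
    fix r u assume "r < dim_row (swapcols ?s (Suc ?s) ?A)" "u < dim_col (swapcols ?s (Suc ?s) ?A)"
    then have ru: "r < k" "u < k" by auto
    consider "u < ?s" | "u = ?s" | "u = Suc ?s" | "Suc ?s < u" by linarith
    then show "mat k k (\<lambda>(r, s). a ((xs @ x # y # zs) ! s) r) $$ (r, u) = swapcols ?s (Suc ?s) ?A $$ (r, u)"
      using ru s by cases (auto simp: nth_append nth_Cons')
  qed auto
  moreover have "det (swapcols ?s (Suc ?s) ?A) = - det ?A"
    using s by (intro det_swapcols) auto
  ultimately show ?thesis by (simp add: minor_def)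
qed

lemma minor_move:
  "length (xs @ ys @ i # zs) = k \<Longrightarrow> minor k a (xs @ ys @ i # zs) = (-1) ^ length ys * minor k a (xs @ i # ys @ zs)"
proof (induction ys arbitrary: xs)
  case (Cons y ys)
  have "minor k a ((xs @ [y]) @ ys @ i # zs) = (-1) ^ length ys * minor k a ((xs @ [y]) @ i # ys @ zs)"
    using Cons.prems by (intro Cons.IH) simp
  moreover have "minor k a (xs @ y # i # ys @ zs) = - minor k a (xs @ i # y # ys @ zs)"
    using Cons.prems by (intro minor_swap) simp
  ultimately show ?case by simp
qed simp

section \<open>Nonnegative configurations with prescribed first returns\<close>

(* The last clause, a row supported in the single column l whenever f l = l + n, forces every
   nonzero minor to contain all such columns; hence the sign in minor_bridge_nonneg does not depend
   on the minor. *)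
definition realized :: "nat \<Rightarrow> nat \<Rightarrow> (nat \<Rightarrow> nat \<Rightarrow> real) \<Rightarrow> (nat \<Rightarrow> nat) \<Rightarrow> bool" where
  "realized k n a f \<longleftrightarrow>
     (\<forall>l. \<forall>r\<ge>k. a l r = 0) \<and>
     (\<forall>y. (\<forall>l\<in>{1..n}. (\<Sum>r<k. y r * a l r) = 0) \<longrightarrow> (\<forall>r<k. y r = 0)) \<and>
     (\<forall>xs. sorted_wrt (<) xs \<longrightarrow> set xs \<subseteq> {1..n} \<longrightarrow> length xs = k \<longrightarrow> 0 \<le> minor k a xs) \<and>
     (\<forall>l\<in>{1..n}. first_ret n a l = f l) \<and>
     (\<forall>l\<in>{1..n}. f l = l + n \<longrightarrow> (\<exists>r<k. a l r \<noteq> 0 \<and> (\<forall>l'\<in>{1..n}. l' \<noteq> l \<longrightarrow> a l' r = 0)))"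

(* f is one period of a bounded affine permutation; f l = l and f l = l + n are the black and the
   white fixed points. *)
definition bounded_affine :: "nat \<Rightarrow> (nat \<Rightarrow> nat) \<Rightarrow> bool" where
  "bounded_affine n f \<longleftrightarrow> (\<forall>l\<in>{1..n}. l \<le> f l \<and> f l \<le> l + n) \<and> inj_on (\<lambda>l. residue n (f l)) {1..n}"

lemma zero_column:
  assumes "1 \<le> l" "l \<le> n" "first_ret n a l = l"
  shows "a l = 0"
  using first_ret_props(3)[OF assms(1,2), of a] assms(3) by (simp add: arc_def)

lemma row_not_in_span:
  assumes "a l r \<noteq> 0" "\<And>l'. l' \<in> S \<Longrightarrow> a l' r = 0"
  shows "a l \<notin> fv.span (a ` S)"
proof
  assume "a l \<in> fv.span (a ` S)"
  moreover have "fv.subspace {v. v r = 0}"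
    by (simp add: fv.subspace_def fscale_apply)
  ultimately have "a l r = 0"
    by (rule fv.span_induct) (use assms(2) in auto)
  then show False using assms(1) by simp
qed

lemma sorted_nth_unique:
  "sorted_wrt (<) xs \<Longrightarrow> sorted_wrt (<) ys \<Longrightarrow> set xs = set ys \<Longrightarrow> xs = (ys :: nat list)"
  by (simp add: strict_sorted_equal)

text \<open>White fixed points receive the unit columns in increasing order and black ones zero
  columns, so the only nonzero minor of size \<open>k\<close> with increasing columns is that of the
  identity matrix.\<close>

lemma realized_fixed:
  assumes "\<And>l. l \<in> {1..n} \<Longrightarrow> f l = l \<or> f l = l + n"
  shows "\<exists>a. realized (card {l \<in> {1..n}. n < f l}) n a f"
proof -
  define W where "W = {l \<in> {1..n}. n < f l}"
  define ws where "ws = sorted_list_of_set W"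
  define k where "k = card W"
  have W: "finite W" "W \<subseteq> {1..n}" by (auto simp: W_def)
  have ws: "set ws = W" "length ws = k" "sorted_wrt (<) ws" "distinct ws"
    using W by (auto simp: ws_def k_def strict_sorted_list_of_set)
  have fW: "l \<in> W \<longleftrightarrow> f l = l + n" if "l \<in> {1..n}" for l
    using assms[OF that] that by (auto simp: W_def)
  define a :: "nat \<Rightarrow> nat \<Rightarrow> real" where "a l r = (if r < k \<and> l = ws ! r then 1 else 0)" for l r
  have unit: "r < k \<Longrightarrow> a (ws ! r) r = 1" "r < k \<Longrightarrow> l \<noteq> ws ! r \<Longrightarrow> a l r = 0" for l r by (auto simp: a_def)
  have ex: "\<exists>r<k. l = ws ! r" if "l \<in> W" for l using that ws(1,2) by (metis in_set_conv_nth)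
  have zero: "a l = 0" if "l \<notin> W" for l
    using that ws by (auto simp: a_def fun_eq_iff)
  have "0 \<le> minor k a xs" if xs: "sorted_wrt (<) xs" "set xs \<subseteq> {1..n}" "length xs = k" for xs
  proof (cases "set xs \<subseteq> W")
    case True
    have "card (set xs) = card W" using xs k_def by (simp add: strict_sorted_iff distinct_card)
    then have "set xs = W" using True W by (simp add: card_subset_eq)
    then have "xs = ws" using ws xs by (intro sorted_nth_unique) auto
    then have "mat k k (\<lambda>(r, s). a (xs ! s) r) = 1\<^sub>m k"
      using ws by (intro eq_matI) (auto simp: a_def nth_eq_iff_index_eq)
    then show ?thesis by (simp add: minor_def)
  next
    case False
    then obtain x where "x \<in> set xs" "x \<notin> W" by blast
    then have "minor k a xs = 0" using zero xs(3) by (intro minor_zero_column[of x]) auto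
    then show ?thesis by simp
  qed
  moreover have "y r = 0" if "\<forall>l\<in>{1..n}. (\<Sum>r<k. y r * a l r) = 0" "r < k" for y r
  proof -
    have "ws ! r \<in> {1..n}" using ws W that(2) by (metis nth_mem subsetD)
    then have "(\<Sum>s<k. y s * a (ws ! r) s) = 0" using that(1) by blast
    moreover have "y s * a (ws ! r) s = (if s = r then y r else 0)" if "s < k" for s
      using that \<open>r < k\<close> ws by (auto simp: a_def nth_eq_iff_index_eq)
    ultimately show ?thesis using that(2) by (simp add: sum.delta)
  qed
  moreover have "first_ret n a l = f l" if l: "l \<in> {1..n}" for l
  proof (cases "l \<in> W")
    case True
    then obtain r where r: "r < k" "l = ws ! r" using ex by blast
    have "a l \<notin> fv.span (a ` arc n l m)" if "l \<le> m" "m < l + n" for m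
    proof (rule row_not_in_span[of _ _ r])
      show "a l r \<noteq> 0" using unit r by simp
      show "a l' r = 0" if "l' \<in> arc n l m" for l'
        using that r unit(2)[of r l'] \<open>m < l + n\<close> l by (cases "l' = l") (auto simp: arc_iff)
    qed
    then have "first_ret n a l = l + n"
      using l self_in_arc[of l n] by (intro first_ret_eqI) (auto intro: fv.span_base)
    then show ?thesis using fW[OF l] True by simp
  next
    case False
    then have "first_ret n a l = l" using zero[OF False] fv.span_zero by (intro first_ret_eqI) auto
    then show ?thesis using assms[OF l] fW[OF l] False by simp
  qed
  moreover have "\<exists>r<k. a l r \<noteq> 0 \<and> (\<forall>l'\<in>{1..n}. l' \<noteq> l \<longrightarrow> a l' r = 0)" if "l \<in> {1..n}" "f l = l + n" for l
  proof -
    have "l \<in> W" using fW that by simp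
    then obtain r where "r < k" "l = ws ! r" using ex by blast
    then show ?thesis using unit by (intro exI[of _ r]) auto
  qed
  moreover have "a l r = 0" if "k \<le> r" for l r using that by (simp add: a_def)
  ultimately have "realized k n a f" unfolding realized_def by blast
  then show ?thesis unfolding k_def W_def by blast
qed

text \<open>By linearity, a minor containing \<open>j\<close> changes by the sign times the minor
  with \<open>i\<close> in place of \<open>j\<close>. Sorting the latter moves \<open>i\<close> past
  the chosen columns between \<open>i\<close> and \<open>j\<close>; a nonzero minor contains exactly
  those of \<open>C\<close>, so the sign needed is always the same.\<close>

lemma minor_bridge_nonneg:
  assumes nonneg: "\<And>xs. sorted_wrt (<) xs \<Longrightarrow> set xs \<subseteq> {1..n} \<Longrightarrow> length xs = k \<Longrightarrow> 0 \<le> minor k a xs"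
    and ij: "1 \<le> i" "i < j" "j \<le> n"
    and C: "C = {l \<in> {i<..<j}. a l \<noteq> 0}"
    and row: "\<And>l. l \<in> C \<Longrightarrow> \<exists>r<k. \<forall>l'\<in>{1..n}. l' \<noteq> l \<longrightarrow> a l' r = 0"
    and xs: "sorted_wrt (<) xs" "set xs \<subseteq> {1..n}" "length xs = k"
  shows "0 \<le> minor k (a(j := a j + fscale ((-1) ^ card C) (a i))) xs"
proof -
  let ?t = "(-1) ^ card C :: real"
  let ?b = "a(j := a j + fscale ?t (a i))"
  show ?thesis
  proof (cases "j \<in> set xs")
    case False
    then have "minor k ?b xs = minor k a xs" using xs(3) by (intro minor_cong) auto
    then show ?thesis using nonneg xs by simp
  next
    case True
    then obtain us zs where s: "xs = us @ j # zs" by (metis split_list)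
    have lt: "\<And>x. x \<in> set us \<Longrightarrow> x < j" "\<And>x. x \<in> set zs \<Longrightarrow> j < x" using xs(1) s by (auto simp: sorted_wrt_append)
    have lin: "minor k ?b xs = minor k a xs + ?t * minor k a (us @ i # zs)"
      unfolding s using lt xs(3) s by (intro minor_linear) auto
    have "0 \<le> ?t * minor k a (us @ i # zs)"
    proof (cases "i \<in> set us")
      case True
      then have "minor k a (us @ i # zs) = 0" using xs(3) s by (intro minor_repeat) auto
      then show ?thesis by simp
    next
      case False
      define vs where "vs = filter (\<lambda>x. x < i) us"
      define ys where "ys = filter (\<lambda>x. i < x) us"
      have su: "sorted_wrt (<) us" "sorted_wrt (<) zs" using xs(1) s by (simp_all add: sorted_wrt_append)
      have us: "us = vs @ ys"
      proof (rule sorted_nth_unique)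
        show "sorted_wrt (<) (vs @ ys)" using su by (auto simp: vs_def ys_def sorted_wrt_append sorted_wrt_filter)
        show "set us = set (vs @ ys)" using False by (auto simp: vs_def ys_def not_less le_less)
      qed (rule su)
      have ysr: "set ys \<subseteq> {i<..<j}" using lt by (auto simp: ys_def)
      have len: "length (vs @ ys @ i # zs) = k" using xs(3) s us by simp
      show ?thesis
      proof (cases "set ys = C")
        case True
        have d: "length ys = card C" using True su by (metis distinct_card strict_sorted_iff us sorted_wrt_append)
        have sorted: "sorted_wrt (<) (vs @ i # ys @ zs)"
        proof -
          have "sorted_wrt (<) (vs @ ys)" using su(1) us by simp
          moreover have "\<And>x. x \<in> set vs \<Longrightarrow> x < i" by (simp add: vs_def)
          moreover have "\<And>x. x \<in> set ys \<Longrightarrow> i < x \<and> x < j" using ysr by auto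
          ultimately show ?thesis using su(2) lt(2) ij(2) by (fastforce simp: sorted_wrt_append)
        qed
        have sub: "set (vs @ i # ys @ zs) \<subseteq> {1..n}" using xs(2) s us ij by auto
        have "0 \<le> minor k a (vs @ i # ys @ zs)" using nonneg[OF sorted sub] len by simp
        moreover have "?t * minor k a (us @ i # zs) = minor k a (vs @ i # ys @ zs)"
          using minor_move[OF len, of a] us d by (simp flip: mult.assoc power_add mult_2)
        ultimately show ?thesis by simp
      next
        case False
        have "minor k a (us @ i # zs) = 0"
        proof (cases "set ys \<subseteq> C")
          case True
          \<comment> \<open>The missing column \<open>l\<close> is the only one with an entry in its
            row \<open>r\<close>, so this row of the minor vanishes.\<close>
          then obtain l where l: "l \<in> C" "l \<notin> set ys" using False by blast
          obtain r where r: "r < k" "\<And>l'. l' \<in> {1..n} \<Longrightarrow> l' \<noteq> l \<Longrightarrow> a l' r = 0" using row[OF l(1)] by blast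
          have lij: "i < l" "l < j" using l(1) C by auto
          have "l \<notin> set (us @ i # zs)"
            using l(2) lij lt(2)[of l] by (auto simp: ys_def)
          moreover have "set (us @ i # zs) \<subseteq> {1..n}" using xs(2) s ij by auto
          ultimately have "a x r = 0" if "x \<in> set (us @ i # zs)" for x using r(2) that by (metis subsetD)
          then show ?thesis using r(1) len us by (intro minor_zero_row[of r]) auto
        next
          case False
          then obtain y where "y \<in> set ys" "a y = 0" using ysr C by blast
          then show ?thesis using len us by (intro minor_zero_column[of y]) auto
        qed
        then show ?thesis by simp
      qed
    qed
    then show ?thesis using lin nonneg[OF xs] by simp
  qed
qed

text \<open>\<open>bridge\<close> turns the exchanged returns back into \<open>f\<close>. The rows
  reserved for white fixed points are zero in the columns \<open>i\<close> and \<open>j\<close>,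
  hence they remain reserved, and adding a column to another preserves independence of the
  rows.\<close>

lemma realized_bridge:
  assumes ij: "1 \<le> i" "i < j" "j \<le> n"
    and fx: "\<And>l. i < l \<Longrightarrow> l < j \<Longrightarrow> f l = l \<or> f l = l + n"
    and f: "j \<le> f i" "f i < f j" "f i \<noteq> i + n" "f j \<noteq> j + n"
    and a: "realized k n a (f(i := f j, j := f i))"
  shows "\<exists>b. realized k n b f"
proof -
  let ?g = "f(i := f j, j := f i)"
  have a1: "\<And>l r. k \<le> r \<Longrightarrow> a l r = 0"
    and a2: "\<And>y r. (\<And>l. l \<in> {1..n} \<Longrightarrow> (\<Sum>r<k. y r * a l r) = 0) \<Longrightarrow> r < k \<Longrightarrow> y r = 0"
    and a3: "\<And>xs. sorted_wrt (<) xs \<Longrightarrow> set xs \<subseteq> {1..n} \<Longrightarrow> length xs = k \<Longrightarrow> 0 \<le> minor k a xs"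
    and a4: "\<And>l. l \<in> {1..n} \<Longrightarrow> first_ret n a l = ?g l"
    and a5: "\<And>l. l \<in> {1..n} \<Longrightarrow> ?g l = l + n \<Longrightarrow> \<exists>r<k. a l r \<noteq> 0 \<and> (\<forall>l'\<in>{1..n}. l' \<noteq> l \<longrightarrow> a l' r = 0)"
    using a unfolding realized_def by blast+
  define C where "C = {l \<in> {i<..<j}. a l \<noteq> 0}"
  define t where "t = ((-1) ^ card C :: real)"
  have ijn: "i \<in> {1..n}" "j \<in> {1..n}" using ij by auto
  have mid: "a l = 0 \<or> (\<exists>r<k. a l r \<noteq> 0 \<and> (\<forall>l'\<in>{1..n}. l' \<noteq> l \<longrightarrow> a l' r = 0))" if l: "i < l" "l < j" for l
  proof -
    have ln: "l \<in> {1..n}" and gl: "?g l = f l" using l ij by auto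
    show ?thesis
    proof (cases "f l = l")
      case True
      then have "first_ret n a l = l" using a4[OF ln] gl by simp
      then show ?thesis using zero_column[of l n a] ln by simp
    next
      case False
      then show ?thesis using fx[OF l] a5[OF ln] gl by simp
    qed
  qed
  interpret bridge n i j a t
  proof
    show "a l = 0 \<or> a l \<notin> fv.span (a ` ({1..n} - {l}))" if l: "i < l" "l < j" for l
      using mid[OF l] row_not_in_span[of a l _ "{1..n} - {l}"] by blast
    show "j \<le> first_ret n a j" "first_ret n a j < first_ret n a i"
      using a4[OF ijn(1)] a4[OF ijn(2)] f ij by auto
  qed (use ij in \<open>simp_all add: t_def\<close>)
  have nonneg: "0 \<le> minor k b xs" if "sorted_wrt (<) xs" "set xs \<subseteq> {1..n}" "length xs = k" for xs
    unfolding b_def unfolding t_def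
    by (rule minor_bridge_nonneg[OF a3 ij C_def _ that]) (use mid C_def in auto)
  have ret: "first_ret n b l = f l" if "l \<in> {1..n}" for l
    using that ret_i ret_j ret_other[of l] a4[OF ijn(1)] a4[OF ijn(2)] a4[OF that] ij
    by (cases "l = i"; cases "l = j") auto
  have ind: "y r = 0" if y: "\<And>l. l \<in> {1..n} \<Longrightarrow> (\<Sum>r<k. y r * b l r) = 0" and "r < k" for y r
  proof (rule a2[OF _ \<open>r < k\<close>])
    fix l assume l: "l \<in> {1..n}"
    have yi: "(\<Sum>r<k. y r * a i r) = 0" using y[OF ijn(1)] b_simps(3) by simp
    show "(\<Sum>r<k. y r * a l r) = 0"
    proof (cases "l = j")
      case True
      have "0 = (\<Sum>r<k. y r * b j r)" using y[OF ijn(2)] by simp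
      also have "\<dots> = (\<Sum>r<k. y r * a j r) + t * (\<Sum>r<k. y r * a i r)"
        unfolding b_simps(1) by (simp add: fscale_apply algebra_simps sum.distrib sum_distrib_left)
      finally show ?thesis using yi True by simp
    next
      case False
      then show ?thesis using y[OF l] b_simps(2)[OF False] by simp
    qed
  qed
  have rows: "\<exists>r<k. b l r \<noteq> 0 \<and> (\<forall>l'\<in>{1..n}. l' \<noteq> l \<longrightarrow> b l' r = 0)" if l: "l \<in> {1..n}" "f l = l + n" for l
  proof -
    have lij: "l \<noteq> i" "l \<noteq> j" using l f by auto
    then obtain r where r: "r < k" "a l r \<noteq> 0" "\<And>l'. l' \<in> {1..n} \<Longrightarrow> l' \<noteq> l \<Longrightarrow> a l' r = 0"
      using a5[OF l(1)] l(2) by auto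
    have "b l' r = 0" if "l' \<in> {1..n}" "l' \<noteq> l" for l'
    proof (cases "l' = j")
      case True
      then show ?thesis using r(3)[OF ijn(1)] r(3)[OF ijn(2)] lij by (simp add: b_simps(1) fscale_apply)
    next
      case False
      then show ?thesis using r(3)[OF that] by (simp add: b_simps(2))
    qed
    then show ?thesis using r(1,2) lij by (intro exI[of _ r]) (simp add: b_simps(2))
  qed
  have "b l r = 0" if "k \<le> r" for l r
    using a1[OF that] by (simp add: b_def fscale_apply)
  then have "realized k n b f" unfolding realized_def using nonneg ret ind rows by blast
  then show ?thesis by blast
qed

text \<open>If the residue were a fixed point, injectivity would make it equal to \<open>l\<close>.
  Hence non-fixed points are sent to non-fixed points.\<close>

lemma bounded_affine_residue:
  assumes "bounded_affine n f" "0 < n"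
    and "l \<in> {1..n}" "f l \<noteq> l" "f l \<noteq> l + n"
  shows "f (residue n (f l)) \<noteq> residue n (f l)" "f (residue n (f l)) \<noteq> residue n (f l) + n"
proof -
  let ?m = "residue n (f l)"
  have m: "?m \<in> {1..n}" using residue_range[OF assms(2)] .
  have fl: "l \<le> f l" "f l \<le> l + n" using assms by (auto simp: bounded_affine_def)
  have ne: "?m \<noteq> l"
  proof (cases "f l \<le> n")
    case True
    then show ?thesis using residue_le[of "f l" n] fl assms by auto
  next
    case False
    then show ?thesis using residue_wrap[of n "f l"] fl assms by auto
  qed
  have inj: "inj_on (\<lambda>l. residue n (f l)) {1..n}" using assms(1) by (simp add: bounded_affine_def)
  have "residue n (f ?m) \<noteq> ?m"
  proof
    assume "residue n (f ?m) = ?m"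
    then have "?m = l" using inj m assms(3) by (auto dest: inj_onD)
    then show False using ne by simp
  qed
  then show "f ?m \<noteq> ?m" "f ?m \<noteq> ?m + n"
    using residue_le[of ?m n] residue_wrap[of n "?m + n"] m by auto
qed

text \<open>Choose non-fixed points \<open>i < j\<close> with \<open>f i < f j\<close> and
  \<open>j - i\<close> minimal. A non-fixed point between them would form a closer pair with one of
  the two. Were \<open>f i < j\<close> or \<open>f j > i + n\<close>, the residue of that value
  would be such a point.\<close>

lemma bounded_affine_descent:
  assumes b: "bounded_affine n f" and n: "0 < n"
    and nf: "l0 \<in> {1..n}" "f l0 \<noteq> l0" "f l0 \<noteq> l0 + n"
  shows "\<exists>i j. 1 \<le> i \<and> i < j \<and> j \<le> n \<and> (\<forall>l. i < l \<longrightarrow> l < j \<longrightarrow> f l = l \<or> f l = l + n) \<and>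
     j \<le> f i \<and> f i < f j \<and> f j \<le> i + n \<and> f i \<noteq> i + n \<and> f j \<noteq> j + n"
proof -
  define N where "N = {l \<in> {1..n}. f l \<noteq> l \<and> f l \<noteq> l + n}"
  have fb: "\<And>l. l \<in> {1..n} \<Longrightarrow> l \<le> f l \<and> f l \<le> l + n" using b by (simp add: bounded_affine_def)
  have res: "residue n (f l) \<in> N" if "l \<in> N" for l
    using bounded_affine_residue[OF b n, of l] that residue_range[OF n, of "f l"] by (auto simp: N_def)
  have res1: "f l \<in> N" if "l \<in> N" "f l \<le> n" for l
    using res[OF that(1)] residue_le[of "f l" n] fb[of l] that by (auto simp: N_def)
  have res2: "f l - n \<in> N" if "l \<in> N" "n < f l" for l
    using res[OF that(1)] residue_wrap[of n "f l"] fb[of l] that by (auto simp: N_def)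
  have N: "finite N" "N \<noteq> {}" using nf by (auto simp: N_def)
  have "\<exists>i j. i \<in> N \<and> j \<in> N \<and> i < j \<and> f i < f j"
  proof (rule ccontr)
    assume "\<not> ?thesis"
    \<comment> \<open>If \<open>f\<close> were weakly decreasing on \<open>N\<close>, the residue of
      the value at the largest point would be a point of \<open>N\<close> beyond the largest or
      before the smallest.\<close>
    then have anti: "\<And>i j. i \<in> N \<Longrightarrow> j \<in> N \<Longrightarrow> i < j \<Longrightarrow> f j \<le> f i" by (meson not_less)
    define u where "u = Min N"
    define w where "w = Max N"
    have u: "u \<in> N" "\<And>l. l \<in> N \<Longrightarrow> u \<le> l" using N by (auto simp: u_def)
    have w: "w \<in> N" "\<And>l. l \<in> N \<Longrightarrow> l \<le> w" using N by (auto simp: w_def)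
    have "f w \<le> f u" using anti[of u w] u w by (cases "u = w") (auto simp: order.order_iff_strict)
    moreover have "f u < u + n" "w < f w" using fb[of u] fb[of w] u(1) w(1) by (auto simp: N_def)
    ultimately have lt: "f w < u + n" "w < f w" by auto
    show False
    proof (cases "f w \<le> n")
      case True
      then show False using w(2)[OF res1[OF w(1)]] lt by simp
    next
      case False
      then show False using u(2)[OF res2[OF w(1)]] lt by simp
    qed
  qed
  then have ex: "\<exists>d i j. i \<in> N \<and> j \<in> N \<and> i < j \<and> f i < f j \<and> j - i = d" by blast
  define d where "d = (LEAST d. \<exists>i j. i \<in> N \<and> j \<in> N \<and> i < j \<and> f i < f j \<and> j - i = d)"
  have min: "\<not> (\<exists>i j. i \<in> N \<and> j \<in> N \<and> i < j \<and> f i < f j \<and> j - i = e)" if "e < d" for e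
    using not_less_Least[OF that[unfolded d_def]] .
  have "\<exists>i j. i \<in> N \<and> j \<in> N \<and> i < j \<and> f i < f j \<and> j - i = d"
    unfolding d_def by (rule LeastI_ex[OF ex])
  then obtain i j where ij: "i \<in> N" "j \<in> N" "i < j" "f i < f j" "j - i = d" by blast
  have ij1: "1 \<le> i" "j \<le> n" "f i \<noteq> i" "f i \<noteq> i + n" "f j \<noteq> j" "f j \<noteq> j + n" "i \<in> {1..n}" "j \<in> {1..n}"
    using ij by (auto simp: N_def)
  have mid: "l \<notin> N" if l: "i < l" "l < j" for l
  proof
    assume lN: "l \<in> N"
    show False
    proof (cases "f i < f l")
      case True
      moreover have "l - i < d" using ij(3,5) l by linarith
      ultimately show False using min[of "l - i"] ij(1) lN l(1) by blast
    next
      case False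
      then have "f l < f j" using ij by simp
      moreover have "j - l < d" using ij(3,5) l by linarith
      ultimately show False using min[of "j - l"] ij(2) lN l(2) by blast
    qed
  qed
  have "j \<le> f i"
  proof (rule ccontr)
    assume a: "\<not> j \<le> f i"
    then have "f i \<in> N" using res1[OF ij(1)] ij1 by simp
    then show False using mid[of "f i"] a fb[OF ij1(7)] ij1 by simp
  qed
  moreover have "f j \<le> i + n"
  proof (rule ccontr)
    assume a: "\<not> f j \<le> i + n"
    then have "f j - n \<in> N" using res2[OF ij(2)] by simp
    moreover have "i < f j - n" "f j - n < j" using a fb[OF ij1(8)] ij1(6) by linarith+
    ultimately show False using mid[of "f j - n"] by blast
  qed
  moreover have "f l = l \<or> f l = l + n" if "i < l" "l < j" for l
    using mid[OF that] that ij1 by (auto simp: N_def)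
  ultimately show ?thesis using ij ij1 by blast
qed

lemma rearrangement:
  fixes i j p q :: nat
  assumes "i < j" "p < q"
  shows "i * q + j * p < i * p + j * q"
proof -
  obtain x y where "j = i + Suc x" "q = p + Suc y" using assms by (metis less_iff_Suc_add add_Suc_right)
  then show ?thesis by (simp add: algebra_simps)
qed

lemma realized_exists:
  assumes "0 < n" "bounded_affine n f"
  shows "\<exists>a. realized (card {l \<in> {1..n}. n < f l}) n a f"
  using assms(2)
proof (induction "\<Sum>l\<in>{1..n}. l * f l" arbitrary: f rule: less_induct)
  case less
  show ?case
  proof (cases "\<forall>l\<in>{1..n}. f l = l \<or> f l = l + n")
    case True
    then show ?thesis using realized_fixed by blast
  next
    case False
    then obtain l0 where "l0 \<in> {1..n}" "f l0 \<noteq> l0" "f l0 \<noteq> l0 + n" by blast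
    then obtain i j where ij: "1 \<le> i" "i < j" "j \<le> n"
      and fx: "\<And>l. i < l \<Longrightarrow> l < j \<Longrightarrow> f l = l \<or> f l = l + n"
      and f: "j \<le> f i" "f i < f j" "f j \<le> i + n" "f i \<noteq> i + n" "f j \<noteq> j + n"
      using bounded_affine_descent[OF less.prems assms(1)] by metis
    let ?g = "f(i := f j, j := f i)"
    have ijn: "i \<in> {1..n}" "j \<in> {1..n}" using ij by auto
    have g: "?g = f \<circ> transpose i j" using ij by (auto simp: fun_eq_iff transpose_def)
    have tp: "transpose i j permutes {1..n}" using ijn by (rule permutes_swap_id)
    have fb: "\<And>l. l \<in> {1..n} \<Longrightarrow> l \<le> f l \<and> f l \<le> l + n" and inj: "inj_on (\<lambda>l. residue n (f l)) {1..n}"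
      using less.prems by (auto simp: bounded_affine_def)
    have "bounded_affine n ?g"
      unfolding bounded_affine_def
    proof
      have "l \<le> ?g l \<and> ?g l \<le> l + n" if "l \<in> {1..n}" for l
        using fb[OF that] fb[OF ijn(1)] fb[OF ijn(2)] f ij by (cases "l = i"; cases "l = j") auto
      then show "\<forall>l\<in>{1..n}. l \<le> ?g l \<and> ?g l \<le> l + n" by blast
      have "inj_on ((\<lambda>l. residue n (f l)) \<circ> transpose i j) {1..n}"
        using inj permutes_image[OF tp] by (intro comp_inj_on) (simp_all add: inj_on_subset[OF inj_transpose])
      then show "inj_on (\<lambda>l. residue n (?g l)) {1..n}" unfolding g by (simp add: comp_def)
    qed
    moreover have "(\<Sum>l\<in>{1..n}. l * ?g l) < (\<Sum>l\<in>{1..n}. l * f l)"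
    proof -
      have e: "(\<Sum>l\<in>{1..n} - {i, j}. l * ?g l) = (\<Sum>l\<in>{1..n} - {i, j}. l * f l)" by (rule sum.cong) auto
      have "(\<Sum>l\<in>{1..n}. l * h l) = i * h i + (j * h j + (\<Sum>l\<in>{1..n} - {i, j}. l * h l))" for h :: "nat \<Rightarrow> nat"
      proof -
        have "(\<Sum>l\<in>{1..n}. l * h l) = i * h i + (\<Sum>l\<in>{1..n} - {i}. l * h l)"
          using ijn by (intro sum.remove) auto
        also have "(\<Sum>l\<in>{1..n} - {i}. l * h l) = j * h j + (\<Sum>l\<in>{1..n} - {i} - {j}. l * h l)"
          using ijn ij by (intro sum.remove) auto
        also have "{1..n} - {i} - {j} = {1..n} - {i, j}" by blast
        finally show ?thesis .
      qed
      moreover have "i * f j + j * f i < i * f i + j * f j" using ij(2) f(2) by (rule rearrangement)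
      moreover have "?g i = f j" "?g j = f i" using ij by simp_all
      ultimately show ?thesis using e by simp
    qed
    ultimately obtain a where a: "realized (card {l \<in> {1..n}. n < ?g l}) n a ?g" using less.hyps by blast
    \<comment> \<open>Exchanging two values does not change how many of them exceed
      \<open>n\<close>, and this is the number of rows.\<close>
    have "{l \<in> {1..n}. n < ?g l} = transpose i j ` {l \<in> {1..n}. n < f l}"
    proof (intro subset_antisym subsetI)
      fix l assume l: "l \<in> {l \<in> {1..n}. n < ?g l}"
      then have "transpose i j l \<in> {l \<in> {1..n}. n < f l}" using g permutes_in_image[OF tp] by auto
      then show "l \<in> transpose i j ` {l \<in> {1..n}. n < f l}" by (metis imageI transpose_involutory)
    next
      fix l assume "l \<in> transpose i j ` {l \<in> {1..n}. n < f l}"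
      then obtain m where "l = transpose i j m" "m \<in> {1..n}" "n < f m" by blast
      then show "l \<in> {l \<in> {1..n}. n < ?g l}" using g permutes_in_image[OF tp, of m] by simp
    qed
    then have "card {l \<in> {1..n}. n < ?g l} = card {l \<in> {1..n}. n < f l}"
      by (simp add: card_image inj_on_subset[OF inj_transpose])
    then have "realized (card {l \<in> {1..n}. n < f l}) n a ?g" using a by simp
    from realized_bridge[OF ij fx f(1,2,4,5) this] show ?thesis .
  qed
qed

section \<open>Positroid cells are nonempty\<close>

lemma fv_span_image:
  "finite T \<Longrightarrow> x \<in> fv.span (g ` T) \<longleftrightarrow> (\<exists>c. \<forall>r. x r = (\<Sum>t\<in>T. c t * g t r))"
proof (induction T arbitrary: x rule: finite_induct)
  case empty
  then show ?case by (auto simp: fun_eq_iff)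
next
  case (insert t T)
  have "x \<in> fv.span (g ` insert t T) \<longleftrightarrow> (\<exists>z. x - fscale z (g t) \<in> fv.span (g ` T))"
    using fv.span_breakdown_eq[of x "g t" "g ` T"] by simp
  also have "\<dots> \<longleftrightarrow> (\<exists>z c. \<forall>r. (x - fscale z (g t)) r = (\<Sum>t\<in>T. c t * g t r))"
    using insert.IH by blast
  also have "\<dots> \<longleftrightarrow> (\<exists>c. \<forall>r. x r = (\<Sum>t\<in>insert t T. c t * g t r))"
  proof
    assume "\<exists>z c. \<forall>r. (x - fscale z (g t)) r = (\<Sum>t\<in>T. c t * g t r)"
    then obtain z c where c: "\<And>r. x r = z * g t r + (\<Sum>t\<in>T. c t * g t r)"
      by (auto simp: fscale_apply algebra_simps)
    have "(\<Sum>s\<in>T. (c(t := z)) s * g s r) = (\<Sum>s\<in>T. c s * g s r)" for r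
      using insert.hyps(2) by (intro sum.cong) auto
    then have "x r = (\<Sum>s\<in>insert t T. (c(t := z)) s * g s r)" for r
      using c insert.hyps by simp
    then show "\<exists>c. \<forall>r. x r = (\<Sum>t\<in>insert t T. c t * g t r)" by blast
  next
    assume "\<exists>c. \<forall>r. x r = (\<Sum>t\<in>insert t T. c t * g t r)"
    then obtain c where "\<And>r. x r = (\<Sum>t\<in>insert t T. c t * g t r)" by blast
    then have "(x - fscale (c t) (g t)) r = (\<Sum>t\<in>T. c t * g t r)" for r
      using insert.hyps by (simp add: fscale_apply)
    then show "\<exists>z c. \<forall>r. (x - fscale z (g t)) r = (\<Sum>t\<in>T. c t * g t r)" by blast
  qed
  finally show ?case .
qed

definition entry :: "nat \<Rightarrow> real vec \<Rightarrow> nat \<Rightarrow> real" where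
  "entry k v r = (if r < k then v $ r else 0)"

lemma vec_span_iff:
  assumes "finite S" "S \<subseteq> carrier_vec k" "x \<in> carrier_vec k"
  shows "x \<in> LinearCombinations.module.span class_ring (module_vec TYPE(real) k) S \<longleftrightarrow>
    entry k x \<in> fv.span (entry k ` S)"
proof -
  interpret V: vec_space "TYPE(real)" k .
  have "x \<in> V.span S \<longleftrightarrow> (\<exists>c. x = V.lincomb c S)"
    unfolding V.finite_span[OF assms(1), unfolded module_vec_simps, OF assms(2)] by (auto simp: class_ring_simps)
  also have "\<dots> \<longleftrightarrow> (\<exists>c. \<forall>r<k. x $ r = (\<Sum>v\<in>S. c v * v $ r))"
  proof -
    have "x = V.lincomb c S \<longleftrightarrow> (\<forall>r<k. x $ r = (\<Sum>v\<in>S. c v * v $ r))" for c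
    proof -
      have d: "dim_vec (V.lincomb c S) = k" using V.lincomb_dim[OF assms(1,2)] .
      show ?thesis
        using V.lincomb_index[OF _ assms(2), of _ c] d assms(3) by (metis carrier_vecD eq_vecI)
    qed
    then show ?thesis by simp
  qed
  also have "\<dots> \<longleftrightarrow> (\<exists>c. \<forall>r. entry k x r = (\<Sum>v\<in>S. c v * entry k v r))"
    by (intro ex_cong1) (auto simp: entry_def)
  also have "\<dots> \<longleftrightarrow> entry k x \<in> fv.span (entry k ` S)" using fv_span_image[OF assms(1)] by simp
  finally show ?thesis .
qed

lemma sum_unit:
  fixes h :: "nat \<Rightarrow> real"
  assumes "r < k"
  shows "(\<Sum>x<k. (if x = r then 1 else 0) * h x) = h r"
proof -
  have "(\<Sum>x<k. (if x = r then 1 else 0) * h x) = (\<Sum>x<k. if x = r then h x else 0)"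
    by (rule sum.cong) auto
  then show ?thesis using assms by simp
qed

lemma in_row_space_iff:
  fixes A :: "real mat"
  assumes A: "A \<in> carrier_mat k n"
  shows "w \<in> vec_space.row_space n A \<longleftrightarrow> (\<exists>y. w = vec n (\<lambda>i. \<Sum>r<k. y r * A $$ (r, i)))"
proof -
  interpret V: vec_space "TYPE(real)" n .
  have e: "A\<^sup>T *\<^sub>v y = vec n (\<lambda>i. \<Sum>r<k. y $ r * A $$ (r, i))" if "y \<in> carrier_vec k" for y
    using A that by (intro eq_vecI) (auto simp: scalar_prod_def lessThan_atLeast0 mult.commute intro!: sum.cong)
  show ?thesis
  proof
    assume "w \<in> V.row_space A"
    then obtain y where "y \<in> carrier_vec k" "A\<^sup>T *\<^sub>v y = w" using A V.row_space_eq[OF A] by auto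
    then show "\<exists>y. w = vec n (\<lambda>i. \<Sum>r<k. y r * A $$ (r, i))" using e by metis
  next
    assume "\<exists>y. w = vec n (\<lambda>i. \<Sum>r<k. y r * A $$ (r, i))"
    then obtain y where y: "w = vec n (\<lambda>i. \<Sum>r<k. y r * A $$ (r, i))" by blast
    have "A\<^sup>T *\<^sub>v vec k y = w" unfolding y using e[of "vec k y"] by (auto intro!: eq_vecI sum.cong)
    moreover have "w \<in> carrier_vec n" using y by simp
    ultimately show "w \<in> V.row_space A" using A V.row_space_eq[OF A] by auto
  qed
qed

text \<open>A relation between columns is an identity between coordinates that holds on the whole
  row space. Hence first returns depend on the subspace only, whichever representing matrix is
  chosen.\<close>

lemma column_span_iff:
  assumes A: "A \<in> carrier_mat k n" and "i < n" "T \<subseteq> {..<n}"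
  shows "col A i \<in> LinearCombinations.module.span class_ring (module_vec TYPE(real) k) (col A ` T) \<longleftrightarrow>
    (\<exists>c. \<forall>w\<in>vec_space.row_space n A. w $ i = (\<Sum>j\<in>T. c j * w $ j))" (is "?L \<longleftrightarrow> ?R")
proof -
  have T: "finite T" using assms(3) finite_subset by blast
  have "?L \<longleftrightarrow> entry k (col A i) \<in> fv.span (entry k ` col A ` T)"
    using A T by (intro vec_span_iff) (auto simp: carrier_vecI)
  also have "\<dots> \<longleftrightarrow> (\<exists>c. \<forall>r. entry k (col A i) r = (\<Sum>j\<in>T. c j * entry k (col A j) r))"
    using fv_span_image[OF T, of _ "\<lambda>j. entry k (col A j)"] by (simp add: image_image)
  also have "\<dots> \<longleftrightarrow> (\<exists>c. \<forall>r<k. A $$ (r, i) = (\<Sum>j\<in>T. c j * A $$ (r, j)))"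
  proof -
    have i: "entry k (col A j) r = (if r < k then A $$ (r, j) else 0)" if "j < n" for j r
      using A that by (simp add: entry_def)
    have "(\<Sum>j\<in>T. c j * entry k (col A j) r) = (if r < k then \<Sum>j\<in>T. c j * A $$ (r, j) else 0)" for c r
      using i assms(3) by (cases "r < k") (auto intro!: sum.cong sum.neutral)
    then show ?thesis using i[OF assms(2)] by auto
  qed
  also have "\<dots> \<longleftrightarrow> ?R"
  proof (rule ex_cong1)
    fix c
    show "(\<forall>r<k. A $$ (r, i) = (\<Sum>j\<in>T. c j * A $$ (r, j))) \<longleftrightarrow>
      (\<forall>w\<in>vec_space.row_space n A. w $ i = (\<Sum>j\<in>T. c j * w $ j))"
    proof (intro iffI ballI allI impI)
      fix w assume a: "\<forall>r<k. A $$ (r, i) = (\<Sum>j\<in>T. c j * A $$ (r, j))" and "w \<in> vec_space.row_space n A"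
      then obtain y where y: "w = vec n (\<lambda>i. \<Sum>r<k. y r * A $$ (r, i))" using in_row_space_iff[OF A] by blast
      have "w $ i = (\<Sum>r<k. y r * (\<Sum>j\<in>T. c j * A $$ (r, j)))" using y assms(2) a by simp
      also have "\<dots> = (\<Sum>j\<in>T. c j * (\<Sum>r<k. y r * A $$ (r, j)))"
        unfolding sum_distrib_left by (subst sum.swap) (simp add: mult.left_commute)
      also have "\<dots> = (\<Sum>j\<in>T. c j * w $ j)" using y assms(3) by (intro sum.cong) auto
      finally show "w $ i = (\<Sum>j\<in>T. c j * w $ j)" .
    next
      fix r assume a: "\<forall>w\<in>vec_space.row_space n A. w $ i = (\<Sum>j\<in>T. c j * w $ j)" and r: "r < k"
      \<comment> \<open>The identity is applied to row \<open>r\<close> itself, which is a vector of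
        the row space.\<close>
      define w where "w = vec n (\<lambda>i. A $$ (r, i))"
      define y where "y = (\<lambda>x. if x = r then 1 else 0 :: real)"
      have "(\<Sum>x<k. y x * A $$ (x, i)) = A $$ (r, i)" for i
        unfolding y_def by (rule sum_unit[OF r])
      then have "w = vec n (\<lambda>i. \<Sum>x<k. y x * A $$ (x, i))" unfolding w_def by presburger
      then have "w \<in> vec_space.row_space n A" using in_row_space_iff[OF A] by blast
      then have "w $ i = (\<Sum>j\<in>T. c j * w $ j)" using a by blast
      moreover have "(\<Sum>j\<in>T. c j * w $ j) = (\<Sum>j\<in>T. c j * A $$ (r, j))"
        using assms(3) by (intro sum.cong) (auto simp: w_def)
      ultimately show "A $$ (r, i) = (\<Sum>j\<in>T. c j * A $$ (r, j))" using assms(2) by (simp add: w_def)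
    qed
  qed
  finally show ?thesis .
qed

lemma first_return_row_space:
  assumes "0 < n" "A \<in> carrier_mat k n" "B \<in> carrier_mat k n" "vec_space.row_space n A = vec_space.row_space n B"
  shows "first_return k n A i = first_return k n B i"
proof -
  have r: "residue n j - 1 < n" for j using residue_range[OF assms(1), of j] by auto
  have "cyc_col n A i \<in> LinearCombinations.module.span class_ring (module_vec TYPE(real) k) (cyc_col n A ` {i<..m}) \<longleftrightarrow>
    cyc_col n B i \<in> LinearCombinations.module.span class_ring (module_vec TYPE(real) k) (cyc_col n B ` {i<..m})" for m
  proof -
    have im: "cyc_col n C ` {i<..m} = col C ` (\<lambda>j. residue n j - 1) ` {i<..m}" for C
      by (auto simp: cyc_col_def)
    have T: "(\<lambda>j. residue n j - 1) ` {i<..m} \<subseteq> {..<n}" using r by auto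
    show ?thesis unfolding im unfolding cyc_col_def
      using column_span_iff[OF assms(2) r T] column_span_iff[OF assms(3) r T] assms(4) by simp
  qed
  then show ?thesis by (simp add: first_return_def)
qed

lemma first_return_mat:
  assumes "i \<in> {1..n}" "\<And>l r. k \<le> r \<Longrightarrow> a l r = 0"
  shows "first_return k n (mat k n (\<lambda>(r, c). a (c + 1) r)) i = first_ret n a i"
proof -
  define M where "M = mat k n (\<lambda>(r, c). a (c + 1) r)"
  have n: "0 < n" using assms(1) by auto
  have c: "entry k (cyc_col n M j) = a (residue n j)" for j
    using residue_range[OF n, of j] assms(2) by (auto simp: M_def entry_def cyc_col_def fun_eq_iff not_less)
  have "cyc_col n M i \<in> LinearCombinations.module.span class_ring (module_vec TYPE(real) k) (cyc_col n M ` {i<..m}) \<longleftrightarrow>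
    a i \<in> fv.span (a ` arc n i m)" for m
  proof -
    have car: "cyc_col n M j \<in> carrier_vec k" for j by (auto simp: M_def cyc_col_def intro: carrier_vecI)
    have "a (residue n i) = a i" using residue_le[of i n] assms(1) by simp
    then show ?thesis using car
      by (subst vec_span_iff) (auto simp: image_image c arc_def)
  qed
  then show ?thesis unfolding M_def[symmetric] by (simp add: first_return_def first_ret_def)
qed

lemma row_space_grassmannian:
  assumes M: "M \<in> carrier_mat k n"
    and ind: "\<And>y. (\<And>i. i < n \<Longrightarrow> (\<Sum>r<k. y r * M $$ (r, i)) = 0) \<Longrightarrow> (\<And>r. r < k \<Longrightarrow> y r = 0)"
  shows "vec_space.row_space n M \<in> grassmannian k n"
proof -
  interpret V: vec_space "TYPE(real)" n .
  have rows: "set (rows M) = row M ` {..<k}" using M by (auto simp: rows_def)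
  have car: "set (rows M) \<subseteq> carrier_vec n" using M rows_carrier[of M] by auto
  have inj: "inj_on (row M) {..<k}"
  proof
    fix r r' assume r: "r \<in> {..<k}" "r' \<in> {..<k}" "row M r = row M r'"
    show "r = r'"
    proof (rule ccontr)
      assume ne: "r \<noteq> r'"
      \<comment> \<open>Two equal rows would give a nontrivial relation. So different indices have
        different rows, and the set of rows has \<open>k\<close> elements.\<close>
      let ?y = "\<lambda>x. (if x = r then 1 else 0) - (if x = r' then 1 else 0) :: real"
      have "M $$ (r, i) = M $$ (r', i)" if "i < n" for i
        using r M that by (metis carrier_matD index_row(1) lessThan_iff)
      then have "(\<Sum>x<k. ?y x * M $$ (x, i)) = 0" if "i < n" for i
        using that r by (simp only: left_diff_distrib sum_subtractf sum_unit lessThan_iff)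
      then have "?y r = 0" using ind[of ?y r] r(1) by simp
      then show False using ne by simp
    qed
  qed
  have li: "V.lin_indpt (set (rows M))"
  proof (rule V.finite_lin_indpt2)
    fix u assume u: "V.lincomb u (set (rows M)) = 0\<^sub>v n"
    have "(\<Sum>r<k. u (row M r) * M $$ (r, i)) = 0" if i: "i < n" for i
    proof -
      have "0 = V.lincomb u (set (rows M)) $ i" using u i by (simp add: module_vec_simps)
      also have "\<dots> = (\<Sum>v\<in>set (rows M). u v * v $ i)" using i car by (rule V.lincomb_index)
      also have "\<dots> = (\<Sum>r<k. u (row M r) * row M r $ i)" unfolding rows by (simp add: sum.reindex[OF inj])
      also have "\<dots> = (\<Sum>r<k. u (row M r) * M $$ (r, i))" using M i by (intro sum.cong) auto
      finally show ?thesis by simp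
    qed
    then have "u (row M r) = 0" if "r < k" for r using ind[of "\<lambda>r. u (row M r)"] that by blast
    then show "\<forall>v\<in>set (rows M). u v = 0" unfolding rows by simp
  qed (use car in \<open>simp_all add: module_vec_simps\<close>)
  have "maximal (set (rows M)) (\<lambda>T. T \<subseteq> set (rows M) \<and> V.lin_indpt T)"
    using li by (auto simp: maximal_def)
  then have "vectorspace.dim class_ring ((module_vec TYPE(real) n)\<lparr>carrier := V.row_space M\<rparr>) = card (set (rows M))"
    unfolding V.row_space_def using car by (intro V.dim_span) (simp_all add: module_vec_simps)
  moreover have "card (set (rows M)) = k" unfolding rows by (simp add: card_image[OF inj])
  moreover have "VectorSpace.subspace class_ring (V.row_space M) (module_vec TYPE(real) n)"
    unfolding V.row_space_def using car by (intro V.span_is_subspace) (simp add: module_vec_simps)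
  ultimately show ?thesis by (simp add: grassmannian_def)
qed

lemma det_submatrix_minor:
  assumes "J \<subseteq> {0..<n}" "card J = k"
  shows "\<exists>xs. sorted_wrt (<) xs \<and> set xs \<subseteq> {1..n} \<and> length xs = k \<and>
    det (submatrix (mat k n (\<lambda>(r, c). a (c + 1) r)) UNIV J) = minor k a xs"
proof (intro exI conjI)
  let ?xs = "map (\<lambda>s. pick J s + 1) [0..<k]"
  have pJ: "pick J s \<in> J" if "s < k" for s using that assms(2) pick_in_set_le by blast
  have "pick J s < pick J s'" if "s < s'" "s' < k" for s s' using that assms(2) pick_mono_le by blast
  then show "sorted_wrt (<) ?xs" by (auto simp: sorted_wrt_map sorted_wrt_iff_nth_less)
  show "set ?xs \<subseteq> {1..n}" using pJ assms(1) by force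
  show "length ?xs = k" by simp
  have J: "{j. j < n \<and> j \<in> J} = J" using assms(1) by auto
  have "submatrix (mat k n (\<lambda>(r, c). a (c + 1) r)) UNIV J = mat k k (\<lambda>(r, s). a (?xs ! s) r)"
  proof (rule eq_matI)
    fix r s assume "r < dim_row (mat k k (\<lambda>(r, s). a (?xs ! s) r))" "s < dim_col (mat k k (\<lambda>(r, s). a (?xs ! s) r))"
    then have rs: "r < k" "s < k" by simp_all
    then have "pick J s < n" using pJ assms(1) by force
    then show "submatrix (mat k n (\<lambda>(r, c). a (c + 1) r)) UNIV J $$ (r, s) = mat k k (\<lambda>(r, s). a (?xs ! s) r) $$ (r, s)"
      using rs J assms(2) by (subst submatrix_index) (simp_all add: pick_UNIV)
  qed (use J assms(2) in \<open>simp_all add: dim_submatrix\<close>)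
  then show "det (submatrix (mat k n (\<lambda>(r, c). a (c + 1) r)) UNIV J) = minor k a ?xs"
    by (simp add: minor_def)
qed

lemma positroid_cell_nonempty:
  assumes p: "\<sigma> permutes {1..n}" and k: "card {x \<in> {1..n}. \<sigma> x < x} = k" and n: "0 < n"
  shows "positroid_cell k n (black_decorated n \<sigma>) \<noteq> {}"
proof -
  \<comment> \<open>One period of the bounded affine lift. Fixed points of \<open>\<sigma>\<close>
    remain at \<open>l\<close>, that is black, and the values beyond \<open>n\<close> are those with
    \<open>\<sigma> l < l\<close>.\<close>
  define f where "f l = (if l \<le> \<sigma> l then \<sigma> l else \<sigma> l + n)" for l
  have s: "\<sigma> l \<in> {1..n}" if "l \<in> {1..n}" for l using permutes_in_image[OF p] that by simp
  have res: "residue n (f l) = \<sigma> l" if "l \<in> {1..n}" for l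
    using s[OF that] residue_le[of "\<sigma> l" n] residue_wrap[of n "\<sigma> l + n"] by (simp add: f_def)
  have "l \<le> f l \<and> f l \<le> l + n" if "l \<in> {1..n}" for l using s[OF that] that by (auto simp: f_def)
  moreover have "inj_on (\<lambda>l. residue n (f l)) {1..n}"
    using res permutes_inj_on[OF p] by (subst inj_on_cong[of _ _ \<sigma>]) auto
  ultimately have "bounded_affine n f" by (simp add: bounded_affine_def)
  then obtain a where a: "realized (card {l \<in> {1..n}. n < f l}) n a f" using realized_exists[OF n] by blast
  have "{l \<in> {1..n}. n < f l} = {x \<in> {1..n}. \<sigma> x < x}" using s by (force simp: f_def)
  then have a: "realized k n a f" using a k by simp
  then have a1: "\<And>l r. k \<le> r \<Longrightarrow> a l r = 0"
    and a2: "\<And>y r. (\<And>l. l \<in> {1..n} \<Longrightarrow> (\<Sum>r<k. y r * a l r) = 0) \<Longrightarrow> r < k \<Longrightarrow> y r = 0"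
    and a3: "\<And>xs. sorted_wrt (<) xs \<Longrightarrow> set xs \<subseteq> {1..n} \<Longrightarrow> length xs = k \<Longrightarrow> 0 \<le> minor k a xs"
    and a4: "\<And>l. l \<in> {1..n} \<Longrightarrow> first_ret n a l = f l"
    unfolding realized_def by blast+
  define M where "M = mat k n (\<lambda>(r, c). a (c + 1) r)"
  define V where "V = vec_space.row_space n M"
  have M: "M \<in> carrier_mat k n" by (simp add: M_def)
  have MV: "represents k n M V" using M by (simp add: represents_def V_def)
  have "V \<in> grassmannian k n"
    unfolding V_def
  proof (rule row_space_grassmannian[OF M])
    fix y r assume y: "\<And>i. i < n \<Longrightarrow> (\<Sum>r<k. y r * M $$ (r, i)) = 0" and r: "r < k"
    show "y r = 0"
    proof (rule a2[OF _ r])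
      fix l assume l: "l \<in> {1..n}"
      then have "l - 1 < n" "l - 1 + 1 = l" by auto
      then show "(\<Sum>r<k. y r * a l r) = 0" using y[of "l - 1"] by (simp add: M_def)
    qed
  qed
  moreover have "0 \<le> det (submatrix M UNIV J)" if "J \<subseteq> {0..<n}" "card J = k" for J
    using det_submatrix_minor[OF that, of a] a3 by (auto simp: M_def)
  ultimately have "V \<in> tnn_grassmannian k n" using MV by (auto simp: tnn_grassmannian_def)
  moreover have "space_decorated_perm k n V = black_decorated n \<sigma>"
  proof -
    define A where "A = (SOME A. represents k n A V)"
    have "represents k n A V" unfolding A_def using MV by (rule someI)
    moreover have "first_return k n M i = first_ret n a i" if "i \<in> {1..n}" for i
      unfolding M_def using that a1 by (rule first_return_mat)
    ultimately have "first_return k n A i = f i" if "i \<in> {1..n}" for i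
      using first_return_row_space[OF n _ M, of A i] a4[OF that] that
      by (simp add: represents_def V_def)
    moreover have "f i = i \<longleftrightarrow> \<sigma> i = i" "f i \<noteq> i + n" if "i \<in> {1..n}" for i
      using s[OF that] that by (auto simp: f_def)
    ultimately have "mat_decorated_perm k n A = black_decorated n \<sigma>"
      using res permutes_not_in[OF p] by (auto simp: mat_decorated_perm_def black_decorated_def fun_eq_iff)
    then show ?thesis by (simp add: space_decorated_perm_def A_def)
  qed
  ultimately show ?thesis by (auto simp: positroid_cell_def)
qed

section \<open>Trips under blowing up\<close>

declare One_nat_def [simp del]

text \<open>\<open>z j\<close> is the half-edge at boundary vertex \<open>j\<close>. At the adjacent
  vertex the half-edges are, in clockwise order, \<open>xh\<close> (leading to \<open>j\<close>),
  \<open>eh\<close> and \<open>fh\<close>.\<close>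

definition xh :: "plabic \<Rightarrow> (nat \<Rightarrow> nat) \<Rightarrow> nat \<Rightarrow> nat" where
  "xh G z j = opp G (z j)"

definition eh :: "plabic \<Rightarrow> (nat \<Rightarrow> nat) \<Rightarrow> nat \<Rightarrow> nat" where
  "eh G z j = cw G (xh G z j)"

definition fh :: "plabic \<Rightarrow> (nat \<Rightarrow> nat) \<Rightarrow> nat \<Rightarrow> nat" where
  "fh G z j = cw G (eh G z j)"

definition start_half :: "plabic \<Rightarrow> (nat \<Rightarrow> nat) \<Rightarrow> (nat \<Rightarrow> colour) \<Rightarrow> nat \<Rightarrow> nat" where
  "start_half G z c j = (if c j = Black then fh G z j else eh G z j)"

definition third_half :: "plabic \<Rightarrow> (nat \<Rightarrow> nat) \<Rightarrow> (nat \<Rightarrow> colour) \<Rightarrow> nat \<Rightarrow> nat" where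
  "third_half G z c j = (if c j = Black then eh G z j else fh G z j)"

(* At the vertex adjacent to boundary vertex j, x j is the half-edge leading to j, a trip starting
   at j leaves through start_half, and a trip ending at j enters through third_half. Trips are cut
   into segments at these half-edges. *)
definition marked :: "plabic \<Rightarrow> (nat \<Rightarrow> nat) \<Rightarrow> (nat \<Rightarrow> colour) \<Rightarrow> nat \<Rightarrow> nat set" where
  "marked G z c n = xh G z ` {1..n} \<union> third_half G z c ` {1..n} \<union> start_half G z c ` {1<..<n}"

text \<open>Here \<open>a\<close> and \<open>b\<close> are outgoing half-edges, and
  \<open>opp G a\<close> is the one through which the vertex is entered; a segment stops before it
  enters through a half-edge of \<open>T\<close>.\<close>

definition move :: "plabic \<Rightarrow> nat set \<Rightarrow> nat \<Rightarrow> nat \<Rightarrow> bool" where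
  "move G T a b \<longleftrightarrow> a \<in> halves G \<and> opp G a \<notin> T \<and>
     (\<exists>v. vert G (opp G a) = Internal v \<and> b = turn G v (opp G a))"

locale framed =
  fixes G :: plabic and z :: "nat \<Rightarrow> nat" and c :: "nat \<Rightarrow> colour" and n :: nat
  assumes fin: "finite (halves G)"
    and opp_in: "h \<in> halves G \<Longrightarrow> opp G h \<in> halves G"
    and opp_opp: "h \<in> halves G \<Longrightarrow> opp G (opp G h) = h"
    and cw_bij: "bij_betw (cw G) (halves G) (halves G)"
    and vert_cw: "h \<in> halves G \<Longrightarrow> vert G (cw G h) = vert G h"
    and z_in: "j \<in> {1..n} \<Longrightarrow> z j \<in> halves G"
    and vert_z: "j \<in> {1..n} \<Longrightarrow> vert G (z j) = Boundary j"
    and z_unique: "h \<in> halves G \<Longrightarrow> vert G h = Boundary j \<Longrightarrow> j \<in> {1..n} \<and> h = z j"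
    and tri: "j \<in> {1..n} \<Longrightarrow> \<exists>v. vert G (xh G z j) = Internal v \<and> plabic.col G v = c j \<and>
        {u \<in> halves G. vert G u = Internal v} = {xh G z j, eh G z j, fh G z j} \<and>
        distinct [xh G z j, eh G z j, fh G z j] \<and> cw G (fh G z j) = xh G z j"
    and sep: "i \<in> {1..n} \<Longrightarrow> j \<in> {1..n} \<Longrightarrow> vert G (xh G z i) = vert G (xh G z j) \<Longrightarrow> i = j"
begin

abbreviation "X \<equiv> third_half G z c"
abbreviation "F \<equiv> start_half G z c"
abbreviation "x \<equiv> xh G z"
abbreviation "seg \<equiv> (move G (marked G z c n))\<^sup>*\<^sup>*"

lemma cw_in: "h \<in> halves G \<Longrightarrow> cw G h \<in> halves G"
  using cw_bij by (auto simp: bij_betw_def)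

lemma inv_cw: "h \<in> halves G \<Longrightarrow> the_inv_into (halves G) (cw G) (cw G h) = h"
  using cw_bij by (simp add: bij_betw_def the_inv_into_f_f)

lemma x_in: "j \<in> {1..n} \<Longrightarrow> x j \<in> halves G"
  by (simp add: xh_def opp_in z_in)

lemma e_in: "j \<in> {1..n} \<Longrightarrow> eh G z j \<in> halves G"
  by (simp add: eh_def cw_in x_in)

lemma f_in: "j \<in> {1..n} \<Longrightarrow> fh G z j \<in> halves G"
  by (simp add: fh_def cw_in e_in)

lemma vert_e: "j \<in> {1..n} \<Longrightarrow> vert G (eh G z j) = vert G (x j)"
  by (simp add: eh_def vert_cw x_in)

lemma vert_f: "j \<in> {1..n} \<Longrightarrow> vert G (fh G z j) = vert G (x j)"
  by (simp add: fh_def vert_cw e_in vert_e)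

lemma X_in: "j \<in> {1..n} \<Longrightarrow> X j \<in> halves G" and F_in: "j \<in> {1..n} \<Longrightarrow> F j \<in> halves G"
  by (simp_all add: third_half_def start_half_def e_in f_in)

lemma vert_X: "j \<in> {1..n} \<Longrightarrow> vert G (X j) = vert G (x j)"
  and vert_F: "j \<in> {1..n} \<Longrightarrow> vert G (F j) = vert G (x j)"
  by (simp_all add: third_half_def start_half_def vert_e vert_f)

lemma cw_f: "j \<in> {1..n} \<Longrightarrow> cw G (fh G z j) = x j"
  using tri by blast

text \<open>With the half-edges named according to the colour, the turning rules at black and at
  white vertices become the same 3-cycle.\<close>

lemma turns:
  assumes "j \<in> {1..n}" "vert G (x j) = Internal v"
  shows "turn G v (x j) = F j" "turn G v (F j) = X j" "turn G v (X j) = x j"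
proof -
  have c: "plabic.col G v = c j" using tri[OF assms(1)] assms(2) by auto
  note i = inv_cw[OF x_in[OF assms(1)]] inv_cw[OF e_in[OF assms(1)]] inv_cw[OF f_in[OF assms(1)]]
  have "turn G v (x j) = F j \<and> turn G v (F j) = X j \<and> turn G v (X j) = x j"
  proof (cases "c j")
    case Black
    then show ?thesis using c i cw_f[OF assms(1)]
      by (simp add: turn_def start_half_def third_half_def flip: eh_def fh_def)
  next
    case White
    then show ?thesis using c cw_f[OF assms(1)]
      by (simp add: turn_def start_half_def third_half_def flip: eh_def fh_def)
  qed
  then show "turn G v (x j) = F j" "turn G v (F j) = X j" "turn G v (X j) = x j" by auto
qed

lemma vert_x: "j \<in> {1..n} \<Longrightarrow> \<exists>v. vert G (x j) = Internal v"
  using tri by blast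

lemma opp_x: "j \<in> {1..n} \<Longrightarrow> opp G (x j) = z j"
  by (simp add: xh_def opp_opp z_in)

lemma trip_L: "j \<in> {1..n} \<Longrightarrow> trip G (opp G (X j)) j"
proof -
  assume j: "j \<in> {1..n}"
  obtain v where v: "vert G (x j) = Internal v" using vert_x[OF j] by blast
  show ?thesis
  proof (rule trip.intros(2))
    show "vert G (opp G (opp G (X j))) = Internal v" using v j by (simp add: opp_opp X_in vert_X)
    have "trip G (x j) j" by (rule trip.intros(1)) (use j in \<open>simp add: opp_x vert_z\<close>)
    then show "trip G (turn G v (opp G (opp G (X j)))) j"
      using turns(3)[OF j v] j by (simp add: opp_opp X_in)
  qed
qed

lemma trip_E: "j \<in> {1..n} \<Longrightarrow> trip G (X j) t \<Longrightarrow> trip G (opp G (F j)) t"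
proof -
  assume j: "j \<in> {1..n}" and t: "trip G (X j) t"
  obtain v where v: "vert G (x j) = Internal v" using vert_x[OF j] by blast
  show ?thesis
  proof (rule trip.intros(2))
    show "vert G (opp G (opp G (F j))) = Internal v" using v j by (simp add: opp_opp F_in vert_F)
    show "trip G (turn G v (opp G (opp G (F j)))) t"
      using turns(2)[OF j v] t j by (simp add: opp_opp F_in)
  qed
qed

lemma trip_z: "j \<in> {1..n} \<Longrightarrow> trip G (F j) t \<Longrightarrow> trip G (z j) t"
proof -
  assume j: "j \<in> {1..n}" and t: "trip G (F j) t"
  obtain v where v: "vert G (x j) = Internal v" using vert_x[OF j] by blast
  show ?thesis
  proof (rule trip.intros(2))
    show "vert G (opp G (z j)) = Internal v" using v by (simp add: xh_def)
    show "trip G (turn G v (opp G (z j))) t" using turns(1)[OF j v] t by (simp add: xh_def)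
  qed
qed

lemma trip_seg: "seg h t \<Longrightarrow> trip G t j \<Longrightarrow> trip G h j"
proof (induction rule: converse_rtranclp_induct)
  case (step a b)
  then show ?case by (auto simp: move_def intro: trip.intros(2))
qed

end

lemma trip_unique: "trip G h j \<Longrightarrow> trip G h j' \<Longrightarrow> j = j'"
proof (induction arbitrary: j' rule: trip.induct)
  case (1 h j)
  from 1(2,1) show ?case by (cases rule: trip.cases) auto
next
  case (2 h v j)
  from 2(4,1) 2(3) show ?case by (cases rule: trip.cases) auto
qed

(* A trip ending at v either arrives directly at the vertex adjacent to v (enter = False), or first
   enters at the vertex m at the far end of the run of colours opposite to c v that is adjacent to v,
   and then passes through the whole run (enter = True). *)
definition first_event :: "nat \<Rightarrow> (nat \<Rightarrow> colour) \<Rightarrow> nat \<Rightarrow> nat \<Rightarrow> bool \<Rightarrow> bool" where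
  "first_event n c v m enter \<longleftrightarrow>
     (if enter then 1 < m \<and> m < n \<and>
          (c v = White \<longrightarrow> m < v \<and> c (m - 1) = White \<and> (\<forall>y. m \<le> y \<and> y < v \<longrightarrow> c y = Black)) \<and>
          (c v = Black \<longrightarrow> v < m \<and> c (m + 1) = Black \<and> (\<forall>y. v < y \<and> y \<le> m \<longrightarrow> c y = White))
      else m = v \<and> (c v = White \<longrightarrow> v = 1 \<or> c (v - 1) = White) \<and> (c v = Black \<longrightarrow> v = n \<or> c (v + 1) = Black))"

definition neighbour :: "(nat \<Rightarrow> colour) \<Rightarrow> nat \<Rightarrow> nat" where
  "neighbour c j = (if c j = Black then j + 1 else j - 1)"

(* third says where the segment after a third_half leads, first where the segment after a start_half
   leads; together with the colours these determine all trips, and they are stable under blowing up. *)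
locale tracked = framed +
  fixes p :: "nat \<Rightarrow> nat"
  assumes word: "word n c"
    and perm: "p permutes {1..n}"
    and third: "1 < j \<Longrightarrow> j < n \<Longrightarrow>
      seg (X j) (opp G ((if c (neighbour c j) = c j then F else X) (neighbour c j)))"
    and first: "a \<in> {1..n} \<Longrightarrow> \<exists>m enter. first_event n c (p a) m enter \<and>
      seg (F a) (opp G ((if enter then F else X) m))"
begin

lemma p_in: "a \<in> {1..n} \<Longrightarrow> p a \<in> {1..n}"
  by (simp only: permutes_in_image[OF perm])

lemma trip_white_run:
  assumes "1 < m" "m < v" "v \<le> n" "c v = White" "\<And>y. m \<le> y \<Longrightarrow> y < v \<Longrightarrow> c y = Black"
  shows "trip G (opp G (F m)) v"
  using assms
proof (induction "v - m" arbitrary: m)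
  case (Suc d)
  have m: "m \<in> {1..n}" "c m = Black" "m < n" "v \<in> {1..n}" using Suc.prems by auto
  have s: "seg (X m) (opp G ((if c (m + 1) = Black then F else X) (m + 1)))"
    using third[of m] m Suc.prems(1) by (simp add: neighbour_def)
  have "trip G (X m) v"
  proof (cases "m + 1 = v")
    case True
    then show ?thesis using trip_seg[OF s] trip_L[OF m(4)] Suc.prems(4) by simp
  next
    case False
    then have "trip G (opp G (F (m + 1))) v" "c (m + 1) = Black" using Suc by auto
    then show ?thesis using trip_seg[OF s] by simp
  qed
  then show ?case using trip_E m(1) by blast
qed simp

lemma trip_black_run:
  assumes "m < n" "v < m" "1 \<le> v" "c v = Black" "\<And>y. v < y \<Longrightarrow> y \<le> m \<Longrightarrow> c y = White"
  shows "trip G (opp G (F m)) v"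
  using assms
proof (induction "m - v" arbitrary: m)
  case (Suc d)
  have m: "m \<in> {1..n}" "c m = White" "1 < m" "v \<in> {1..n}" using Suc.prems by auto
  have s: "seg (X m) (opp G ((if c (m - 1) = White then F else X) (m - 1)))"
    using third[of m] m Suc.prems(1) by (simp add: neighbour_def)
  have "trip G (X m) v"
  proof (cases "m - 1 = v")
    case True
    then show ?thesis using trip_seg[OF s] trip_L[OF m(4)] Suc.prems(4) by simp
  next
    case False
    then have "trip G (opp G (F (m - 1))) v" "c (m - 1) = White" using Suc by auto
    then show ?thesis using trip_seg[OF s] by simp
  qed
  then show ?case using trip_E m(1) by blast
qed simp

lemma trip_boundary:
  assumes "a \<in> {1..n}"
  shows "trip G (z a) (p a)"
proof -
  obtain m enter where f: "first_event n c (p a) m enter"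
    and s: "seg (F a) (opp G ((if enter then F else X) m))" using first[OF assms] by blast
  have pa: "p a \<in> {1..n}" using p_in[OF assms] .
  have "trip G (opp G ((if enter then F else X) m)) (p a)"
  proof (cases enter)
    case False
    then show ?thesis using f trip_L pa by (simp add: first_event_def)
  next
    case True
    then show ?thesis using f pa trip_white_run[of m "p a"] trip_black_run[of m "p a"]
      by (cases "c (p a)") (auto simp: first_event_def)
  qed
  then show ?thesis using trip_z trip_seg[OF s] assms by blast
qed

lemma trip_perm_eq: "trip_perm n G = p"
proof
  fix a
  show "trip_perm n G a = p a"
  proof (cases "a \<in> {1..n}")
    case True
    then have "(THE j. \<exists>h\<in>halves G. vert G h = Boundary a \<and> trip G h j) = p a"
      using trip_boundary z_in vert_z z_unique trip_unique
      by (intro the_equality) blast+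
    then show ?thesis using True by (simp add: trip_perm_def)
  next
    case False
    then show ?thesis using permutes_not_in[OF perm False] by (simp only: trip_perm_def if_False)
  qed
qed

end

section \<open>The graph after one blow-up\<close>

locale blown = tracked +
  fixes G' :: plabic and i hx he hf ab ba bc cb cd dc da ad y zn va vb vc vd
  assumes i: "1 < i" "i < n"
    and hx: "hx = x i" and he: "he = eh G z i" and hf: "hf = fh G z i"
    and halves': "halves G' = halves G \<union> {ab, ba, bc, cb, cd, dc, da, ad, y, zn}"
    and fresh: "{ab, ba, bc, cb, cd, dc, da, ad, y, zn} \<inter> halves G = {}"
    and dist: "distinct [ab, ba, bc, cb, cd, dc, da, ad, y, zn]"
    and dist_v: "distinct [va, vb, vc, vd]"
    and fresh_v: "Internal ` {va, vb, vc, vd} \<inter> vert G ` halves G = {}"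
    and opp': "opp G' = (opp G)(ab := ba, ba := ab, bc := cb, cb := bc, cd := dc, dc := cd,
                        da := ad, ad := da, y := zn, zn := y)"
    and cw': "cw G' = (cw G)(he := ab, ab := ad, ad := he,
                      hf := bc, bc := ba, ba := hf,
                      hx := cd, cd := cb, cb := hx,
                      y := da, da := dc, dc := y,
                      zn := zn)"
    and vert': "vert G' = (shift_boundary i \<circ> vert G)
                   (he := Internal va, ab := Internal va, ad := Internal va,
                    hf := Internal vb, bc := Internal vb, ba := Internal vb,
                    hx := Internal vc, cd := Internal vc, cb := Internal vc,
                    y := Internal vd, da := Internal vd, dc := Internal vd,
                    zn := Boundary (i + 1))"
    and col': "plabic.col G' = (plabic.col G)(va := Black, vb := White, vc := Black, vd := White)"
begin

abbreviation "c' \<equiv> blow_col i c"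
definition "z' j = (if j = i + 1 then zn else z (unsh (i + 1) j))"

lemma i_in: "i \<in> {1..n}" using i by simp

lemma h_in: "hx \<in> halves G" "he \<in> halves G" "hf \<in> halves G"
  using i_in by (auto simp: hx he hf x_in e_in f_in)

lemma h_dist: "hx \<noteq> he" "he \<noteq> hf" "hx \<noteq> hf"
  using tri[OF i_in] by (auto simp: hx he hf)

lemma fresh_ne: "h \<in> halves G \<Longrightarrow> h \<noteq> ab \<and> h \<noteq> ba \<and> h \<noteq> bc \<and> h \<noteq> cb \<and> h \<noteq> cd \<and> h \<noteq> dc \<and> h \<noteq> da \<and> h \<noteq> ad \<and> h \<noteq> y \<and> h \<noteq> zn"
  using fresh by blast

lemma dist_rev: "distinct (rev [ab, ba, bc, cb, cd, dc, da, ad, y, zn])"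
  using dist by (simp only: distinct_rev)

lemma ne_fresh: "h \<in> halves G \<Longrightarrow> ab \<noteq> h \<and> ba \<noteq> h \<and> bc \<noteq> h \<and> cb \<noteq> h \<and> cd \<noteq> h \<and> dc \<noteq> h \<and> da \<noteq> h \<and> ad \<noteq> h \<and> y \<noteq> h \<and> zn \<noteq> h"
  using fresh by blast

lemmas ne = dist[simplified] dist_rev[simplified] fresh_ne[OF h_in(1)] fresh_ne[OF h_in(2)] fresh_ne[OF h_in(3)]
  ne_fresh[OF h_in(1)] ne_fresh[OF h_in(2)] ne_fresh[OF h_in(3)] h_dist h_dist[symmetric]

lemma opp'_old: "h \<in> halves G \<Longrightarrow> opp G' h = opp G h"
  using fresh_ne[of h] by (simp add: opp')

lemma opp'_new: "opp G' ab = ba" "opp G' ba = ab" "opp G' bc = cb" "opp G' cb = bc" "opp G' cd = dc"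
  "opp G' dc = cd" "opp G' da = ad" "opp G' ad = da" "opp G' y = zn" "opp G' zn = y"
  by (simp_all add: opp' ne)

lemma cw'_old: "h \<in> halves G \<Longrightarrow> h \<notin> {hx, he, hf} \<Longrightarrow> cw G' h = cw G h"
  using fresh_ne[of h] by (simp add: cw')

lemma cw'_new: "cw G' he = ab" "cw G' ab = ad" "cw G' ad = he" "cw G' hf = bc" "cw G' bc = ba" "cw G' ba = hf"
  "cw G' hx = cd" "cw G' cd = cb" "cw G' cb = hx" "cw G' y = da" "cw G' da = dc" "cw G' dc = y" "cw G' zn = zn"
  by (simp_all add: cw' ne)

lemma vert'_old: "h \<in> halves G \<Longrightarrow> h \<notin> {hx, he, hf} \<Longrightarrow> vert G' h = shift_boundary i (vert G h)"
  using fresh_ne[of h] by (simp add: vert')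

lemma vert'_new: "vert G' he = Internal va" "vert G' ab = Internal va" "vert G' ad = Internal va"
  "vert G' hf = Internal vb" "vert G' bc = Internal vb" "vert G' ba = Internal vb"
  "vert G' hx = Internal vc" "vert G' cd = Internal vc" "vert G' cb = Internal vc"
  "vert G' y = Internal vd" "vert G' da = Internal vd" "vert G' dc = Internal vd"
  "vert G' zn = Boundary (i + 1)"
  by (simp_all add: vert' ne)

lemma col'_old: "h \<in> halves G \<Longrightarrow> vert G h = Internal v \<Longrightarrow> plabic.col G' v = plabic.col G v"
proof -
  assume "h \<in> halves G" "vert G h = Internal v"
  then have "Internal v \<in> vert G ` halves G" by (metis imageI)
  then have "v \<notin> {va, vb, vc, vd}" using fresh_v by blast
  then show ?thesis by (simp add: col')
qed

lemma col'_new: "plabic.col G' va = Black" "plabic.col G' vb = White" "plabic.col G' vc = Black" "plabic.col G' vd = White"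
  using dist_v by (simp_all add: col')

text \<open>All half-edges at the vertices of the square, and the new one at the boundary. The new
  rotation preserves this set as well as its complement, where it agrees with the old one.\<close>

abbreviation "N \<equiv> {he, ab, ad, hf, bc, ba, hx, cd, cb, y, da, dc, zn}"

lemma halves'_split: "halves G' = (halves G - {hx, he, hf}) \<union> N"
  using h_in by (auto simp: halves')

lemma cw_h: "cw G hx = he" "cw G he = hf" "cw G hf = hx"
  using cw_f[OF i_in] by (simp_all add: hx he hf eh_def fh_def)

lemma cw_bij_old: "bij_betw (cw G) (halves G - {hx, he, hf}) (halves G - {hx, he, hf})"
proof -
  have "cw G ` {hx, he, hf} = {hx, he, hf}" using cw_h by auto
  moreover have "inj_on (cw G) (halves G)" "cw G ` halves G = halves G" using cw_bij by (auto simp: bij_betw_def)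
  ultimately show ?thesis using h_in
    by (auto simp: bij_betw_def inj_on_image_set_diff[of _ "halves G"] intro: inj_on_subset)
qed

lemma cw'_bij: "bij_betw (cw G') (halves G') (halves G')"
proof -
  have 1: "bij_betw (cw G') (halves G - {hx, he, hf}) (halves G - {hx, he, hf})"
    using cw_bij_old cw'_old by (subst bij_betw_cong[of _ _ "cw G"]) auto
  have im: "cw G' ` N = N" using cw'_new by auto
  then have "inj_on (cw G') N" by (intro finite_surj_inj) auto
  then have 2: "bij_betw (cw G') N N" using im by (simp add: bij_betw_def)
  show ?thesis unfolding halves'_split
    by (rule bij_betw_combine[OF 1 2]) (use fresh in auto)
qed

lemma inv_cw': "h \<in> halves G' \<Longrightarrow> the_inv_into (halves G') (cw G') (cw G' h) = h"
  using cw'_bij by (simp add: bij_betw_def the_inv_into_f_f)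

lemma turn'_old:
  assumes "h \<in> halves G" "h \<notin> {hx, he, hf}" "vert G h = Internal v"
  shows "turn G' v h = turn G v h"
proof -
  have "h \<in> cw G ` (halves G - {hx, he, hf})"
    using assms bij_betw_imp_surj_on[OF cw_bij_old] by simp
  then obtain g where g: "g \<in> halves G - {hx, he, hf}" "cw G g = h" by blast
  have "cw G' g = h" using g cw'_old by simp
  then have "the_inv_into (halves G') (cw G') h = g" "the_inv_into (halves G) (cw G) h = g"
    using inv_cw'[of g] inv_cw[of g] g by (auto simp: halves')
  then show ?thesis using assms col'_old cw'_old by (simp add: turn_def split: colour.split)
qed

lemma z'_simps: "z' (i + 1) = zn" "j \<noteq> i + 1 \<Longrightarrow> z' j = z (unsh (i + 1) j)" "z' (sh (i + 1) j) = z j"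
  by (auto simp: z'_def)

lemma new_index: "j \<in> {1..n + 1} \<Longrightarrow> j = i \<or> j = i + 1 \<or> (\<exists>k\<in>{1..n}. k \<noteq> i \<and> j = sh (i + 1) k)"
proof -
  assume j: "j \<in> {1..n + 1}"
  have "unsh (i + 1) j \<in> {1..n} \<and> unsh (i + 1) j \<noteq> i \<and> j = sh (i + 1) (unsh (i + 1) j)" if "j \<noteq> i" "j \<noteq> i + 1"
    using j that i by (auto simp: unsh_def sh_def)
  then show ?thesis by blast
qed

lemma old_not_h: "k \<in> {1..n} \<Longrightarrow> k \<noteq> i \<Longrightarrow> h \<in> {x k, eh G z k, fh G z k} \<Longrightarrow> h \<notin> {hx, he, hf}"
proof
  assume k: "k \<in> {1..n}" "k \<noteq> i" and h: "h \<in> {x k, eh G z k, fh G z k}" "h \<in> {hx, he, hf}"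
  have "vert G h = vert G (x k)" using h(1) vert_e[OF k(1)] vert_f[OF k(1)] by auto
  moreover have "vert G h = vert G (x i)"
    using h(2) vert_e[OF i_in] vert_f[OF i_in] by (auto simp: hx he hf)
  ultimately show False using sep[OF k(1) i_in] k(2) by simp
qed

lemma z_not_h: "k \<in> {1..n} \<Longrightarrow> z k \<notin> {hx, he, hf}"
  using vert_z[of k] vert_x[OF i_in] vert_e[OF i_in] vert_f[OF i_in] by (auto simp: hx he hf)

lemma xef'_old:
  assumes "k \<in> {1..n}" "k \<noteq> i"
  shows "xh G' z' (sh (i + 1) k) = x k" "eh G' z' (sh (i + 1) k) = eh G z k" "fh G' z' (sh (i + 1) k) = fh G z k"
proof -
  show 1: "xh G' z' (sh (i + 1) k) = x k"
    using assms by (simp add: xh_def z'_simps opp'_old z_in)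
  show 2: "eh G' z' (sh (i + 1) k) = eh G z k"
    unfolding eh_def 1 by (rule cw'_old) (use assms x_in old_not_h in blast)+
  show "fh G' z' (sh (i + 1) k) = fh G z k"
    unfolding fh_def 2 by (rule cw'_old) (use assms e_in old_not_h in blast)+
qed

lemma sh_i: "sh (i + 1) i = i" by (simp add: sh_def)

lemma xef'_i: "xh G' z' i = hx" "eh G' z' i = cd" "fh G' z' i = cb"
proof -
  show 1: "xh G' z' i = hx"
    using z'_simps(3)[of i] i_in by (simp add: xh_def opp'_old z_in hx sh_i)
  show 2: "eh G' z' i = cd" unfolding eh_def 1 by (rule cw'_new)
  show "fh G' z' i = cb" unfolding fh_def 2 by (rule cw'_new)
qed

lemma xef'_Suc: "xh G' z' (i + 1) = y" "eh G' z' (i + 1) = da" "fh G' z' (i + 1) = dc"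
proof -
  show 1: "xh G' z' (i + 1) = y" by (simp add: xh_def z'_simps(1)[simplified] opp'_new)
  show 2: "eh G' z' (i + 1) = da" unfolding eh_def 1 by (rule cw'_new)
  show "fh G' z' (i + 1) = dc" unfolding fh_def 2 by (rule cw'_new)
qed

lemma c'_simps: "c' i = Black" "c' (i + 1) = White" "k \<noteq> i \<Longrightarrow> c' (sh (i + 1) k) = c k"
  by (auto simp: blow_col_def sh_def)

lemma X'_old: "k \<in> {1..n} \<Longrightarrow> k \<noteq> i \<Longrightarrow> third_half G' z' c' (sh (i + 1) k) = X k"
  and F'_old: "k \<in> {1..n} \<Longrightarrow> k \<noteq> i \<Longrightarrow> start_half G' z' c' (sh (i + 1) k) = F k"
  using xef'_old[of k] c'_simps(3)[of k] by (simp_all add: third_half_def start_half_def)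

lemma X'_i: "third_half G' z' c' i = cd" and F'_i: "start_half G' z' c' i = cb"
  and X'_Suc: "third_half G' z' c' (i + 1) = dc" and F'_Suc: "start_half G' z' c' (i + 1) = da"
  unfolding third_half_def start_half_def c'_simps xef'_i xef'_Suc by simp_all

lemma framed': "framed G' z' c' (n + 1)"
proof
  show "finite (halves G')" using fin by (simp add: halves')
  show "opp G' h \<in> halves G'" if "h \<in> halves G'" for h
    using that opp'_old opp_in opp'_new by (auto simp: halves')
  show "opp G' (opp G' h) = h" if "h \<in> halves G'" for h
    using that opp'_old opp_opp opp_in opp'_new by (auto simp: halves')
  show "bij_betw (cw G') (halves G') (halves G')" by (rule cw'_bij)
  show "vert G' (cw G' h) = vert G' h" if "h \<in> halves G'" for h
  proof (cases "h \<in> N")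
    case True
    then show ?thesis using cw'_new vert'_new by auto
  next
    case False
    then have h: "h \<in> halves G - {hx, he, hf}" using that halves'_split by blast
    then have "cw G h \<in> halves G - {hx, he, hf}" using cw_bij_old by (auto simp: bij_betw_def)
    then show ?thesis using h vert'_old cw'_old vert_cw by simp
  qed
  show z': "z' j \<in> halves G'" if "j \<in> {1..n + 1}" for j
    using new_index[OF that] z'_simps z_in z'_simps(3)[of i] i_in by (auto simp: halves' sh_i)
  show "vert G' (z' j) = Boundary j" if "j \<in> {1..n + 1}" for j
  proof -
    have *: "vert G' (z' (sh (i + 1) k)) = Boundary (sh (i + 1) k)" if "k \<in> {1..n}" for k
      unfolding z'_simps(3) using that z_in[of k] vert_z[of k] z_not_h[of k] vert'_old[of "z k"]
      by (auto simp: sh_def)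
    show ?thesis using new_index[OF that] *[OF i_in] * vert'_new(13) z'_simps(1) by (auto simp: sh_i)
  qed
  show "j \<in> {1..n + 1} \<and> h = z' j" if h: "h \<in> halves G'" "vert G' h = Boundary j" for h j
  proof (cases "h \<in> N")
    case True
    then have "h = zn" "j = i + 1" using h(2) vert'_new by auto
    then show ?thesis using i z'_simps(1) by simp
  next
    case False
    then have o: "h \<in> halves G" "h \<notin> {hx, he, hf}" using h halves'_split by blast+
    then obtain k where k: "vert G h = Boundary k" "j = sh (i + 1) k"
      using vert'_old[OF o] h(2) by (cases "vert G h") (auto simp: sh_def split: if_splits)
    have "k \<in> {1..n}" "h = z k" using z_unique[OF o(1) k(1)] by auto
    then show ?thesis using k z'_simps(3)[of k] by (auto simp: sh_def)
  qed
  have vx: "vert G' (xh G' z' (sh (i + 1) k)) = vert G (x k)" if k: "k \<in> {1..n}" "k \<noteq> i" for k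
    using vert'_old[OF x_in[OF k(1)]] old_not_h[OF k] vert_x[OF k(1)] by (auto simp: xef'_old(1)[OF k])
  have vnew: "Internal v \<notin> vert G ` halves G" if "v \<in> {va, vb, vc, vd}" for v using fresh_v that by blast
  have vin: "vert G (x k) \<in> vert G ` halves G" if k: "k \<in> {1..n}" for k using x_in[OF k] by blast
  show "\<exists>v. vert G' (xh G' z' j) = Internal v \<and> plabic.col G' v = c' j \<and>
        {u \<in> halves G'. vert G' u = Internal v} = {xh G' z' j, eh G' z' j, fh G' z' j} \<and>
        distinct [xh G' z' j, eh G' z' j, fh G' z' j] \<and> cw G' (fh G' z' j) = xh G' z' j"
    if j: "j \<in> {1..n + 1}" for j
  proof -
    consider "j = i" | "j = i + 1" | k where "k \<in> {1..n}" "k \<noteq> i" "j = sh (i + 1) k" using new_index[OF j] by blast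
    then show ?thesis
    proof cases
      case 1
      have "{u \<in> halves G'. vert G' u = Internal vc} = {hx, cd, cb}"
      proof -
        have "vert G' u \<noteq> Internal vc" if "u \<in> halves G - {hx, he, hf}" for u
          using that vert'_old[of u] vnew[of vc] by (cases "vert G u") (auto, metis imageI)
        then show ?thesis unfolding halves'_split using vert'_new dist_v by auto
      qed
      then show ?thesis unfolding 1 xef'_i c'_simps(1)
        by (intro exI[of _ vc]) (simp add: vert'_new col'_new ne cw'_new)
    next
      case 2
      have "{u \<in> halves G'. vert G' u = Internal vd} = {y, da, dc}"
      proof -
        have "vert G' u \<noteq> Internal vd" if "u \<in> halves G - {hx, he, hf}" for u
          using that vert'_old[of u] vnew[of vd] by (cases "vert G u") (auto, metis imageI)
        then show ?thesis unfolding halves'_split using vert'_new dist_v by auto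
      qed
      then show ?thesis unfolding 2 xef'_Suc c'_simps(2)
        by (intro exI[of _ vd]) (simp add: vert'_new col'_new ne cw'_new)
    next
      case 3
      obtain v where v: "vert G (x k) = Internal v" "plabic.col G v = c k"
        "{u \<in> halves G. vert G u = Internal v} = {x k, eh G z k, fh G z k}"
        "distinct [x k, eh G z k, fh G z k]" "cw G (fh G z k) = x k" using tri[OF 3(1)] by blast
      have "v \<notin> {va, vb, vc, vd}" using vnew vin[OF 3(1)] v(1) by metis
      moreover have "vert G' u = Internal v \<longleftrightarrow> vert G u = Internal v" if "u \<in> halves G - {hx, he, hf}" for u
        using that vert'_old[of u] by (cases "vert G u") auto
      moreover have "vert G u \<noteq> Internal v" if "u \<in> {hx, he, hf}" for u
        using v(3) old_not_h[OF 3(1,2)] h_in that by blast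
      ultimately have "{u \<in> halves G'. vert G' u = Internal v} = {u \<in> halves G. vert G u = Internal v}"
        unfolding halves'_split using vert'_new h_in by auto
      moreover have "cw G' (fh G z k) = x k"
        using cw'_old[OF f_in[OF 3(1)] old_not_h[OF 3(1,2)]] v(5) by simp
      moreover have "plabic.col G' v = c k" using col'_old[OF x_in[OF 3(1)] v(1)] v(2) by simp
      ultimately show ?thesis
        using v vx[OF 3(1,2)] unfolding 3(3) xef'_old[OF 3(1,2)] c'_simps(3)[OF 3(2)] by auto
    qed
  qed
  show "j = k" if jk: "j \<in> {1..n + 1}" "k \<in> {1..n + 1}" and e: "vert G' (xh G' z' j) = vert G' (xh G' z' k)" for j k
  proof -
    have vi: "vert G' (xh G' z' i) = Internal vc" "vert G' (xh G' z' (i + 1)) = Internal vd"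
      unfolding xef'_i xef'_Suc by (rule vert'_new)+
    have ne1: "vert G (x l) \<noteq> Internal v" if "l \<in> {1..n}" "v \<in> {vc, vd}" for l v
      using vin[OF that(1)] vnew[of v] that(2) by (metis insertCI insert_iff)
    have ne2: "vert G' (xh G' z' i) \<noteq> vert G' (xh G' z' (i + 1))"
      unfolding vi using dist_v by simp
    have ne3: "vert G' (xh G' z' (sh (i + 1) l)) \<noteq> vert G' (xh G' z' i)"
       "vert G' (xh G' z' (sh (i + 1) l)) \<noteq> vert G' (xh G' z' (i + 1))" if "l \<in> {1..n}" "l \<noteq> i" for l
      unfolding vi vx[OF that] using ne1[OF that(1)] by simp_all
    consider "j = i" | "j = i + 1" | l where "l \<in> {1..n}" "l \<noteq> i" "j = sh (i + 1) l"
      using new_index[OF jk(1)] by blast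
    then show ?thesis
    proof cases
      case 1
      then show ?thesis using new_index[OF jk(2)] e ne2 ne3 by metis
    next
      case 2
      then show ?thesis using new_index[OF jk(2)] e ne2 ne3 by metis
    next
      case 3
      consider "k = i" | "k = i + 1" | m where "m \<in> {1..n}" "m \<noteq> i" "k = sh (i + 1) m"
        using new_index[OF jk(2)] by blast
      then show ?thesis
      proof cases
        case B: 3
        then show ?thesis using 3 e vx[OF 3(1,2)] B(3) vx[OF B(1,2)] sep[OF 3(1) B(1)] by simp
      qed (use 3 e ne3 in metis)+
    qed
  qed
qed

sublocale F': framed G' z' c' "n + 1"
  by (rule framed')

text \<open>\<open>hx\<close> still leads to \<open>i\<close>, but \<open>he\<close> and
  \<open>hf\<close> now sit at the inner vertices \<open>a\<close> and \<open>b\<close>. Segments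
  that stopped there can therefore be continued through the square.\<close>

lemma marked'_old: "marked G' z' c' (n + 1) \<inter> halves G \<subseteq> insert hx (marked G z c n - {he, hf})"
proof
  fix h assume "h \<in> marked G' z' c' (n + 1) \<inter> halves G"
  then have h: "h \<in> marked G' z' c' (n + 1)" "h \<in> halves G" by auto
  from h(1) consider j where "j \<in> {1..n + 1}" "h = xh G' z' j" | j where "j \<in> {1..n + 1}" "h = third_half G' z' c' j"
    | j where "j \<in> {1<..<n + 1}" "h = start_half G' z' c' j" by (auto simp: marked_def)
  then show "h \<in> insert hx (marked G z c n - {he, hf})"
  proof cases
    case 1
    from new_index[OF 1(1)] show ?thesis
    proof (elim disjE bexE conjE)
      fix k assume k: "k \<in> {1..n}" "k \<noteq> i" "j = sh (i + 1) k"
      then have "h = x k" using 1 xef'_old by simp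
      then show ?thesis using k old_not_h[OF k(1,2)] by (auto simp: marked_def)
    qed (use 1 xef'_i xef'_Suc fresh_ne[OF h(2)] in simp_all)
  next
    case 2
    from new_index[OF 2(1)] show ?thesis
    proof (elim disjE bexE conjE)
      fix k assume k: "k \<in> {1..n}" "k \<noteq> i" "j = sh (i + 1) k"
      then have "h = X k" using 2 X'_old by simp
      then show ?thesis using k old_not_h[OF k(1,2), of h] by (auto simp: marked_def third_half_def split: if_splits)
    qed (use 2 X'_i X'_Suc fresh_ne[OF h(2)] in simp_all)
  next
    case 3
    then have "j \<in> {1..n + 1}" by auto
    from new_index[OF this] show ?thesis
    proof (elim disjE bexE conjE)
      fix k assume k: "k \<in> {1..n}" "k \<noteq> i" "j = sh (i + 1) k"
      then have "h = F k" using 3 F'_old by simp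
      moreover have "k \<in> {1<..<n}" using k 3 i by (auto simp: sh_def split: if_splits)
      ultimately show ?thesis using k old_not_h[OF k(1,2), of h] by (auto simp: marked_def start_half_def split: if_splits)
    qed (use 3 F'_i F'_Suc fresh_ne[OF h(2)] in simp_all)
  qed
qed

lemma marked'_new: "marked G' z' c' (n + 1) \<inter> {ab, ba, bc, ad} = {}"
proof -
  have "ab \<notin> halves G" "ba \<notin> halves G" "bc \<notin> halves G" "ad \<notin> halves G" using fresh by auto
  moreover have "h \<in> halves G \<union> {hx, cd, cb, y, da, dc}" if h: "h \<in> marked G' z' c' (n + 1)" for h
  proof -
    have *: "xh G' z' j \<in> halves G \<union> {hx, cd, cb, y, da, dc} \<and> third_half G' z' c' j \<in> halves G \<union> {hx, cd, cb, y, da, dc}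
        \<and> start_half G' z' c' j \<in> halves G \<union> {hx, cd, cb, y, da, dc}" if "j \<in> {1..n + 1}" for j
      using new_index[OF that]
    proof (elim disjE bexE conjE)
      fix k assume k: "k \<in> {1..n}" "k \<noteq> i" "j = sh (i + 1) k"
      then show ?thesis using xef'_old X'_old F'_old x_in X_in F_in by simp
    qed (use xef'_i xef'_Suc X'_i X'_Suc F'_i F'_Suc in simp_all)
    have "{1<..<n + 1} \<subseteq> {1..n + 1}" by auto
    then show ?thesis using h * unfolding marked_def by blast
  qed
  ultimately show ?thesis using ne by blast
qed

abbreviation "seg' \<equiv> F'.seg"

lemma h_marked: "hx \<in> marked G z c n" "he \<in> marked G z c n" "hf \<in> marked G z c n"
proof -
  have "{hx, X i, F i} \<subseteq> marked G z c n" using i i_in by (auto simp: marked_def hx)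
  moreover have "{X i, F i} = {he, hf}" by (auto simp: he hf third_half_def start_half_def)
  ultimately show "hx \<in> marked G z c n" "he \<in> marked G z c n" "hf \<in> marked G z c n" by blast+
qed

text \<open>A step within a segment does not enter through \<open>hx\<close>, \<open>he\<close> or
  \<open>hf\<close>, since these are marked, and so it does not pass the blown-up vertex.\<close>

lemma seg'_old: "seg h t \<Longrightarrow> seg' h t"
proof (induction rule: rtranclp_induct)
  case (step a b)
  obtain v where a: "a \<in> halves G" "opp G a \<notin> marked G z c n" "vert G (opp G a) = Internal v" "b = turn G v (opp G a)"
    using step(2) by (auto simp: move_def)
  have o: "opp G a \<notin> {hx, he, hf}" using a(2) h_marked by blast
  have "opp G a \<notin> marked G' z' c' (n + 1)" using marked'_old a(2) o opp_in[OF a(1)] by blast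
  moreover have "vert G' (opp G a) = Internal v" using vert'_old[OF opp_in[OF a(1)] o] a(3) by simp
  ultimately have "move G' (marked G' z' c' (n + 1)) a b"
    using a turn'_old[OF opp_in[OF a(1)] o a(3)] opp'_old[OF a(1)] by (auto simp: move_def halves')
  then show ?case using step(3) by simp
qed simp

lemma move'I:
  assumes "a \<in> halves G'" "opp G' a \<notin> marked G' z' c' (n + 1)" "vert G' (opp G' a) = Internal v" "turn G' v (opp G' a) = b"
  shows "move G' (marked G' z' c' (n + 1)) a b"
  using assms by (auto simp: move_def)

lemma turn_va: "turn G' va he = ad" "turn G' va ab = he" "turn G' va ad = ab"
  using inv_cw'[of ad] inv_cw'[of he] inv_cw'[of ab] cw'_new col'_new h_in by (auto simp: turn_def halves')

lemma turn_vb: "turn G' vb hf = bc" "turn G' vb bc = ba" "turn G' vb ba = hf"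
  using cw'_new col'_new by (auto simp: turn_def)

text \<open>Coming through \<open>he\<close>, a trip turns at \<open>a\<close> towards
  \<open>d\<close> and arrives there at the start half-edge \<open>da\<close> of
  \<open>i + 1\<close>. In the next lemma it comes through \<open>hf\<close>, turns at
  \<open>b\<close> towards \<open>c\<close> and arrives at the start half-edge \<open>cb\<close> of
  \<open>i\<close>.\<close>

lemma seg'_e: "seg' (opp G he) ad"
proof -
  have "he \<notin> marked G' z' c' (n + 1)" using marked'_old h_in h_dist by blast
  then have "move G' (marked G' z' c' (n + 1)) (opp G he) ad"
    using opp_in[OF h_in(2)] opp_opp[OF h_in(2)] opp'_old[OF opp_in[OF h_in(2)]] vert'_new turn_va
    by (intro move'I[of _ va]) (auto simp: halves')
  then show ?thesis by simp
qed

lemma seg'_f: "seg' (opp G hf) bc"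
proof -
  have "hf \<notin> marked G' z' c' (n + 1)" using marked'_old h_in h_dist by blast
  then have "move G' (marked G' z' c' (n + 1)) (opp G hf) bc"
    using opp_in[OF h_in(3)] opp_opp[OF h_in(3)] opp'_old[OF opp_in[OF h_in(3)]] vert'_new turn_vb
    by (intro move'I[of _ vb]) (auto simp: halves')
  then show ?thesis by simp
qed

text \<open>The trip from \<open>i\<close> leaves the square through \<open>he\<close>, and by the
  next lemma that from \<open>i + 1\<close> through \<open>hf\<close>. One of these is the old start
  half-edge of \<open>i\<close>, continuing the old trip; the other is the old third half-edge and
  belongs to the inserted trip.\<close>

lemma seg'_cb: "seg' cb he"
proof -
  have "move G' (marked G' z' c' (n + 1)) cb ba"
    using marked'_new opp'_new vert'_new turn_vb by (intro move'I[of _ vb]) (auto simp: halves')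
  moreover have "move G' (marked G' z' c' (n + 1)) ba he"
    using marked'_new opp'_new vert'_new turn_va by (intro move'I[of _ va]) (auto simp: halves')
  ultimately show ?thesis by (meson converse_rtranclp_into_rtranclp r_into_rtranclp)
qed

lemma seg'_da: "seg' da hf"
proof -
  have "move G' (marked G' z' c' (n + 1)) da ab"
    using marked'_new opp'_new vert'_new turn_va by (intro move'I[of _ va]) (auto simp: halves')
  moreover have "move G' (marked G' z' c' (n + 1)) ab hf"
    using marked'_new opp'_new vert'_new turn_vb by (intro move'I[of _ vb]) (auto simp: halves')
  ultimately show ?thesis by (meson converse_rtranclp_into_rtranclp r_into_rtranclp)
qed

end

section \<open>Rotation systems of the blown-up graphs\<close>

(* How an event of a segment of G is seen in G': only those at the vertex blown up change. *)
definition follows :: "nat \<Rightarrow> colour \<Rightarrow> nat \<Rightarrow> bool \<Rightarrow> nat \<Rightarrow> bool \<Rightarrow> bool" where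
  "follows i s m enter m' enter' \<longleftrightarrow>
     (if m \<noteq> i then m' = sh (i + 1) m \<and> enter' = enter
      else m' = (if enter = (s = Black) then i else i + 1) \<and> enter')"

lemma blow_col_simps:
  "y < i \<Longrightarrow> blow_col i c y = c y" "blow_col i c i = Black" "blow_col i c (i + 1) = White"
  "i < y \<Longrightarrow> blow_col i c (y + 1) = c y" "i + 1 < y \<Longrightarrow> blow_col i c y = c (y - 1)"
  by (auto simp: blow_col_def)

lemma first_event_TrueI:
  assumes "1 < m" "m < n"
    and "c v = White \<Longrightarrow> m < v \<and> c (m - 1) = White" "\<And>y. c v = White \<Longrightarrow> m \<le> y \<Longrightarrow> y < v \<Longrightarrow> c y = Black"
    and "c v = Black \<Longrightarrow> v < m \<and> c (m + 1) = Black" "\<And>y. c v = Black \<Longrightarrow> v < y \<Longrightarrow> y \<le> m \<Longrightarrow> c y = White"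
  shows "first_event n c v m True"
  unfolding first_event_def if_True using assms by blast

text \<open>Only trips ending at the first white place \<open>w\<close> after \<open>i\<close>
  change their end: their black run contained \<open>i\<close> and is now stopped by the white
  letter at \<open>i + 1\<close>. For the others the run is merely shifted or gains a letter of the
  square.\<close>

lemma first_event_black:
  assumes w: "word n c" and i: "1 < i" "i < n" "c i = Black" and v: "1 \<le> v" "v \<le> n"
    and f: "first_event n c v m enter"
  shows "\<exists>m' enter'. first_event (n + 1) (blow_col i c)
      (transpose (i + 1) (next_white c i + 1) (sh (i + 1) v)) m' enter' \<and> follows i Black m enter m' enter'"
proof -
  define w where "w = next_white c i"
  note nw = word_next_white[OF w i(3,1,2), folded w_def]
  let ?c = "blow_col i c"
  note B = blow_col_simps[where i = i and c = c]
  show ?thesis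
  proof (cases "v = w")
    case True
    have cv: "c v = White" "i < v" using nw True by auto
    have p: "c (v - 1) = Black" using cv True nw(4)[of "v - 1"] i(3) by (cases "v - 1 = i") auto
    have en: enter using f cv i p by (cases enter) (simp_all add: first_event_def)
    then have e: enter "1 < m" "m < v" "c (m - 1) = White" "\<And>y. m \<le> y \<Longrightarrow> y < v \<Longrightarrow> c y = Black"
      using f cv(1) by (simp_all add: first_event_def)
    have mi: "m \<le> i"
    proof (rule ccontr)
      assume "\<not> m \<le> i"
      then have "c (m - 1) = Black" using e(3) True nw(4)[of "m - 1"] i(3) by (cases "m - 1 = i") auto
      then show False using e(4) by simp
    qed
    have "?c y = Black" if "m \<le> y" "y < i + 1" for y
      using that e(5)[of y] cv B by (cases "y = i") auto
    moreover have "?c (m - 1) = White" using e mi B(1)[of "m - 1"] by simp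
    ultimately have "first_event (n + 1) ?c (i + 1) m True"
      using e mi i by (simp add: first_event_def B)
    moreover have "transpose (i + 1) (next_white c i + 1) (sh (i + 1) v) = i + 1"
      using True cv by (simp add: w_def sh_def)
    moreover have "follows i Black m enter m True" using e(1) mi by (simp add: follows_def sh_def)
    ultimately show ?thesis by metis
  next
    case False
    have t: "transpose (i + 1) (next_white c i + 1) (sh (i + 1) v) = sh (i + 1) v"
      using False nw(1) by (auto simp: transpose_def w_def[symmetric] sh_def)
    consider "v = i" | "v < i" | "i < v" by linarith
    then show ?thesis
    proof cases
      case 1
      show ?thesis
      proof (cases enter)
        case True
        then have e: "i < m" "m < n" "c (m + 1) = Black" "\<And>y. i < y \<Longrightarrow> y \<le> m \<Longrightarrow> c y = White"
          using f 1 i by (auto simp: first_event_def)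
        have "?c y = White" if "i < y" "y \<le> m + 1" for y
          using that e(4)[of "y - 1"] B(3) B(5)[of y] by (cases "y = i + 1") auto
        then have "first_event (n + 1) ?c i (m + 1) True"
          using e B(4)[of "m + 1"] i by (simp add: first_event_def B(2))
        then show ?thesis unfolding t using 1 e(1) True by (auto simp: follows_def sh_def)
      next
        case False
        \<comment> \<open>A direct arrival at \<open>i\<close> becomes an entry at
          \<open>i + 1\<close>, a white run of one letter that the square adds next to
          \<open>i\<close>.\<close>
        then have e: "m = i" "c (i + 1) = Black" using f 1 i by (auto simp: first_event_def)
        have "?c y = White" if "i < y" "y \<le> i + 1" for y
          using that B(3) by (cases "y = i + 1") auto
        then have "first_event (n + 1) ?c i (i + 1) True"
          using e B(4)[of "i + 1"] i by (simp add: first_event_def B(2))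
        then show ?thesis unfolding t using 1 e(1) False by (auto simp: follows_def sh_def)
      qed
    next
      case 2
      show ?thesis
      proof (cases enter)
        case True
        have mi: "m < i"
        proof (rule ccontr)
          assume "\<not> m < i"
          then show False using f True i 2 by (cases "c v") (auto simp: first_event_def)
        qed
        have "?c (m + 1) = Black" if "c v = Black"
          using f that True mi B(1)[of "m + 1"] B(2) by (cases "m + 1 = i") (auto simp: first_event_def)
        moreover have 1: "?c v = c v" "?c (m - 1) = c (m - 1)" using mi 2 B(1) by auto
        moreover have "?c y = Black" if "c v = White" "m \<le> y" "y < v" for y
          using f that True 2 B(1)[of y] by (simp add: first_event_def)
        moreover have "?c y = White" if "c v = Black" "v < y" "y \<le> m" for y
          using f that True mi B(1)[of y] by (simp add: first_event_def)
        moreover have "1 < m" "m < n + 1" "c v = White \<Longrightarrow> m < v \<and> c (m - 1) = White" "c v = Black \<Longrightarrow> v < m"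
          using f True by (simp_all add: first_event_def)
        ultimately have "first_event (n + 1) ?c v m True"
          unfolding first_event_def if_True 1 by blast
        then show ?thesis unfolding t using 2 mi True by (auto simp: follows_def sh_def)
      next
        case False
        have "?c (v + 1) = Black" if "c v = Black"
          using f that False 2 i B(1)[of "v + 1"] B(2) by (cases "v + 1 = i") (auto simp: first_event_def)
        then have "first_event (n + 1) ?c v v False"
          using f False 2 i B(1)[of v] B(1)[of "v - 1"] by (auto simp: first_event_def)
        then show ?thesis unfolding t using 2 False f by (auto simp: follows_def sh_def first_event_def)
      qed
    next
      case 3
      show ?thesis
      proof (cases enter)
        case True
        have mi: "i < m"
        proof (rule ccontr)
          assume a: "\<not> i < m"
          then have "c v = White" using f True 3 by (cases "c v") (auto simp: first_event_def)
          moreover then have "\<And>y. i < y \<Longrightarrow> y < v \<Longrightarrow> c y = Black" using f True 3 a by (auto simp: first_event_def)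
          ultimately have "next_white c i = v" using 3 by (intro next_whiteI)
          then show False using False w_def by simp
        qed
        have 1: "?c (v + 1) = c v" "?c (m + 1) = c m" "?c (m + 1 + 1) = c (m + 1)" using mi 3 B(4) by auto
        have 2: "?c m = White" if "c v = White"
          using f that True mi B(3) B(5)[of m] by (cases "m = i + 1") (auto simp: first_event_def)
        have "first_event (n + 1) ?c (v + 1) (m + 1) True"
        proof (rule first_event_TrueI)
          show "1 < m + 1" "m + 1 < n + 1" using f True by (simp_all add: first_event_def)
          show "m + 1 < v + 1 \<and> ?c (m + 1 - 1) = White" if "?c (v + 1) = White"
          proof -
            have cv: "c v = White" using that 1(1) by simp
            then have "m < v" using f True by (simp add: first_event_def)
            then show ?thesis using 2[OF cv] by simp
          qed
          show "v + 1 < m + 1 \<and> ?c (m + 1 + 1) = Black" if "?c (v + 1) = Black"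
            using f True that unfolding 1 by (simp add: first_event_def)
          show "?c y = Black" if "?c (v + 1) = White" "m + 1 \<le> y" "y < v + 1" for y
          proof -
            have "m \<le> y - 1" "y - 1 < v" "i + 1 < y" using that mi by auto
            then show ?thesis using f that(1)[unfolded 1] True B(5)[of y] by (simp add: first_event_def)
          qed
          show "?c y = White" if "?c (v + 1) = Black" "v + 1 < y" "y \<le> m + 1" for y
          proof -
            have "v < y - 1" "y - 1 \<le> m" "i + 1 < y" using that 3 by auto
            then show ?thesis using f that(1)[unfolded 1] True B(5)[of y] by (simp add: first_event_def)
          qed
        qed
        then show ?thesis unfolding t using 3 mi True by (auto simp: follows_def sh_def)
      next
        case False
        have "?c v = White" if "c v = White"
          using f that False 3 i B(5)[of v] B(3) by (cases "v = i + 1") (auto simp: first_event_def)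
        then have "first_event (n + 1) ?c (v + 1) (v + 1) False"
          using f False 3 B(4)[of v] B(4)[of "v + 1"] by (auto simp: first_event_def)
        then show ?thesis unfolding t using 3 False f by (auto simp: follows_def sh_def first_event_def)
      qed
    qed
  qed
qed

text \<open>Mirror image of the black case: the white run of trips ending at the last black place
  \<open>b\<close> before \<open>i\<close> contained \<open>i\<close> and is now stopped by the
  black letter there.\<close>

lemma first_event_white:
  assumes w: "word n c" and i: "1 < i" "i < n" "c i = White" and v: "1 \<le> v" "v \<le> n"
    and f: "first_event n c v m enter"
  shows "\<exists>m' enter'. first_event (n + 1) (blow_col i c)
      (transpose i (prev_black c i) (sh i v)) m' enter' \<and> follows i White m enter m' enter'"
proof -
  define b where "b = prev_black c i"
  note pb = word_prev_black[OF w i(3,1,2), folded b_def]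
  let ?c = "blow_col i c"
  note B = blow_col_simps[where i = i and c = c]
  show ?thesis
  proof (cases "v = b")
    case True
    have cv: "c v = Black" "v < i" using pb True by auto
    have p: "c (v + 1) = White" using cv True pb(4)[of "v + 1"] i(3) by (cases "v + 1 = i") auto
    have en: enter using f cv i p by (cases enter) (simp_all add: first_event_def)
    then have e: enter "m < n" "v < m" "c (m + 1) = Black" "\<And>y. v < y \<Longrightarrow> y \<le> m \<Longrightarrow> c y = White"
      using f cv(1) by (simp_all add: first_event_def)
    have mi: "i \<le> m"
    proof (rule ccontr)
      assume "\<not> i \<le> m"
      then have "c (m + 1) = White" using e(3) True pb(4)[of "m + 1"] i(3) by (cases "m + 1 = i") auto
      then show False using e(4) by simp
    qed
    have "?c y = White" if "i < y" "y \<le> m + 1" for y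
      using that e(5)[of "y - 1"] cv B(3) B(5)[of y] by (cases "y = i + 1") auto
    moreover have "?c (m + 1 + 1) = Black" using e mi B(4)[of "m + 1"] by simp
    ultimately have "first_event (n + 1) ?c i (m + 1) True"
      using e mi i by (simp add: first_event_def B(2))
    moreover have "transpose i (prev_black c i) (sh i v) = i"
      using True cv by (simp add: b_def[symmetric] sh_def)
    moreover have "follows i White m enter (m + 1) True" using e(1) mi by (simp add: follows_def sh_def)
    ultimately show ?thesis by metis
  next
    case False
    have t: "transpose i (prev_black c i) (sh i v) = sh i v"
      using False pb(1) by (auto simp: transpose_def b_def[symmetric] sh_def)
    consider "v = i" | "v < i" | "i < v" by linarith
    then show ?thesis
    proof cases
      case 1
      show ?thesis
      proof (cases enter)
        case True
        then have e: "m < i" "1 < m" "c (m - 1) = White" "\<And>y. m \<le> y \<Longrightarrow> y < i \<Longrightarrow> c y = Black"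
          using f 1 i by (auto simp: first_event_def)
        have "?c y = Black" if "m \<le> y" "y < i + 1" for y
          using that e(4)[of y] B(1)[of y] B(2) by (cases "y = i") auto
        then have "first_event (n + 1) ?c (i + 1) m True"
          using e B(1)[of "m - 1"] i by (simp add: first_event_def B(3))
        then show ?thesis unfolding t using 1 e(1) True by (auto simp: follows_def sh_def)
      next
        case False
        then have e: "m = i" "c (i - 1) = White" using f 1 i by (auto simp: first_event_def)
        have "?c y = Black" if "i \<le> y" "y < i + 1" for y
          using that B(2) by (cases "y = i") auto
        then have "first_event (n + 1) ?c (i + 1) i True"
          using e B(1)[of "i - 1"] i by (simp add: first_event_def B(3))
        then show ?thesis unfolding t using 1 e(1) False by (auto simp: follows_def sh_def)
      qed
    next
      case 3
      show ?thesis
      proof (cases enter)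
        case True
        have mi: "i < m"
        proof (rule ccontr)
          assume "\<not> i < m"
          then show False using f True i 3 by (cases "c v") (auto simp: first_event_def)
        qed
        have 1: "?c (v + 1) = c v" "?c (m + 1) = c m" "?c (m + 1 + 1) = c (m + 1)" using mi 3 B(4) by auto
        have 2: "?c m = White" if "c v = White"
          using f that True mi i B(3) B(5)[of m] by (cases "m = i + 1") (auto simp: first_event_def)
        have "first_event (n + 1) ?c (v + 1) (m + 1) True"
        proof (rule first_event_TrueI)
          show "1 < m + 1" "m + 1 < n + 1" using f True by (simp_all add: first_event_def)
          show "m + 1 < v + 1 \<and> ?c (m + 1 - 1) = White" if "?c (v + 1) = White"
          proof -
            have cv: "c v = White" using that 1(1) by simp
            then have "m < v" using f True by (simp add: first_event_def)
            then show ?thesis using 2[OF cv] by simp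
          qed
          show "v + 1 < m + 1 \<and> ?c (m + 1 + 1) = Black" if "?c (v + 1) = Black"
            using f True that unfolding 1 by (simp add: first_event_def)
          show "?c y = Black" if "?c (v + 1) = White" "m + 1 \<le> y" "y < v + 1" for y
          proof -
            have "m \<le> y - 1" "y - 1 < v" "i + 1 < y" using that mi by auto
            then show ?thesis using f that(1)[unfolded 1] True B(5)[of y] by (simp add: first_event_def)
          qed
          show "?c y = White" if "?c (v + 1) = Black" "v + 1 < y" "y \<le> m + 1" for y
          proof -
            have "v < y - 1" "y - 1 \<le> m" "i + 1 < y" using that 3 by auto
            then show ?thesis using f that(1)[unfolded 1] True B(5)[of y] by (simp add: first_event_def)
          qed
        qed
        then show ?thesis unfolding t using 3 mi True by (auto simp: follows_def sh_def)
      next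
        case False
        have "?c v = White" if "c v = White"
          using f that False 3 i B(5)[of v] B(3) by (cases "v = i + 1") (auto simp: first_event_def)
        then have "first_event (n + 1) ?c (v + 1) (v + 1) False"
          using f False 3 B(4)[of v] B(4)[of "v + 1"] by (auto simp: first_event_def)
        then show ?thesis unfolding t using 3 False f by (auto simp: follows_def sh_def first_event_def)
      qed
    next
      case 2
      show ?thesis
      proof (cases enter)
        case True
        have mi: "m < i"
        proof (rule ccontr)
          assume a: "\<not> m < i"
          then have "c v = Black" using f True 2 by (cases "c v") (auto simp: first_event_def)
          moreover then have "\<And>y. v < y \<Longrightarrow> y < i \<Longrightarrow> c y = White" using f True 2 a by (auto simp: first_event_def)
          ultimately have "prev_black c i = v" using 2 by (intro prev_blackI)
          then show False using False b_def by simp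
        qed
        have "?c (m + 1) = Black" if "c v = Black"
          using f that True mi B(1)[of "m + 1"] B(2) by (cases "m + 1 = i") (auto simp: first_event_def)
        moreover have 1: "?c v = c v" "?c (m - 1) = c (m - 1)" using mi 2 B(1) by auto
        moreover have "?c y = Black" if "c v = White" "m \<le> y" "y < v" for y
          using f that True 2 B(1)[of y] by (simp add: first_event_def)
        moreover have "?c y = White" if "c v = Black" "v < y" "y \<le> m" for y
          using f that True mi B(1)[of y] by (simp add: first_event_def)
        moreover have "1 < m" "m < n + 1" "c v = White \<Longrightarrow> m < v \<and> c (m - 1) = White" "c v = Black \<Longrightarrow> v < m"
          using f True by (simp_all add: first_event_def)
        ultimately have "first_event (n + 1) ?c v m True"
          unfolding first_event_def if_True 1 by blast
        then show ?thesis unfolding t using 2 mi True by (auto simp: follows_def sh_def)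
      next
        case False
        have "?c (v + 1) = Black" if "c v = Black"
          using f that False 2 i B(1)[of "v + 1"] B(2) by (cases "v + 1 = i") (auto simp: first_event_def)
        then have "first_event (n + 1) ?c v v False"
          using f False 2 i B(1)[of v] B(1)[of "v - 1"] by (auto simp: first_event_def)
        then show ?thesis unfolding t using 2 False f by (auto simp: follows_def sh_def first_event_def)
      qed
    qed
  qed
qed

lemma first_event_range: "first_event n c v m enter \<Longrightarrow> 1 \<le> v \<Longrightarrow> v \<le> n \<Longrightarrow> m \<in> {1..n}"
  by (auto simp: first_event_def split: if_splits)

context blown
begin

lemma opp'_X: "k \<in> {1..n} \<Longrightarrow> opp G' (X k) = opp G (X k)" "k \<in> {1..n} \<Longrightarrow> opp G' (F k) = opp G (F k)"
  by (simp_all only: opp'_old X_in F_in)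

lemma h_XF: "c i = Black \<Longrightarrow> X i = he \<and> F i = hf" "c i = White \<Longrightarrow> X i = hf \<and> F i = he"
  by (simp_all add: he hf third_half_def start_half_def)

text \<open>A segment up to \<open>hf\<close> is continued to the start half-edge of
  \<open>i\<close>, one up to \<open>he\<close> to that of \<open>i + 1\<close>. Which of the two is
  meant by \<open>F i\<close> or \<open>X i\<close> depends on the colour of \<open>i\<close>;
  \<open>follows\<close> encodes exactly this.\<close>

lemma seg'_follows:
  assumes m: "m \<in> {1..n}" and f: "follows i (c i) m enter m' enter'"
  shows "seg' (opp G ((if enter then F else X) m)) (opp G' ((if enter' then F'.F else F'.X) m'))"
proof (cases "m = i")
  case False
  then have "m' = sh (i + 1) m" "enter' = enter" using f by (simp_all add: follows_def)
  then show ?thesis using X'_old[OF m False] F'_old[OF m False] opp'_X[OF m] by simp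
next
  case True
  have e: "opp G' (F'.F i) = bc" "opp G' (F'.F (i + 1)) = ad"
    unfolding F'_i F'_Suc by (rule opp'_new)+
  show ?thesis
  proof (cases "enter = (c i = Black)")
    case eq: True
    then have "(if enter then F else X) m = hf" using h_XF True by (cases "c i") auto
    moreover have "m' = i" enter' using f True eq by (simp_all add: follows_def)
    ultimately show ?thesis using seg'_f e by simp
  next
    case ne: False
    then have "(if enter then F else X) m = he" using h_XF True by (cases "c i") auto
    moreover have "m' = i + 1" enter' using f True ne by (auto simp: follows_def)
    ultimately show ?thesis using seg'_e e by simp
  qed
qed

text \<open>Between \<open>i\<close> and \<open>i + 1\<close> the third half-edges are the two
  halves of one edge, so the segment is empty. Elsewhere only a neighbour equal to \<open>i\<close>
  requires a continuation through the square.\<close>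

lemma third':
  assumes j: "1 < j" "j < n + 1"
  shows "seg' (F'.X j) (opp G' ((if c' (neighbour c' j) = c' j then F'.F else F'.X) (neighbour c' j)))"
proof -
  have "j \<in> {1..n + 1}" using j by simp
  then consider "j = i" | "j = i + 1" | k where "k \<in> {1..n}" "k \<noteq> i" "j = sh (i + 1) k" using new_index by blast
  then show ?thesis
  proof cases
    case 1
    have "neighbour c' j = i + 1" "c' (i + 1) \<noteq> c' i" using 1 by (simp_all add: neighbour_def c'_simps)
    moreover have "opp G' (F'.X (i + 1)) = F'.X i" unfolding X'_i X'_Suc by (rule opp'_new)
    ultimately show ?thesis using 1 by simp
  next
    case 2
    have "neighbour c' j = i" "c' (i + 1) \<noteq> c' i" using 2 by (simp_all add: neighbour_def c'_simps)
    moreover have "opp G' (F'.X i) = F'.X (i + 1)" unfolding X'_i X'_Suc by (rule opp'_new)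
    ultimately show ?thesis using 2 by simp
  next
    case 3
    let ?m = "neighbour c k"
    have k: "1 < k" "k < n" using 3 j i by (auto simp: sh_def split: if_splits)
    then have m: "?m \<in> {1..n}" by (auto simp: neighbour_def)
    have ck: "c' j = c k" using c'_simps(3)[OF 3(2)] 3(3) by simp
    note t = seg'_old[OF third[OF k]]
    have F'Xj: "F'.X j = X k" using X'_old[OF 3(1,2)] 3(3) by simp
    show ?thesis
    proof (cases "?m = i")
      case False
      then have "neighbour c' j = sh (i + 1) ?m"
        using 3 ck k i by (auto simp: neighbour_def sh_def)
      moreover have "c' (sh (i + 1) ?m) = c ?m" using c'_simps(3)[OF False] .
      ultimately show ?thesis
        using t ck F'Xj X'_old[OF m False] F'_old[OF m False] opp'_X[OF m]
        by (cases "c ?m = c k") simp_all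
    next
      case True
      have ee: "opp G' (F'.F i) = bc" "opp G' (F'.F (i + 1)) = ad"
        unfolding F'_i F'_Suc by (rule opp'_new)+
      show ?thesis
      proof (cases "c k")
        case Black
        then have "j = k" "k + 1 = i" using True 3 by (auto simp: neighbour_def sh_def)
        then have "neighbour c' j = i" using ck Black by (simp add: neighbour_def)
        moreover have e: "(if c ?m = c k then F else X) ?m = hf"
          unfolding True Black using h_XF by (cases "c i") auto
        have "seg' (X k) bc" using rtranclp_trans[OF t[unfolded e] seg'_f] .
        ultimately show ?thesis using F'Xj ck Black ee c'_simps(1) by simp
      next
        case White
        then have "j = k + 1" "k = i + 1" using True 3 i by (auto simp: neighbour_def sh_def split: if_splits)
        then have "neighbour c' j = i + 1" using ck White by (simp add: neighbour_def)
        moreover have e: "(if c ?m = c k then F else X) ?m = he"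
          unfolding True White using h_XF by (cases "c i") auto
        have "seg' (X k) ad" using rtranclp_trans[OF t[unfolded e] seg'_e] .
        ultimately show ?thesis using F'Xj ck White ee c'_simps(2) by simp
      qed
    qed
  qed
qed

lemma i_not_marked: "c (i + 1) = White \<Longrightarrow> c i = Black \<Longrightarrow> next_white c i = i + 1"
  by (rule next_whiteI) auto

text \<open>The inserted trip starts at \<open>i\<close> for a black and at \<open>i + 1\<close> for
  a white vertex. It leaves through the old third half-edge, and \<open>third\<close> takes it to
  the old neighbour of \<open>i\<close> and thereby into the run that ends at \<open>w\<close> or
  \<open>b\<close>. All other trips follow old segments.\<close>

lemma first':
  assumes a': "a' \<in> {1..n + 1}"
  shows "\<exists>m enter. first_event (n + 1) c' (blow_perm i c p a') m enter \<and>
      seg' (F'.F a') (opp G' ((if enter then F'.F else F'.X) m))"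
proof (cases "c i")
  case Black
  define w where "w = next_white c i"
  note nw = word_next_white[OF word Black i, folded w_def]
  have bp: "blow_perm i c p = transpose (i + 1) (w + 1) \<circ> ins i (i + 1) p"
    using blow_perm_black[where c = c, OF Black w_def[symmetric]] .
  show ?thesis
  proof (cases "a' = i")
    case True
    have "blow_perm i c p a' = w + 1" unfolding bp True by simp
    moreover have "seg' (F'.F a') he" unfolding True F'_i by (rule seg'_cb)
    moreover have "seg' he (opp G ((if c (i + 1) = c i then F else X) (i + 1)))"
      using seg'_old[OF third[OF i]] h_XF Black by (simp add: neighbour_def)
    moreover have "(if c (i + 1) = c i then F else X) (i + 1) = (if c (i + 1) = c i then F'.F else F'.X) (i + 2)"
    proof -
      have "sh (i + 1) (i + 1) = i + 2" by (simp add: sh_def)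
      then show ?thesis using X'_old[of "i + 1"] F'_old[of "i + 1"] i by (cases "c (i + 1) = c i") auto
    qed
    moreover have "opp G ((if c (i + 1) = c i then F else X) (i + 1)) = opp G' ((if c (i + 1) = c i then F else X) (i + 1))"
      using opp'_X[of "i + 1"] i by simp
    moreover have "first_event (n + 1) c' (w + 1) (i + 2) (c (i + 1) = c i)"
    proof (cases "c (i + 1)")
      case c1: Black
      have "i + 1 \<noteq> w" using c1 nw by auto
      then have "i + 2 < w + 1" using nw(1) by simp
      moreover have "c' y = Black" if "i + 2 \<le> y" "y < w + 1" for y
        using that nw(4)[of "y - 1"] by (auto simp: blow_col_def)
      moreover have "c' (w + 1) = White" "c' (i + 2 - 1) = White" using nw by (auto simp: blow_col_def)
      ultimately show ?thesis using Black c1 nw(3) by (simp add: first_event_def)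
    next
      case c1: White
      then have "w = i + 1" using i_not_marked Black w_def by simp
      then show ?thesis using Black c1 by (simp add: first_event_def blow_col_def)
    qed
    ultimately show ?thesis by (metis rtranclp_trans)
  next
    case False
    define a where "a = unsh i a'"
    have a: "a' = sh i a" "a \<in> {1..n}" using False a' i by (auto simp: a_def sh_def unsh_def)
    have s: "seg' (F'.F a') (F a)"
    proof (cases "a = i")
      case True
      then have "a' = i + 1" "F a = hf" using a h_XF Black by (auto simp: sh_def)
      then show ?thesis using seg'_da F'_Suc by simp
    next
      case False
      then have "a' = sh (i + 1) a" using a by (auto simp: sh_def)
      then show ?thesis using F'_old[OF a(2) False] by simp
    qed
    have pa: "1 \<le> p a" "p a \<le> n" using p_in[OF a(2)] by auto
    obtain m enter where f: "first_event n c (p a) m enter"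
      and t: "seg (F a) (opp G ((if enter then F else X) m))" using first[OF a(2)] by blast
    obtain m' enter' where f': "first_event (n + 1) c' (transpose (i + 1) (w + 1) (sh (i + 1) (p a))) m' enter'"
      and fo: "follows i Black m enter m' enter'"
      using first_event_black[OF word i Black pa f] unfolding w_def by blast
    have "blow_perm i c p a' = transpose (i + 1) (w + 1) (sh (i + 1) (p a))" unfolding bp a(1) by simp
    moreover have "seg' (F'.F a') (opp G' ((if enter' then F'.F else F'.X) m'))"
      using s seg'_old[OF t] seg'_follows[OF first_event_range[OF f pa], of enter m' enter'] fo Black
      by (metis rtranclp_trans)
    ultimately show ?thesis using f' by metis
  qed
next
  case White
  define b where "b = prev_black c i"
  note pb = word_prev_black[OF word White i, folded b_def]
  have bp: "blow_perm i c p = transpose i b \<circ> ins (i + 1) i p"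
    using blow_perm_white[where c = c, OF White b_def[symmetric]] .
  show ?thesis
  proof (cases "a' = i + 1")
    case True
    have "blow_perm i c p a' = b" unfolding bp True by simp
    moreover have "seg' (F'.F a') hf" unfolding True F'_Suc by (rule seg'_da)
    moreover have "seg' hf (opp G ((if c (i - 1) = c i then F else X) (i - 1)))"
      using seg'_old[OF third[OF i]] h_XF White by (simp add: neighbour_def)
    moreover have "(if c (i - 1) = c i then F else X) (i - 1) = (if c (i - 1) = c i then F'.F else F'.X) (i - 1)"
    proof -
      have "sh (i + 1) (i - 1) = i - 1" "i - 1 \<in> {1..n}" "i - 1 \<noteq> i" using i by (auto simp: sh_def)
      then show ?thesis using X'_old[of "i - 1"] F'_old[of "i - 1"] by (cases "c (i - 1) = c i") simp_all
    qed
    moreover have "opp G ((if c (i - 1) = c i then F else X) (i - 1)) = opp G' ((if c (i - 1) = c i then F else X) (i - 1))"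
    proof -
      have "i - 1 \<in> {1..n}" using i by auto
      then show ?thesis using opp'_X[of "i - 1"] by simp
    qed
    moreover have "first_event (n + 1) c' b (i - 1) (c (i - 1) = c i)"
    proof (cases "c (i - 1)")
      case c1: White
      have "i - 1 \<noteq> b" using c1 pb by auto
      then have "b < i - 1" using pb(1) by simp
      moreover have "c' y = White" if "b < y" "y \<le> i - 1" for y
        using that pb(4)[of y] i by (auto simp: blow_col_def)
      moreover have "c' b = Black" "c' (i - 1 + 1) = Black" using pb i by (auto simp: blow_col_def)
      ultimately show ?thesis using White c1 pb(3) i by (simp add: first_event_def)
    next
      case c1: Black
      then have "b = i - 1" using pb(1) pb(4)[of "i - 1"] i by (cases "b = i - 1") auto
      then show ?thesis using White c1 i by (simp add: first_event_def blow_col_def)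
    qed
    ultimately show ?thesis by (metis rtranclp_trans)
  next
    case False
    define a where "a = unsh (i + 1) a'"
    have a: "a' = sh (i + 1) a" "a \<in> {1..n}" using False a' i by (auto simp: a_def sh_def unsh_def)
    have s: "seg' (F'.F a') (F a)"
    proof (cases "a = i")
      case True
      then have "a' = i" "F a = he" using a h_XF White by (auto simp: sh_def)
      then show ?thesis using seg'_cb F'_i by simp
    next
      case False
      then show ?thesis using F'_old[OF a(2) False] a(1) by simp
    qed
    have pa: "1 \<le> p a" "p a \<le> n" using p_in[OF a(2)] by auto
    obtain m enter where f: "first_event n c (p a) m enter"
      and t: "seg (F a) (opp G ((if enter then F else X) m))" using first[OF a(2)] by blast
    obtain m' enter' where f': "first_event (n + 1) c' (transpose i b (sh i (p a))) m' enter'"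
      and fo: "follows i White m enter m' enter'"
      using first_event_white[OF word i White pa f] unfolding b_def by blast
    have "blow_perm i c p a' = transpose i b (sh i (p a))" unfolding bp a(1) by simp
    moreover have "seg' (F'.F a') (opp G' ((if enter' then F'.F else F'.X) m'))"
      using s seg'_old[OF t] seg'_follows[OF first_event_range[OF f pa], of enter m' enter'] fo White
      by (metis rtranclp_trans)
    ultimately show ?thesis using f' by metis
  qed
qed

lemma tracked': "tracked G' z' c' (n + 1) (blow_perm i c p)"
proof
  show "word (n + 1) c'" by (rule word_blow[OF word i])
  show "blow_perm i c p permutes {1..n + 1}" by (rule blow_perm_permutes[OF word i perm])
qed (use third' first' in auto)

end

section \<open>All graphs obtained from the square are tracked\<close>

lemma blow_up_tracked:
  assumes "tracked G z c n p" "1 < i" "i < n" "blow_up i s G G'"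
  shows "s = c i \<and> (\<exists>z'. tracked G' z' (blow_col i c) (n + 1) (blow_perm i c p))"
  using assms(4)
proof cases
  case (1 h x v e f ab ba bc cb cd dc da ad y z0 a b c0 d)
  interpret tracked G z c n p by (rule assms(1))
  have ii: "i \<in> {1..n}" using assms by simp
  have h: "h = z i" using z_unique[OF 1(1,2)] by simp
  have x: "x = xh G z i" using 1 h by (simp add: xh_def)
  have e: "e = eh G z i" using 1 x by (simp add: eh_def)
  have f: "f = fh G z i" using 1 e by (simp add: fh_def)
  have "s = c i" using tri[OF ii] 1 x by auto
  moreover have "blown G z c n p G' i x e f ab ba bc cb cd dc da ad y z0 a b c0 d"
    by unfold_locales (use assms 1 x e f in \<open>simp_all only: plabic.simps\<close>)
  then have "tracked G' (blown.z' z i z0) (blow_col i c) (n + 1) (blow_perm i c p)"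
    by (rule blown.tracked')
  ultimately show ?thesis by blast
qed

lemma blow_up_exists:
  assumes "tracked G z c n p" "1 < i" "i < n"
  shows "\<exists>G'. blow_up i (c i) G G'"
proof -
  interpret tracked G z c n p by (rule assms(1))
  have ii: "i \<in> {1..n}" using assms by simp
  obtain M where M: "\<And>h. h \<in> halves G \<Longrightarrow> h < M" using fin by (meson finite_nat_set_iff_bounded)
  have "finite {v. Internal v \<in> vert G ` halves G}"
    by (rule finite_vimageI[of "vert G ` halves G" Internal, unfolded vimage_def]) (use fin in \<open>auto simp: inj_def\<close>)
  then obtain V where V: "\<And>v. Internal v \<in> vert G ` halves G \<Longrightarrow> v < V" by (auto simp: finite_nat_set_iff_bounded)
  obtain v where v: "vert G (x i) = Internal v" "plabic.col G v = c i"
     "{u \<in> halves G. vert G u = Internal v} = {x i, eh G z i, fh G z i}"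
     "distinct [x i, eh G z i, fh G z i]" "cw G (fh G z i) = x i" using tri[OF ii] by blast
  show ?thesis
  proof (rule exI, rule blow_up.intros[where h = "z i" and x = "x i" and v = v and e = "eh G z i" and f = "fh G z i"
      and ab = M and ba = "M + 1" and bc = "M + 2" and cb = "M + 3" and cd = "M + 4" and dc = "M + 5"
      and da = "M + 6" and ad = "M + 7" and y = "M + 8" and z = "M + 9"
      and a = V and b = "V + 1" and c = "V + 2" and d = "V + 3"])
    show "{M, M + 1, M + 2, M + 3, M + 4, M + 5, M + 6, M + 7, M + 8, M + 9} \<inter> halves G = {}"
      using M by fastforce
    show "Internal ` {V, V + 1, V + 2, V + 3} \<inter> vert G ` halves G = {}"
      using V by fastforce
  qed (use v z_in[OF ii] vert_z[OF ii] in \<open>auto simp: xh_def eh_def fh_def\<close>)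
qed


lemma square_graph_tracked:
  assumes "square_graph G"
  shows "\<exists>z. tracked G z col0 4 perm0"
  using assms
proof cases
  case (1 ab ba bc cb cd dc da ad xa xb xc xd za zb zc zd a b c d)
  note one = One_nat_def
  define z where "z j = (if j = 1 then za else if j = 2 then zb else if j = 3 then zc else zd)" for j :: nat
  have J: "{1..4} = {1, 2, 3, 4 :: nat}" by auto
  note d1 = 1(1)[simplified] 
  have d2: "distinct (rev [ab, ba, bc, cb, cd, dc, da, ad, xa, xb, xc, xd, za, zb, zc, zd])"
    using 1(1) by (simp only: distinct_rev)
  have d3: "distinct (rev [a, b, c, d])" using 1(10) by (simp only: distinct_rev)
  note dd = d1 d2[simplified] 1(10)[simplified] d3[simplified]
  have o: "opp G ab = ba" "opp G ba = ab" "opp G bc = cb" "opp G cb = bc" "opp G cd = dc" "opp G dc = cd"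
    "opp G da = ad" "opp G ad = da" "opp G xa = za" "opp G xb = zb" "opp G xc = zc" "opp G xd = zd"
    "opp G za = xa" "opp G zb = xb" "opp G zc = xc" "opp G zd = xd"
    using 1(3,4) by simp_all
  have w: "cw G xa = ab" "cw G ab = ad" "cw G ad = xa" "cw G xb = bc" "cw G bc = ba" "cw G ba = xb"
    "cw G xc = cd" "cw G cd = cb" "cw G cb = xc" "cw G xd = da" "cw G da = dc" "cw G dc = xd"
    "cw G za = za" "cw G zb = zb" "cw G zc = zc" "cw G zd = zd"
    using 1(5-9) by simp_all
  have v: "vert G xa = Internal a" "vert G ab = Internal a" "vert G ad = Internal a"
    "vert G xb = Internal b" "vert G bc = Internal b" "vert G ba = Internal b"
    "vert G xc = Internal c" "vert G cd = Internal c" "vert G cb = Internal c"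
    "vert G xd = Internal d" "vert G da = Internal d" "vert G dc = Internal d"
    "vert G za = Boundary 1" "vert G zb = Boundary 2" "vert G zc = Boundary 3" "vert G zd = Boundary 4"
    using 1(11-15) by (simp_all add: numeral_eq_Suc)
  have cl: "plabic.col G a = White" "plabic.col G b = Black" "plabic.col G c = White" "plabic.col G d = Black"
    using 1(16) by simp_all
  note H = 1(2)
  have zz: "z 1 = za" "z 2 = zb" "z 3 = zc" "z 4 = zd" by (simp_all add: z_def)
  have x: "xh G z 1 = xa" "xh G z 2 = xb" "xh G z 3 = xc" "xh G z 4 = xd"
    by (simp_all only: xh_def zz o)
  have e: "eh G z 1 = ab" "eh G z 2 = bc" "eh G z 3 = cd" "eh G z 4 = da"
    by (simp_all only: eh_def x w)
  have f: "fh G z 1 = ad" "fh G z 2 = ba" "fh G z 3 = cb" "fh G z 4 = dc"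
    by (simp_all only: fh_def e w)
  have c0: "col0 1 = White" "col0 2 = Black" "col0 3 = White" "col0 4 = Black"
    by (simp_all add: col0_def)
  have p0: "perm0 1 = 3" "perm0 2 = 4" "perm0 3 = 1" "perm0 4 = 2" by (simp_all add: perm0_def)
  have im: "cw G ` halves G = halves G" unfolding H by (simp add: w) blast
  then have inj: "inj_on (cw G) (halves G)" using H by (intro finite_surj_inj) auto
  have fr: "framed G z col0 4"
  proof
    show "finite (halves G)" by (simp add: H)
    show "opp G h \<in> halves G" "opp G (opp G h) = h" "vert G (cw G h) = vert G h" if "h \<in> halves G" for h
      using that unfolding H by (auto simp: o w v)
    show "bij_betw (cw G) (halves G) (halves G)" using inj im by (simp add: bij_betw_def)
    show "z j \<in> halves G" "vert G (z j) = Boundary j" if "j \<in> {1..4}" for j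
      using that unfolding J H by (auto simp: zz v)
    show "j \<in> {1..4} \<and> h = z j" if "h \<in> halves G" "vert G h = Boundary j" for h j
      using that unfolding J H by (auto simp: zz v)
    show "\<exists>v. vert G (xh G z j) = Internal v \<and> plabic.col G v = col0 j \<and>
        {u \<in> halves G. vert G u = Internal v} = {xh G z j, eh G z j, fh G z j} \<and>
        distinct [xh G z j, eh G z j, fh G z j] \<and> cw G (fh G z j) = xh G z j" if "j \<in> {1..4}" for j
    proof -
      have "{u \<in> halves G. vert G u = Internal a} = {xa, ab, ad}" "{u \<in> halves G. vert G u = Internal b} = {xb, bc, ba}"
        "{u \<in> halves G. vert G u = Internal c} = {xc, cd, cb}" "{u \<in> halves G. vert G u = Internal d} = {xd, da, dc}"
        unfolding H by (auto simp: v dd)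
      then show ?thesis using that unfolding J by (auto simp: x e f v cl c0 w dd)
    qed
    show "i = j" if "i \<in> {1..4}" "j \<in> {1..4}" "vert G (xh G z i) = vert G (xh G z j)" for i j
      using that unfolding J by (auto simp: x v dd)
  qed
  interpret framed G z col0 4 by (rule fr)
  have X: "X 1 = ad" "X 2 = bc" "X 3 = cb" "X 4 = da" by (simp_all only: third_half_def c0 e f if_True if_False colour.simps refl)
  have F: "F 1 = ab" "F 2 = ba" "F 3 = cd" "F 4 = dc" by (simp_all only: start_half_def c0 e f if_True if_False colour.simps refl)
  have m: "marked G z col0 4 = {xa, xb, xc, xd, ad, bc, cb, da, ba, cd}"
  proof -
    have "{1<..<4} = {2, 3 :: nat}" by auto
    then show ?thesis unfolding marked_def J by (auto simp: x X F)
  qed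
  have "tracked G z col0 4 perm0"
  proof
    show "word 4 col0" "perm0 permutes {1..4}" by (rule word_col0 perm0_permutes)+
    show "seg (X j) (opp G ((if col0 (neighbour col0 j) = col0 j then F else X) (neighbour col0 j)))"
      if "1 < j" "j < 4" for j
    proof -
      have n: "neighbour col0 2 = 3" "neighbour col0 3 = 2" by (simp_all add: neighbour_def c0)
      have "j = 2 \<or> j = 3" using that by auto
      then show ?thesis by (auto simp: n c0 X o)
    qed
    have iv: "the_inv_into (halves G) (cw G) xd = dc" "the_inv_into (halves G) (cw G) dc = da"
    proof -
      have "dc \<in> halves G" "da \<in> halves G" by (simp_all add: H)
      then show "the_inv_into (halves G) (cw G) xd = dc" "the_inv_into (halves G) (cw G) dc = da"
        using inv_cw[of dc] inv_cw[of da] unfolding w by blast+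
    qed
    \<comment> \<open>The trips from 2 and 3 pass the vertices next to 1 and 4 through the start
      half-edges \<open>ab\<close> and \<open>dc\<close>. These are not marked, because the first
      and the last place are never blown up.\<close>
    have s2: "seg ba ad"
    proof -
      have "move G (marked G z col0 4) ba ad"
        unfolding move_def m by (simp add: H o v turn_def cl w dd)
      then show ?thesis by simp
    qed
    have s3: "seg cd da"
    proof -
      have "move G (marked G z col0 4) cd da"
        unfolding move_def m by (simp add: H o v turn_def cl iv[unfolded H] dd)
      then show ?thesis by simp
    qed
    show "\<exists>m enter. first_event 4 col0 (perm0 a) m enter \<and> seg (F a) (opp G ((if enter then F else X) m))"
      if a: "a \<in> {1..4}" for a
    proof -
      have e1: "first_event 4 col0 3 2 True" unfolding first_event_def by (auto simp: col0_def)
      have e2: "first_event 4 col0 4 4 False" unfolding first_event_def by (auto simp: col0_def)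
      have e3: "first_event 4 col0 1 1 False" unfolding first_event_def by (auto simp: col0_def)
      have e4: "first_event 4 col0 2 3 True" unfolding first_event_def by (auto simp: col0_def)
      consider "a = 1" | "a = 2" | "a = 3" | "a = 4" using a by force
      then show ?thesis
      proof cases
        case 1
        then show ?thesis using e1 by (intro exI[of _ 2] exI[of _ True]) (simp add: p0 F o)
      next
        case 2
        then show ?thesis using e2 s2 by (intro exI[of _ 4] exI[of _ False]) (simp add: p0 F X o)
      next
        case 3
        then show ?thesis using e3 s3 by (intro exI[of _ 1] exI[of _ False]) (simp add: p0 F X o)
      next
        case 4
        then show ?thesis using e4 by (intro exI[of _ 3] exI[of _ True]) (simp add: p0 F X o)
      qed
    qed
  qed
  then show ?thesis by blast
qed

lemma square_graph_exists: "\<exists>G. square_graph G"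
proof -
  let ?G = "\<lparr>halves = {0, 1, 2, 3, 4, 5, 6, 7, 8, 9, 10, 11, 12, 13, 14, 15}, opp = (\<lambda>h. [1, 0, 3, 2, 5, 4, 7, 6, 12, 13, 14, 15, 8, 9, 10, 11] ! h),
    cw = (\<lambda>h. [7, 9, 1, 10, 3, 11, 5, 8, 0, 2, 4, 6, 12, 13, 14, 15] ! h),
    vert = (\<lambda>h. [Internal 0, Internal 1, Internal 1, Internal 2, Internal 2, Internal 3, Internal 3, Internal 0,
      Internal 0, Internal 1, Internal 2, Internal 3, Boundary 1, Boundary 2, Boundary 3, Boundary 4] ! h),
    col = (\<lambda>v. [White, Black, White, Black] ! v)\<rparr>"
  have "square_graph ?G"
    by (rule square_graph.intros[of 0 1 2 3 4 5 6 7 8 9 10 11 12 13 14 15 _ 0 1 2 3])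
      (simp_all add: numeral_3_eq_3)
  then show ?thesis by blast
qed

lemma bcfw_graph_state:
  "bcfw_graph n k G \<Longrightarrow> \<exists>c p. bcfw_state n k c p \<and> trip_perm n G = p"
proof -
  have "bcfw_graph n k G \<Longrightarrow> \<exists>c p z. bcfw_state n k c p \<and> tracked G z c n p"
  proof (induction rule: bcfw_graph.induct)
    case (square G)
    then show ?case using square_graph_tracked bcfw_state.base by blast
  next
    case (black n k G i G')
    then obtain c p z where s: "bcfw_state n k c p" "tracked G z c n p" by blast
    have i: "1 < i" "i < n" using black by auto
    have "c i = Black" "\<exists>z'. tracked G' z' (blow_col i c) (n + 1) (blow_perm i c p)"
      using blow_up_tracked[OF s(2) i black(3)] by auto
    then show ?case using bcfw_state.blow[OF s(1) i] by auto
  next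
    case (white n k G i G')
    then obtain c p z where s: "bcfw_state n k c p" "tracked G z c n p" by blast
    have i: "1 < i" "i < n" using white by auto
    have "c i = White" "\<exists>z'. tracked G' z' (blow_col i c) (n + 1) (blow_perm i c p)"
      using blow_up_tracked[OF s(2) i white(3)] by auto
    then show ?case using bcfw_state.blow[OF s(1) i] by auto
  qed
  then show "bcfw_graph n k G \<Longrightarrow> \<exists>c p. bcfw_state n k c p \<and> trip_perm n G = p"
    using tracked.trip_perm_eq by blast
qed

lemma bcfw_state_graph:
  "bcfw_state n k c p \<Longrightarrow> \<exists>G. bcfw_graph n k G \<and> trip_perm n G = p"
proof -
  have "bcfw_state n k c p \<Longrightarrow> \<exists>G z. bcfw_graph n k G \<and> tracked G z c n p"
  proof (induction rule: bcfw_state.induct)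
    case base
    then show ?case using square_graph_exists square_graph_tracked bcfw_graph.square by blast
  next
    case (blow n k c f i)
    then obtain G z where G: "bcfw_graph n k G" "tracked G z c n f" by blast
    obtain G' where G': "blow_up i (c i) G G'" using blow_up_exists[OF G(2) blow(2,3)] by blast
    have i: "i \<in> {1..n} - {1, n}" using blow by auto
    obtain z' where "tracked G' z' (blow_col i c) (n + 1) (blow_perm i c f)"
      using blow_up_tracked[OF G(2) blow(2,3) G'] by blast
    then show ?case
      using bcfw_graph.black[OF G(1) i, of G'] bcfw_graph.white[OF G(1) i, of G'] G' 
      by (cases "c i") auto
  qed
  then show "bcfw_state n k c p \<Longrightarrow> \<exists>G. bcfw_graph n k G \<and> trip_perm n G = p"
    using tracked.trip_perm_eq by blast
qed

section \<open>The bijection\<close>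

lemma bcfw_perms_path_state:
  "bcfw_perms n k = {black_decorated n (back2 n f) |p q f. path_state n k p q f}"
proof (intro subset_antisym subsetI)
  fix x assume "x \<in> bcfw_perms n k"
  then obtain G where G: "bcfw_graph n (k + 2) G" "x = black_decorated n (back2 n (trip_perm n G))"
    by (auto simp: bcfw_perms_def back2_def)
  from bcfw_graph_state[OF G(1)] obtain c where "tail_state n (k + 2) c (trip_perm n G)"
    by (auto simp: bcfw_state_eq_tail_state)
  from tail_state_path_state[OF this] obtain p q where "path_state n k p q (trip_perm n G)" by auto
  then show "x \<in> {black_decorated n (back2 n f) |p q f. path_state n k p q f}" using G(2) by blast
next
  fix x assume "x \<in> {black_decorated n (back2 n f) |p q f. path_state n k p q f}"
  then obtain p q f where f: "path_state n k p q f" "x = black_decorated n (back2 n f)" by blast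
  have "bcfw_state n (k + 2) (path_col q) f"
    using path_state_tail_state[OF f(1)] by (simp add: bcfw_state_eq_tail_state)
  from bcfw_state_graph[OF this] obtain G where "bcfw_graph n (k + 2) G" "trip_perm n G = f" by blast
  then show "x \<in> bcfw_perms n k" using f(2) unfolding bcfw_perms_def back2_def by blast
qed

theorem theorem6p3:
  fixes n k :: nat
  assumes "k + 4 \<le> n"
  shows "bij_betw (diagram_cell k n) (D_diagrams n k) (bcfw_cells n k)"
proof -
  have cell: "diagram_cell k n (Omega_LD n k (p, q)) = positroid_cell k n (black_decorated n (back2 n f))"
    if "path_state n k p q f" for p q f
    using Omega_decorated_perm[OF that] by (simp add: diagram_cell_def)
  have D: "D_diagrams n k = {Omega_LD n k (p, q) |p q f. path_state n k p q f}"
    using path_state_path_pairs path_pairs_path_state[OF _ assms] unfolding D_diagrams_def by fast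
  have "inj_on (diagram_cell k n) (D_diagrams n k)"
  proof
    fix d d'
    assume d: "d \<in> D_diagrams n k" "d' \<in> D_diagrams n k" "diagram_cell k n d = diagram_cell k n d'"
    obtain p q f where f: "d = Omega_LD n k (p, q)" "path_state n k p q f" using d(1) D by blast
    obtain p' q' f' where f': "d' = Omega_LD n k (p', q')" "path_state n k p' q' f'" using d(2) D by blast
    have "back2 n f permutes {1..n}" using back2_permutes[OF path_state_permutes[OF f(2)]] assms by simp
    \<comment> \<open>A point common to two cells forces their permutations to be equal; two empty
      cells would be equal for any permutations.\<close>
    then obtain V where "V \<in> positroid_cell k n (black_decorated n (back2 n f))"
      using positroid_cell_nonempty[OF _ path_state_count[OF f(2)]] assms by fastforce
    moreover have "V \<in> positroid_cell k n (black_decorated n (back2 n f'))"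
      using calculation d(3) cell[OF f(2)] cell[OF f'(2)] f(1) f'(1) by simp
    ultimately have "black_decorated n (back2 n f) = black_decorated n (back2 n f')"
      by (simp add: positroid_cell_def)
    then have "back2 n f = back2 n f'" by (simp add: black_decorated_def)
    then have "f = f'" using back2_inject[of n f f'] assms by linarith
    then have "p = p' \<and> q = q'" using path_state_inject[OF f(2)] f'(2) by simp
    then show "d = d'" using f(1) f'(1) by simp
  qed
  moreover have "diagram_cell k n ` D_diagrams n k = bcfw_cells n k"
  proof (intro subset_antisym subsetI)
    fix S assume "S \<in> diagram_cell k n ` D_diagrams n k"
    then obtain d where d: "d \<in> D_diagrams n k" "S = diagram_cell k n d" by blast
    from d(1) obtain p q f where "path_state n k p q f" "d = Omega_LD n k (p, q)" unfolding D by blast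
    then have "path_state n k p q f" "S = diagram_cell k n (Omega_LD n k (p, q))" using d(2) by simp_all
    then show "S \<in> bcfw_cells n k" using cell unfolding bcfw_cells_def bcfw_perms_path_state by blast
  next
    fix S assume "S \<in> bcfw_cells n k"
    then obtain p q f where "path_state n k p q f" "S = positroid_cell k n (black_decorated n (back2 n f))"
      unfolding bcfw_cells_def bcfw_perms_path_state by blast
    then have "Omega_LD n k (p, q) \<in> D_diagrams n k" "S = diagram_cell k n (Omega_LD n k (p, q))"
      using cell D by blast+
    then show "S \<in> diagram_cell k n ` D_diagrams n k" by blast
  qed
  ultimately show ?thesis by (simp add: bij_betw_def)
qed

end
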